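(* Let $T$ be the classical staircase transformation on $[0,1)$ and let $p,q$ be two rationally independent positive numbers. Let $f:[0,1)\to\{p,q\}$ be a $2$-wise constant function, attaining the values $p$ and $q$ on complementary intervals. Then the suspension flow $([0,1),T,f,\mu)$ is mixing.
   Context: Staircase transformations (rank-one cutting and stacking). Fix a cutting sequence of positive integers $(r_n)_{n\ge1}$ and an initial interval $J=[0,a)$ (the non-spacer interval), forming column $C_0$ with $h_0=1$ level. Given column $C_{n-1}$ of $h_{n-1}$ disjoint equal-length intervals (levels) stacked on one another, cut it vertically into $r_n$ subcolumns of equal width; on top of the $i$-th subcolumn ($1\le i\le r_n$, left to right) place $i-1$ new intervals ("spacers") of the same width, taken consecutively from $[a,\infty)$ right after previously used spacer material; stack the $(i+1)$-th subcolumn on top of the $i$-th. This gives column $C_n$ of height $h_n=r_nh_{n-1}+\sum_{i=1}^{r_n}(i-1)$. $T$ maps each non-top level of $C_n$ by translation onto the level above; $a$ is chosen so that $J$ plus all spacers has total length $1$, so $T$ is defined a.e. on $[0,1)$; $[0,a)$ is the non-spacer part and $[a,1)$ the spacer part. The classical staircase is the case $r_n=n$. A $2$-wise constant function (relative to $T$): $f$ takes two rationally independent values $p>q>0$, with $f=p$ on the non-spacer part and $f=q$ on the spacer part. Suspension flow $([0,1),T,f,\mu)$: the space $X=\{(x,y):x\in[0,1),\,0\le y<f(x)\}$ with Lebesgue (area) measure $\mu$; the flow moves $(x,y)$ vertically at unit speed, $\phi_t(x,y)=(x,y+t)$ while $y+t<f(x)$, and a point reaching $(x,f(x))$ is sent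 to $(T(x),0)$. The flow is mixing if $\nu(\phi_{-t}A\cap B)\to\nu(A)\nu(B)$ as $t\to\infty$ for all measurable $A,B\subseteq X$, where $\nu=\mu/\mu(X)$. *)

theory Defs
  imports "HOL-Analysis.Analysis"
begin

fun uwidth :: "(nat \<Rightarrow> nat) \<Rightarrow> nat \<Rightarrow> real" where
  "uwidth r 0 = 1"
| "uwidth r (Suc n) = uwidth r n / real (r (Suc n))"

text \<open>Length a of the non-spacer interval [0,a), chosen so that J plus all spacers has length 1.
  At stage n (n >= 1) exactly 0 + 1 + ... + (r n - 1) spacers of the current width are added.\<close>
definition stair_a :: "(nat \<Rightarrow> nat) \<Rightarrow> real" where
  "stair_a r = 1 / (1 + (\<Sum>n. uwidth r (Suc n) * real ((r (Suc n) * (r (Suc n) - 1)) div 2)))"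

definition width :: "(nat \<Rightarrow> nat) \<Rightarrow> nat \<Rightarrow> real" where
  "width r n = stair_a r * uwidth r n"

definition spacer_used :: "(nat \<Rightarrow> nat) \<Rightarrow> nat \<Rightarrow> real" where
  "spacer_used r n = (\<Sum>k\<in>{1..n}. width r k * real ((r k * (r k - 1)) div 2))"

text \<open>Left endpoints of the levels of column C_n, listed from bottom to top; each level of C_n is
  the interval [x, x + width r n).  Subcolumn i (0-based, left to right) of C_n is shifted by
  i * width r (n+1); on top of it the i new spacers are placed, taken consecutively from
  [a + spacer_used r n, ...).\<close>
fun levels :: "(nat \<Rightarrow> nat) \<Rightarrow> nat \<Rightarrow> real list" where
  "levels r 0 = [0]"
| "levels r (Suc n) =
     concat (map (\<lambda>i. map (\<lambda>x. x + real i * width r (Suc n)) (levels r n)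
                     @ map (\<lambda>k. stair_a r + spacer_used r n
                                 + real ((i * (i - 1)) div 2 + k) * width r (Suc n)) [0..<i])
                 [0..<r (Suc n)])"

definition in_level :: "(nat \<Rightarrow> nat) \<Rightarrow> nat \<Rightarrow> nat \<Rightarrow> real \<Rightarrow> bool" where
  "in_level r n j x \<longleftrightarrow> Suc j < length (levels r n)
      \<and> levels r n ! j \<le> x \<and> x < levels r n ! j + width r n"

text \<open>The cutting-and-stacking transformation: translate a non-top level onto the level above.
  (Defined a.e.; on the remaining null set it is set to the identity.)\<close>
definition cs_map :: "(nat \<Rightarrow> nat) \<Rightarrow> real \<Rightarrow> real" where
  "cs_map r x = (if \<exists>n j. in_level r n j x
     then (case SOME nj. in_level r (fst nj) (snd nj) x of
             (n, j) \<Rightarrow> x - levels r n ! j + levels r n ! Suc j)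
     else x)"

definition staircase_r :: "nat \<Rightarrow> nat" where
  "staircase_r n = n"

definition staircase :: "real \<Rightarrow> real" where
  "staircase = cs_map staircase_r"

definition birkhoff_sum :: "(real \<Rightarrow> real) \<Rightarrow> (real \<Rightarrow> real) \<Rightarrow> nat \<Rightarrow> real \<Rightarrow> real" where
  "birkhoff_sum T f n x = (\<Sum>i<n. f ((T ^^ i) x))"

definition susp_space :: "(real \<Rightarrow> real) \<Rightarrow> (real \<times> real) set" where
  "susp_space f = {(x, y). 0 \<le> x \<and> x < 1 \<and> 0 \<le> y \<and> y < f x}"

text \<open>The flow phi_t for t >= 0: move up at unit speed, jumping from (x, f x) to (T x, 0).\<close>
definition susp_flow ::
  "(real \<Rightarrow> real) \<Rightarrow> (real \<Rightarrow> real) \<Rightarrow> real \<Rightarrow> real \<times> real \<Rightarrow> real \<times> real" where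
  "susp_flow T f t z = (case z of (x, y) \<Rightarrow>
     (let k = (LEAST k. y + t < birkhoff_sum T f (Suc k) x)
      in ((T ^^ k) x, y + t - birkhoff_sum T f k x)))"

definition susp_mixing :: "(real \<Rightarrow> real) \<Rightarrow> (real \<Rightarrow> real) \<Rightarrow> bool" where
  "susp_mixing T f \<longleftrightarrow>
     (let X = susp_space f;
          \<nu> = (\<lambda>S. measure lebesgue S / measure lebesgue X)
      in \<forall>A B. A \<in> sets lebesgue \<longrightarrow> B \<in> sets lebesgue \<longrightarrow> A \<subseteq> X \<longrightarrow> B \<subseteq> X \<longrightarrow>
           ((\<lambda>t. \<nu> ({z \<in> X. susp_flow T f t z \<in> A} \<inter> B)) \<longlongrightarrow> \<nu> A * \<nu> B) at_top)"

definition rationally_independent :: "real \<Rightarrow> real \<Rightarrow> bool" where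
  "rationally_independent p q \<longleftrightarrow>
     (\<forall>m n :: int. real_of_int m * p + real_of_int n * q = 0 \<longrightarrow> m = 0 \<and> n = 0)"

end

theory Submission
  imports Defs "HOL-Real_Asymp.Real_Asymp"
begin

text \<open>
  The suspension is a rank-one flow whose \<open>n\<close>-th tower is cut into \<open>n + 1\<close> subcolumns with spacers of total
  height \<open>i * q\<close> over the \<open>i\<close>-th. Correlations of functions of the tower height are correlations of functions
  on the line. Flowing for a time close to \<open>k\<close> tower heights delays the \<open>i\<close>-th subcolumn by a constant plus
  \<open>i * k * q\<close>, so the correlation is an average over \<open>i\<close> of translates by multiples of \<open>k * q\<close>, and mixing
  follows once these averages are small uniformly in \<open>k\<close>. For \<open>k = 1\<close> this is ergodicity of the time-\<open>q\<close> map: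
  modulo \<open>q\<close>, successive copies of a tower start at multiples of its height, an irrational rotation. It gives
  decay of correlations at times close to a tower height; for general \<open>k\<close> one averages over shifts by multiples
  of \<open>k * q\<close> close to several consecutive tower heights, as in Adams' proof for the staircase map.
\<close>

text \<open>The obstacle is uniformity. Up to time \<open>H (n + 1)\<close> the stride
  \<open>k * q\<close> occurs with every \<open>k \<le> n + 1\<close>, so \<open>k\<close> grows
  with the stage, and ergodicity of each single time-\<open>k * q\<close> map gives no common rate.
  The way out is that correlations near a tower height are small in every higher tower. A few
  multiples of the stride, each dwarfing the previous one, have all their differences near tower
  heights, and small pairwise correlations bound the L2 norm of the sum of the corresponding
  translates. Factorial growth of the heights leaves room for such multiples well below
  \<open>n\<close> strides.

  A second point is the choice of the mean-zero function. A constant function on the suspension does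
  not vanish on later spacers, so its profiles violate the recursion of \<open>tow_seq\<close>. The
  mean is therefore subtracted relative to one fixed tower, and that tower is compared with the
  whole space at the end. Rational independence enters as irrationality of \<open>p / q\<close>:
  modulo \<open>q\<close> every tower height is a positive multiple of \<open>p\<close>, so the
  rotations by tower heights stay irrational.\<close>

section \<open>Irrational rotations\<close>

text \<open>Sums of \<open>frac - 1/2\<close> along steps \<open>\<delta>\<close> almost telescope, since \<open>\<Phi>\<close> is a continuous periodic primitive.
  The floor difference counts the wrap-arounds.\<close>

lemma frac_potential_step:
  fixes y \<delta> :: real
  defines "\<Phi> \<equiv> \<lambda>z::real. ((frac z)\<^sup>2 - frac z) / 2"
  assumes "0 < \<delta>" "\<delta> < 1"
  shows "\<bar>\<Phi> (y + \<delta>) - \<Phi> y - \<delta> * (frac y - 1/2)\<bar>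
           \<le> \<delta>\<^sup>2 / 2 + \<delta> * real_of_int (\<lfloor>y + \<delta>\<rfloor> - \<lfloor>y\<rfloor>)"
proof (cases "frac y + \<delta> < 1")
  case True
  have fl: "\<lfloor>y + \<delta>\<rfloor> = \<lfloor>y\<rfloor>"
    using True assms by (simp add: frac_def floor_eq_iff) linarith
  then have "frac (y + \<delta>) = frac y + \<delta>" by (simp add: frac_def)
  then have "\<Phi> (y + \<delta>) - \<Phi> y - \<delta> * (frac y - 1/2) = \<delta>\<^sup>2 / 2"
    unfolding \<Phi>_def by (simp add: power2_eq_square field_simps)
  then have "\<bar>\<Phi> (y + \<delta>) - \<Phi> y - \<delta> * (frac y - 1/2)\<bar> = \<delta>\<^sup>2 / 2"
    by (simp only:) simp
  with fl show ?thesis by simp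
next
  case False
  have fl: "\<lfloor>y + \<delta>\<rfloor> = \<lfloor>y\<rfloor> + 1"
    using False assms frac_lt_1[of y] by (simp add: frac_def floor_eq_iff)
  then have fr: "frac (y + \<delta>) = frac y + \<delta> - 1" by (simp add: frac_def)
  have "\<Phi> (y + \<delta>) - \<Phi> y - \<delta> * (frac y - 1/2) = \<delta>\<^sup>2 / 2 + (1 - frac y - \<delta>)"
    unfolding \<Phi>_def fr by (simp add: power2_eq_square field_simps)
  moreover have "1 - frac y - \<delta> \<le> 0" "- \<delta> \<le> 1 - frac y - \<delta>"
    using False frac_lt_1[of y] by auto
  moreover have "0 \<le> \<delta>\<^sup>2" by simp
  moreover have "\<delta> * real_of_int (\<lfloor>y + \<delta>\<rfloor> - \<lfloor>y\<rfloor>) = \<delta>" using fl by simp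
  ultimately show ?thesis by linarith
qed

text \<open>Division of the telescoped estimate by \<delta>: the bounded potential at the two ends
  gives \<open>1 / \<delta>\<close>, the quadratic errors and the at most
  \<open>R * \<delta> + 1\<close> wrap-arounds give the rest.\<close>

lemma frac_arith_progression_pos:
  fixes x \<delta> :: real
  assumes "0 < \<delta>" "\<delta> < 1"
  shows "\<bar>\<Sum>r<R. frac (x + real r * \<delta>) - 1/2\<bar> \<le> 1 / \<delta> + 2 * real R * \<delta> + 1"
proof -
  define \<Phi> where "\<Phi> z = ((frac z)\<^sup>2 - frac z) / 2" for z :: real
  define y where "y r = x + real r * \<delta>" for r
  have y_Suc: "y r + \<delta> = y (Suc r)" for r by (simp add: y_def algebra_simps)
  have \<Phi>_bd: "\<bar>\<Phi> z\<bar> \<le> 1/2" for z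
  proof -
    have "0 \<le> frac z" "frac z \<le> 1" using frac_lt_1[of z] by (auto intro: less_imp_le)
    then have "0 \<le> frac z * frac z" "frac z * frac z \<le> 1" by (auto intro: mult_le_one)
    then have "\<bar>frac z * frac z - frac z\<bar> \<le> 1"
      using \<open>0 \<le> frac z\<close> \<open>frac z \<le> 1\<close> by linarith
    then show ?thesis unfolding \<Phi>_def by (simp add: power2_eq_square)
  qed
  have step: "\<bar>\<Phi> (y (Suc r)) - \<Phi> (y r) - \<delta> * (frac (y r) - 1/2)\<bar>
      \<le> \<delta>\<^sup>2 / 2 + \<delta> * (real_of_int \<lfloor>y (Suc r)\<rfloor> - real_of_int \<lfloor>y r\<rfloor>)" for r
    using frac_potential_step[OF assms, of "y r"] unfolding \<Phi>_def y_Suc by simp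
  have "\<bar>\<Sum>r<R. (\<Phi> (y (Suc r)) - \<Phi> (y r)) - \<delta> * (frac (y r) - 1/2)\<bar>
     \<le> (\<Sum>r<R. \<delta>\<^sup>2 / 2 + \<delta> * (real_of_int \<lfloor>y (Suc r)\<rfloor> - real_of_int \<lfloor>y r\<rfloor>))"
    by (rule order_trans[OF sum_abs]) (intro sum_mono step)
  also have "\<dots> = real R * (\<delta>\<^sup>2 / 2) + \<delta> * (real_of_int \<lfloor>y R\<rfloor> - real_of_int \<lfloor>y 0\<rfloor>)"
    by (simp add: sum.distrib sum_distrib_left[symmetric] sum_lessThan_telescope[of "\<lambda>r. real_of_int \<lfloor>y r\<rfloor>"])
  also have "\<dots> \<le> real R * (\<delta>\<^sup>2 / 2) + \<delta> * (real R * \<delta> + 1)"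
    using assms by (intro add_mono mult_left_mono) (auto simp: y_def, linarith)
  finally have "\<bar>(\<Phi> (y R) - \<Phi> (y 0)) - \<delta> * (\<Sum>r<R. frac (y r) - 1/2)\<bar>
     \<le> real R * (\<delta>\<^sup>2 / 2) + \<delta> * (real R * \<delta> + 1)"
    by (simp only: sum_subtractf[of "\<lambda>r. \<Phi> (y (Suc r)) - \<Phi> (y r)"] sum_lessThan_telescope[of "\<lambda>r. \<Phi> (y r)"]
          sum_distrib_left)
  then have "\<bar>\<delta> * (\<Sum>r<R. frac (y r) - 1/2)\<bar> \<le> 1 + real R * (\<delta>\<^sup>2 / 2) + \<delta> * (real R * \<delta> + 1)"
    using \<Phi>_bd[of "y R"] \<Phi>_bd[of "y 0"] by linarith
  also have "\<dots> \<le> \<delta> * (1 / \<delta> + 2 * real R * \<delta> + 1)"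
    using assms by (simp add: algebra_simps power2_eq_square)
  finally show ?thesis using assms by (simp add: abs_mult y_def)
qed

lemma frac_arith_progression:
  fixes x \<delta> :: real
  assumes "\<delta> \<noteq> 0" "\<bar>\<delta>\<bar> < 1"
  shows "\<bar>\<Sum>r<R. frac (x + real r * \<delta>) - 1/2\<bar> \<le> 1 / \<bar>\<delta>\<bar> + 2 * real R * \<bar>\<delta>\<bar> + 1"
proof (cases "\<delta> > 0")
  case True
  then show ?thesis using frac_arith_progression_pos[of \<delta>] assms by simp
next
  case False
  then have d: "0 < - \<delta>" "- \<delta> < 1" using assms by auto
  \<comment> \<open>A progression with negative step is read backwards from its last point.\<close>
  have "(\<Sum>r<R. frac (x + real r * \<delta>) - 1/2)
      = (\<Sum>r<R. frac ((x + (real R - 1) * \<delta>) + real r * (- \<delta>)) - 1/2)"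
    by (subst sum.nat_diff_reindex[symmetric], rule sum.cong)
       (auto simp: algebra_simps of_nat_diff Suc_le_eq)
  then show ?thesis using frac_arith_progression_pos[OF d, of _ R] False by simp
qed

lemma sum_blocks:
  fixes \<phi> :: "nat \<Rightarrow> 'a::comm_monoid_add"
  shows "(\<Sum>k<R * n. \<phi> k) = (\<Sum>r<R. \<Sum>s<n. \<phi> (r * n + s))"
proof -
  have "(\<Sum>k = r * n..<r * n + n. \<phi> k) = (\<Sum>s<n. \<phi> (r * n + s))" for r
    by (rule sum.reindex_bij_witness[of _ "\<lambda>s. r * n + s" "\<lambda>k. k - r * n"]) auto
  then show ?thesis by (simp add: sum.nat_group[symmetric])
qed

text \<open>Dirichlet approximation gives a positive \<open>n \<le> N\<close> with
  \<open>n * \<beta>\<close> within \<open>1 / N\<close> of an integer, at nonzero distance by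
  irrationality. Along each residue class modulo \<open>n\<close> the orbit is then an arithmetic
  progression of small step modulo 1, and no bound depends on \<open>x\<close>.\<close>

lemma irrational_rotation_uniform:
  fixes \<beta> :: real
  assumes "\<beta> \<notin> \<rat>"
  shows "uniform_limit UNIV (\<lambda>K x. (\<Sum>k<K. frac (x + real k * \<beta>) - 1/2) / real K) (\<lambda>_. 0) sequentially"
  unfolding uniform_limit_sequentially_iff
proof (intro allI impI)
  fix \<epsilon> :: real assume \<epsilon>: "\<epsilon> > 0"
  define N where "N = nat \<lceil>4 / \<epsilon>\<rceil> + 2"
  have N: "N > 0" "4 / \<epsilon> \<le> real N" "real N \<ge> 2" unfolding N_def by (auto, linarith)
  obtain h m where hm: "0 < m" "m \<le> int N" "\<bar>of_int m * \<beta> - of_int h\<bar> < 1 / real N"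
    using Dirichlet_approx[OF N(1), of \<beta>] by blast
  define \<delta> where "\<delta> = of_int m * \<beta> - of_int h"
  define n where "n = nat m"
  have n: "n > 0" "real n = of_int m" using hm by (auto simp: n_def)
  have "\<delta> \<noteq> 0"
  proof
    assume "\<delta> = 0"
    then have "\<beta> = of_int h / of_int m" using hm by (simp add: \<delta>_def field_simps)
    then show False using assms by simp
  qed
  moreover have "\<bar>\<delta>\<bar> < 1 / real N" using hm by (simp add: \<delta>_def)
  moreover have "1 / real N \<le> \<epsilon> / 4" using N \<epsilon> by (simp add: field_simps)
  moreover have "1 / real N < 1" using N by simp
  ultimately have \<delta>: "\<delta> \<noteq> 0" "\<bar>\<delta>\<bar> < 1" "\<bar>\<delta>\<bar> \<le> \<epsilon> / 4" by auto
  \<comment> \<open>\<open>C\<close> gathers what does not grow with \<open>K\<close>: the ends of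
    the \<open>n\<close> progressions and the fewer than \<open>n\<close> points after the last full
    block.\<close>
  define C where "C = real n * (1 / \<bar>\<delta>\<bar> + 1) + real n"
  have "C \<ge> 0" unfolding C_def by simp
  show "\<exists>N. \<forall>K\<ge>N. \<forall>x\<in>UNIV. dist ((\<Sum>k<K. frac (x + real k * \<beta>) - 1/2) / real K) 0 < \<epsilon>"
  proof (intro exI allI impI ballI)
    fix K x
    assume "nat \<lceil>4 * C / \<epsilon>\<rceil> + 1 \<le> K"
    then have K: "4 * C / \<epsilon> \<le> real K" "0 < real K" by linarith+
    define \<phi> where "\<phi> k = frac (x + real k * \<beta>) - 1/2" for k
    have \<phi>1: "\<bar>\<phi> k\<bar> \<le> 1" for k
      using frac_lt_1[of "x + real k * \<beta>"] frac_ge_0[of "x + real k * \<beta>"]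
      unfolding \<phi>_def by linarith
    define R where "R = K div n"
    have split: "{..<K} = {..<R * n} \<union> {R * n..<K}" "R * n \<le> K"
    proof -
      show "R * n \<le> K" unfolding R_def by (simp add: div_times_less_eq_dividend)
      then show "{..<K} = {..<R * n} \<union> {R * n..<K}" by auto
    qed
    have "\<bar>\<Sum>k<R * n. \<phi> k\<bar> = \<bar>\<Sum>s<n. \<Sum>r<R. \<phi> (r * n + s)\<bar>"
      unfolding sum_blocks by (subst sum.swap) simp
    also have "\<dots> \<le> (\<Sum>s<n. 1 / \<bar>\<delta>\<bar> + 2 * real R * \<bar>\<delta>\<bar> + 1)"
    proof (rule order_trans[OF sum_abs], rule sum_mono)
      fix s
      have "\<phi> (r * n + s) = frac ((x + real s * \<beta>) + real r * \<delta>) - 1/2" for r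
      proof -
        have "x + real (r * n + s) * \<beta> = (x + real s * \<beta>) + real r * \<delta> + of_int (int r * h)"
          unfolding \<delta>_def using n by (simp add: algebra_simps)
        then show ?thesis unfolding \<phi>_def by (simp only: frac_def floor_add_int[symmetric] of_int_add)
      qed
      then show "\<bar>\<Sum>r<R. \<phi> (r * n + s)\<bar> \<le> 1 / \<bar>\<delta>\<bar> + 2 * real R * \<bar>\<delta>\<bar> + 1"
        using frac_arith_progression[OF \<delta>(1,2)] by simp
    qed
    also have "\<dots> = real n * (1 / \<bar>\<delta>\<bar> + 1) + 2 * (real R * real n) * \<bar>\<delta>\<bar>"
      by (simp add: algebra_simps)
    also have "\<dots> \<le> real n * (1 / \<bar>\<delta>\<bar> + 1) + 2 * real K * (\<epsilon> / 4)"
      using split(2) \<delta> by (intro add_mono mult_mono order_refl) (auto simp flip: of_nat_mult)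
    finally have 1: "\<bar>\<Sum>k<R * n. \<phi> k\<bar> \<le> real n * (1 / \<bar>\<delta>\<bar> + 1) + \<epsilon> / 2 * real K" by simp
    have "\<bar>\<Sum>k=R * n..<K. \<phi> k\<bar> \<le> (\<Sum>k=R * n..<K. 1)"
      by (rule order_trans[OF sum_abs]) (intro sum_mono \<phi>1)
    also have "\<dots> \<le> real n"
    proof -
      have "K - R * n < n" unfolding R_def using n by (simp add: minus_div_mult_eq_mod)
      then show ?thesis by simp
    qed
    finally have 2: "\<bar>\<Sum>k=R * n..<K. \<phi> k\<bar> \<le> real n" .
    have "(\<Sum>k<K. \<phi> k) = (\<Sum>k<R * n. \<phi> k) + (\<Sum>k=R * n..<K. \<phi> k)"
      unfolding split(1) by (rule sum.union_disjoint) auto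
    then have "\<bar>\<Sum>k<K. \<phi> k\<bar> \<le> C + \<epsilon> / 2 * real K"
      using 1 2 unfolding C_def by linarith
    also have "C \<le> \<epsilon> / 4 * real K" using K \<epsilon> by (simp add: field_simps)
    also have "\<epsilon> / 4 * real K + \<epsilon> / 2 * real K < \<epsilon> * real K" using K \<epsilon> by simp
    finally show "dist ((\<Sum>k<K. frac (x + real k * \<beta>) - 1/2) / real K) 0 < \<epsilon>"
      using K unfolding \<phi>_def by (simp add: pos_divide_less_eq)
  qed
qed

section \<open>Equidistribution of periodizations modulo the spacer height\<close>

lemma integral_shift:
  fixes \<psi> :: "real \<Rightarrow> real"
  shows "integral\<^sup>L lborel (\<lambda>y. \<psi> (y + t)) = integral\<^sup>L lborel \<psi>"
  using lborel_integral_real_affine[of 1 \<psi> t] by (simp add: add.commute)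

lemma integrable_shift:
  fixes \<psi> :: "real \<Rightarrow> real"
  shows "integrable lborel (\<lambda>y. \<psi> (y + t)) \<longleftrightarrow> integrable lborel \<psi>"
  using lborel_integrable_real_affine_iff[of 1 \<psi> t] by (simp add: add.commute)

text \<open>For \<psi> supported in \<open>[0, h)\<close>, \<open>G s\<close> is the sum of \<psi>
  over all points congruent to \<open>s\<close> modulo \<open>q\<close>, read off from finite sums:
  the two inequalities say that the sampled points cover the support. The limit is the mean of
  \<open>G\<close> over one period. Uniformity in \<open>s\<close> is asked for because the sums
  over copies of a tower start at arbitrary phases.\<close>

definition periodization :: "real \<Rightarrow> real \<Rightarrow> real \<Rightarrow> (real \<Rightarrow> real) \<Rightarrow> (real \<Rightarrow> real) \<Rightarrow> bool" where
  "periodization q \<theta> h \<psi> G \<longleftrightarrow> integrable lborel \<psi> \<and>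
     (\<forall>s M. s \<le> 0 \<longrightarrow> h \<le> s + real M * q \<longrightarrow> (\<Sum>j<M. \<psi> (s + real j * q)) = G s) \<and>
     (\<forall>s. \<forall>z::int. G (s + of_int z * q) = G s) \<and>
     uniform_limit UNIV (\<lambda>K s. (\<Sum>k<K. G (s - real k * \<theta>)) / real K)
       (\<lambda>_. integral\<^sup>L lborel \<psi> / q) sequentially"

definition equi :: "real \<Rightarrow> real \<Rightarrow> real \<Rightarrow> (real \<Rightarrow> real) \<Rightarrow> bool" where
  "equi q \<theta> h \<psi> \<longleftrightarrow> (\<exists>G. periodization q \<theta> h \<psi> G)"

lemma periodizationD:
  assumes "periodization q \<theta> h \<psi> G"
  shows "integrable lborel \<psi>"
    "s \<le> 0 \<Longrightarrow> h \<le> s + real M * q \<Longrightarrow> (\<Sum>j<M. \<psi> (s + real j * q)) = G s"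
    "G (s + real_of_int z * q) = G s"
    "uniform_limit UNIV (\<lambda>K s. (\<Sum>k<K. G (s - real k * \<theta>)) / real K)
       (\<lambda>_. integral\<^sup>L lborel \<psi> / q) sequentially"
  using assms unfolding periodization_def by blast+

text \<open>The number of \<open>j\<close> with \<open>s + j * q\<close> in \<open>[c, d)\<close> is
  a difference of two ceilings, that is \<open>(d - c) / q\<close> plus a difference of two
  fractional parts, whose averages along the rotation both tend uniformly to
  \<open>1/2\<close>.\<close>

lemma equi_interval:
  fixes q \<theta> h c d :: real
  assumes q: "q > 0" and irr: "\<theta> / q \<notin> \<rat>" and cd: "0 \<le> c" "c \<le> d" "d \<le> h"
  shows "equi q \<theta> h (indicator {c..<d})"
  unfolding equi_def periodization_def
proof (intro exI[of _ "\<lambda>s. of_int (\<lceil>(d - s) / q\<rceil> - \<lceil>(c - s) / q\<rceil>)"] conjI allI impI)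
  show "integrable lborel (indicator {c..<d} :: real \<Rightarrow> real)"
    using cd by (auto intro!: integrable_real_indicator)
next
  fix s :: real and M :: nat
  assume s: "s \<le> 0" and M: "h \<le> s + real M * q"
  define i0 i1 where "i0 = nat \<lceil>(c - s) / q\<rceil>" and "i1 = nat \<lceil>(d - s) / q\<rceil>"
  have nn: "0 \<le> (c - s) / q" "0 \<le> (d - s) / q" using q s cd by auto
  have le: "(c - s) / q \<le> (d - s) / q" using q cd by (simp add: divide_right_mono)
  have "(d - s) / q \<le> real M" using q M cd by (simp add: pos_divide_le_eq)
  then have i1M: "i1 \<le> M" unfolding i1_def by (simp add: ceiling_le_iff nat_le_iff)
  have iff: "(s + real j * q \<in> {c..<d}) \<longleftrightarrow> j \<in> {i0..<i1}" for j :: nat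
  proof -
    have "s + real j * q \<in> {c..<d} \<longleftrightarrow> (c - s) / q \<le> real j \<and> real j < (d - s) / q"
      using q by (auto simp: field_simps)
    also have "\<dots> \<longleftrightarrow> \<lceil>(c - s) / q\<rceil> \<le> int j \<and> int j < \<lceil>(d - s) / q\<rceil>"
      by (simp add: ceiling_le_iff less_ceiling_iff)
    also have "\<dots> \<longleftrightarrow> j \<in> {i0..<i1}"
      using nn unfolding i0_def i1_def by (auto simp: nat_le_iff zless_nat_eq_int_zless)
    finally show ?thesis .
  qed
  have "(\<Sum>j<M. indicator {c..<d} (s + real j * q) :: real) = (\<Sum>j<M. if j \<in> {i0..<i1} then 1 else 0)"
    by (intro sum.cong refl) (simp only: indicator_def iff of_bool_def)
  also have "\<dots> = real (card ({..<M} \<inter> {j. j \<in> {i0..<i1}}))"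
    by (subst sum.If_cases) auto
  also have "{..<M} \<inter> {j. j \<in> {i0..<i1}} = {i0..<i1}" using i1M by auto
  also have "real (card {i0..<i1}) = real i1 - real i0"
    using ceiling_mono[OF le] by (simp add: i0_def i1_def nat_mono of_nat_diff)
  also have "\<dots> = of_int (\<lceil>(d - s) / q\<rceil> - \<lceil>(c - s) / q\<rceil>)"
    using nn by (simp add: i0_def i1_def)
  finally show "(\<Sum>j<M. indicator {c..<d} (s + real j * q) :: real) = \<dots>" .
next
  fix s :: real and z :: int
  have "(d - (s + of_int z * q)) / q = (d - s) / q - of_int z" "(c - (s + of_int z * q)) / q = (c - s) / q - of_int z"
    using q by (auto simp: field_simps)
  then show "real_of_int (\<lceil>(d - (s + of_int z * q)) / q\<rceil> - \<lceil>(c - (s + of_int z * q)) / q\<rceil>)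
     = of_int (\<lceil>(d - s) / q\<rceil> - \<lceil>(c - s) / q\<rceil>)"
    by simp
next
  have irr': "- (\<theta> / q) \<notin> \<rat>" using irr by (metis Rats_minus_iff)
  define F where "F K x = (\<Sum>k<K. frac (x + real k * (- (\<theta> / q))) - 1/2) / real K" for K x
  have lim: "uniform_limit UNIV (\<lambda>K s. F K ((s - b) / q)) (\<lambda>_. 0) sequentially" for b
    using irrational_rotation_uniform[OF irr'] unfolding F_def[abs_def]
    by (rule uniform_limit_compose') simp
  have ce: "real_of_int \<lceil>z\<rceil> = z + frac (- z)" for z :: real
    by (simp add: ceiling_def frac_def)
  have term_eq: "real_of_int (\<lceil>(d - (s - real k * \<theta>)) / q\<rceil> - \<lceil>(c - (s - real k * \<theta>)) / q\<rceil>)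
       = (d - c) / q + (frac ((s - d) / q + real k * (- (\<theta> / q))) - 1/2)
                     - (frac ((s - c) / q + real k * (- (\<theta> / q))) - 1/2)" for s k
  proof -
    have "- ((d - (s - real k * \<theta>)) / q) = (s - d) / q + real k * (- (\<theta> / q))"
      "- ((c - (s - real k * \<theta>)) / q) = (s - c) / q + real k * (- (\<theta> / q))"
      using q by (auto simp: field_simps)
    moreover have "(d - (s - real k * \<theta>)) / q - (c - (s - real k * \<theta>)) / q = (d - c) / q"
      using q by (auto simp: field_simps)
    moreover have "\<And>a c e x y :: real. a - c = e \<Longrightarrow> (a + x) - (c + y) = e + (x - 1/2) - (y - 1/2)" by simp
    ultimately show ?thesis unfolding of_int_diff ce by metis
  qed
  have "uniform_limit UNIV (\<lambda>K s. (d - c) / q + F K ((s - d) / q) - F K ((s - c) / q))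
      (\<lambda>_. (d - c) / q + 0 - 0) sequentially"
    by (intro uniform_limit_minus uniform_limit_add lim uniform_limit_const)
  moreover have "\<forall>\<^sub>F K in sequentially. \<forall>s\<in>UNIV. (d - c) / q + F K ((s - d) / q) - F K ((s - c) / q)
      = (\<Sum>k<K. real_of_int (\<lceil>(d - (s - real k * \<theta>)) / q\<rceil> - \<lceil>(c - (s - real k * \<theta>)) / q\<rceil>)) / real K"
    using eventually_gt_at_top[of 0] unfolding term_eq F_def
    by eventually_elim (simp add: sum.distrib sum_subtractf add_divide_distrib diff_divide_distrib)
  ultimately show "uniform_limit UNIV
      (\<lambda>K s. (\<Sum>k<K. real_of_int (\<lceil>(d - (s - real k * \<theta>)) / q\<rceil> - \<lceil>(c - (s - real k * \<theta>)) / q\<rceil>)) / real K)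
      (\<lambda>_. integral\<^sup>L lborel (indicator {c..<d}) / q) sequentially"
    using cd by (subst (asm) uniform_limit_cong) auto
qed

lemma equi_add:
  assumes "equi q \<theta> h \<phi>" "equi q \<theta> h \<psi>"
  shows "equi q \<theta> h (\<lambda>y. \<phi> y + \<psi> y)"
proof -
  obtain G F where "periodization q \<theta> h \<phi> G" "periodization q \<theta> h \<psi> F"
    using assms unfolding equi_def by blast
  note G = periodizationD[OF this(1)] and F = periodizationD[OF this(2)]
  show ?thesis unfolding equi_def periodization_def
    using G(1-3) F(1-3) uniform_limit_add[OF G(4) F(4)]
    by (intro exI[of _ "\<lambda>s. G s + F s"]) (auto simp: sum.distrib add_divide_distrib)
qed

lemma equi_scale:
  assumes "equi q \<theta> h \<psi>"
  shows "equi q \<theta> h (\<lambda>y. c * \<psi> y)"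
proof -
  obtain F where "periodization q \<theta> h \<psi> F" using assms unfolding equi_def by blast
  note F = periodizationD[OF this]
  show ?thesis unfolding equi_def periodization_def
    using F(1-3) bounded_linear.uniform_limit[OF bounded_linear_mult_right[of c] F(4)]
    by (intro exI[of _ "\<lambda>s. c * F s"]) (auto simp: sum_distrib_left[symmetric])
qed

lemma equi_shift:
  assumes "equi q \<theta> h \<psi>" "0 \<le> t" "t + h \<le> h'"
  shows "equi q \<theta> h' (\<lambda>y. \<psi> (y - t))"
proof -
  obtain F where "periodization q \<theta> h \<psi> F" using assms unfolding equi_def by blast
  note F = periodizationD[OF this]
  have c: "s + a - t = (s - t) + a" "s - a - t = (s - t) - a" for s a :: real by simp_all
  have "periodization q \<theta> h' (\<lambda>y. \<psi> (y - t)) (\<lambda>s. F (s - t))" unfolding periodization_def c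
  proof (intro conjI allI impI)
    show "integrable lborel (\<lambda>y. \<psi> (y - t))" using F(1) integrable_shift[of \<psi> "- t"] by simp
    show "uniform_limit UNIV (\<lambda>K s. (\<Sum>k<K. F ((s - t) - real k * \<theta>)) / real K)
        (\<lambda>_. integral\<^sup>L lborel (\<lambda>y. \<psi> (y - t)) / q) sequentially"
      using uniform_limit_compose'[OF F(4), of "\<lambda>s. s - t" UNIV] integral_shift[of \<psi> "- t"] by simp
  qed (use F(2,3) assms(2,3) in auto)
  then show ?thesis unfolding equi_def by blast
qed

lemma equi_sum:
  assumes "\<And>i. i \<in> I \<Longrightarrow> equi q \<theta> h (\<psi> i)" "finite I"
  shows "equi q \<theta> h (\<lambda>y. \<Sum>i\<in>I. \<psi> i y)"
  using assms(2,1)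
proof (induction I rule: finite_induct)
  case empty
  show ?case unfolding equi_def periodization_def by (auto intro!: exI[of _ "\<lambda>_. 0"] uniform_limit_const)
next
  case (insert i I)
  then show ?case by (simp add: equi_add)
qed

section \<open>Correlations in rank-one towers on the line\<close>

lemma integrable_bounded_support:
  fixes \<phi> :: "real \<Rightarrow> real"
  assumes "\<phi> \<in> borel_measurable borel" "\<And>y. \<bar>\<phi> y\<bar> \<le> C" "\<And>y. y \<notin> {a..b} \<Longrightarrow> \<phi> y = 0"
  shows "integrable lborel \<phi>"
proof -
  have "integrable lborel (\<lambda>y. indicator {a..b} y *\<^sub>R C :: real)"
    by (intro integrable_scaleR_left integrable_real_indicator) (auto simp: emeasure_lborel_Icc_eq)
  then show ?thesis
    by (rule Bochner_Integration.integrable_bound)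
       (use assms in \<open>auto simp: indicator_def intro: order_trans[OF _ abs_ge_self]\<close>)
qed

text \<open>\<open>H n\<close> and \<open>w n\<close> are height and width of the
  \<open>n\<close>-th flow tower, and \<open>W\<close> bounds the areas. In \<open>H_Suc\<close>
  tower \<open>n\<close> is cut into \<open>n + 1\<close> subcolumns, the \<open>i\<close>-th of
  which, counted from 0, receives spacers of height \<open>i * q\<close>.\<close>

locale tower_data =
  fixes p q W :: real and H w :: "nat \<Rightarrow> real"
  assumes p_pos: "p > 0" and q_pos: "q > 0" and irr: "p / q \<notin> \<rat>"
    and H_0: "H 0 = p"
    and H_Suc: "H (Suc n) = real (Suc n) * H n + q * (real (Suc n) * real n / 2)"
    and w_0: "w 0 > 0" and w_Suc: "w (Suc n) = w n / real (Suc n)"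
    and wH: "w n * H n \<le> W"
begin

text \<open>Height inside tower \<open>n + 1\<close> at which the \<open>i\<close>-th copy of tower
  \<open>n\<close> starts; for \<open>i = n + 1\<close> it is the height of tower
  \<open>n + 1\<close>.\<close>

definition S :: "nat \<Rightarrow> nat \<Rightarrow> real" where
  "S n i = real i * H n + q * (real i * (real i - 1) / 2)"

text \<open>\<open>g n y\<close> is the value at height \<open>y\<close> in the \<open>n\<close>-th flow tower of a function on the suspension that
  depends on the height only and vanishes on the spacers inserted after stage \<open>n0\<close>.\<close>

definition tow_seq :: "nat \<Rightarrow> (nat \<Rightarrow> real \<Rightarrow> real) \<Rightarrow> bool" where
  "tow_seq n0 g \<longleftrightarrow> (\<forall>n\<ge>n0. g n \<in> borel_measurable borel \<and> (\<forall>y. \<bar>g n y\<bar> \<le> 1) \<and>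
     (\<forall>y. y \<notin> {0..<H n} \<longrightarrow> g n y = 0) \<and> (\<forall>y. g (Suc n) y = (\<Sum>i\<le>n. g n (y - S n i))))"

text \<open>For profiles \<open>b\<close> and \<open>g\<close>, \<open>w n * corr b g n t\<close> is
  the part of the correlation at time \<open>t\<close> that comes from points staying inside tower
  \<open>n\<close> up to time \<open>t\<close>.\<close>

definition corr :: "(nat \<Rightarrow> real \<Rightarrow> real) \<Rightarrow> (nat \<Rightarrow> real \<Rightarrow> real) \<Rightarrow> nat \<Rightarrow> real \<Rightarrow> real" where
  "corr b g n t = (\<integral>y. b n y * g n (y + t) \<partial>lborel)"

lemma w_pos: "w n > 0"
  by (induction n) (auto simp: w_0 w_Suc)

lemma H_pos: "H n > 0"
proof (induction n)
  case (Suc n)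
  have "0 < real (Suc n) * H n" using Suc by simp
  moreover have "0 \<le> q * (real (Suc n) * real n / 2)" using q_pos by simp
  ultimately show ?case unfolding H_Suc by linarith
qed (simp add: H_0 p_pos)

lemma W_pos: "W > 0"
  using wH[of 0] mult_pos_pos[OF w_pos H_pos, of 0 0] by linarith

lemma H_Suc_ge: "real (Suc n) * H n \<le> H (Suc n)"
  unfolding H_Suc using q_pos by simp

lemma H_le_Suc: "H n \<le> H (Suc n)"
proof -
  have "1 * H n \<le> real (Suc n) * H n" using H_pos[of n] by (intro mult_right_mono) auto
  then show ?thesis using H_Suc_ge[of n] by simp
qed

lemma H_mono: "m \<le> n \<Longrightarrow> H m \<le> H n"
  using H_le_Suc by (rule lift_Suc_mono_le)

lemma H_ge_fact: "fact n * p \<le> H n"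
proof (induction n)
  case (Suc n)
  have "fact (Suc n) * p = real (Suc n) * (fact n * p)" by simp
  also have "\<dots> \<le> real (Suc n) * H n" using Suc by (intro mult_left_mono) auto
  finally show ?case using H_Suc_ge[of n] by linarith
qed (simp add: H_0)

lemma H_ge_quad: "q * (real n * (real n - 1) / 2) \<le> H n"
proof (cases n)
  case (Suc m)
  then show ?thesis using H_pos[of m] by (simp add: H_Suc)
qed (use H_pos in \<open>auto intro: less_imp_le\<close>)

lemma S_0 [simp]: "S n 0 = 0" by (simp add: S_def)

lemma S_Suc: "S n (Suc i) = S n i + H n + real i * q"
  by (simp add: S_def field_simps)

lemma S_top: "S n (Suc n) = H (Suc n)"
  by (simp add: S_def H_Suc field_simps)

lemma S_mono: "i \<le> j \<Longrightarrow> S n i \<le> S n j"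
  by (rule lift_Suc_mono_le[of "S n"]) (use H_pos[of n] q_pos in \<open>auto simp: S_Suc\<close>)

lemma S_nonneg: "0 \<le> S n i" using S_mono[of 0 i n] by simp

lemma S_add_le: "i \<le> n \<Longrightarrow> S n i + H n \<le> H (Suc n)"
proof -
  assume "i \<le> n"
  have "S n i + H n \<le> S n (Suc i)" using q_pos by (simp add: S_Suc)
  also have "\<dots> \<le> H (Suc n)" using S_mono[of "Suc i" "Suc n" n] \<open>i \<le> n\<close> by (simp add: S_top)
  finally show ?thesis .
qed

lemma tow_seqD:
  assumes "tow_seq n0 g" "n \<ge> n0"
  shows "g n \<in> borel_measurable borel" "\<bar>g n y\<bar> \<le> 1" "y \<notin> {0..<H n} \<Longrightarrow> g n y = 0"
    "g (Suc n) y = (\<Sum>i\<le>n. g n (y - S n i))"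
  using assms unfolding tow_seq_def by blast+

lemma tow_measurable:
  assumes "tow_seq n0 g" "n \<ge> n0"
  shows "(\<lambda>y. g n (y + t)) \<in> borel_measurable borel"
  using measurable_compose[OF _ tow_seqD(1)[OF assms], of "\<lambda>y. y + t" borel] by simp

lemma tow_integrable:
  assumes "tow_seq n0 g" "n \<ge> n0"
  shows "integrable lborel (\<lambda>y. g n (y + t))"
  by (rule integrable_bounded_support[where C = 1 and a = "- t" and b = "H n - t"])
     (use tow_measurable[OF assms] tow_seqD[OF assms] in auto)

lemma tow_integrable2:
  assumes "tow_seq n0 b" "tow_seq n0 g" "n \<ge> n0"
  shows "integrable lborel (\<lambda>y. b n (y + s) * g n (y + t))"
proof (rule integrable_bounded_support[where C = 1 and a = "- t" and b = "H n - t"])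
  show "(\<lambda>y. b n (y + s) * g n (y + t)) \<in> borel_measurable borel"
    using tow_measurable[OF assms(1,3)] tow_measurable[OF assms(2,3)] by simp
  show "\<bar>b n (y + s) * g n (y + t)\<bar> \<le> 1" for y
    using tow_seqD(2)[OF assms(1,3), of "y + s"] tow_seqD(2)[OF assms(2,3), of "y + t"]
    by (simp add: abs_mult mult_le_one)
  show "y \<notin> {- t..H n - t} \<Longrightarrow> b n (y + s) * g n (y + t) = 0" for y
    using tow_seqD(3)[OF assms(2,3), of "y + t"] by auto
qed

lemma corr_shift:
  assumes "tow_seq n0 b" "tow_seq n0 g" "n \<ge> n0"
  shows "(\<integral>y. b n (y + s) * g n (y + t) \<partial>lborel) = corr b g n (t - s)"
  unfolding corr_def using integral_shift[of "\<lambda>y. b n y * g n (y + (t - s))" s]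
  by (simp add: algebra_simps)

lemma corr_sym:
  assumes "tow_seq n0 g" "n \<ge> n0"
  shows "corr g g n (- t) = corr g g n t"
  using corr_shift[OF assms(1,1,2), of t 0] by (simp add: corr_def mult.commute)

text \<open>The integrand lives on the overlap of \<open>[0, H n)\<close> with its translate by
  \<open>- s\<close> and is at most 1 there.\<close>

lemma corr_bound:
  assumes "tow_seq n0 b" "tow_seq n0 g" "n \<ge> n0"
  shows "\<bar>corr b g n s\<bar> \<le> max 0 (H n - \<bar>s\<bar>)"
proof -
  define l u where "l = max 0 (- s)" and "u = max l (min (H n) (H n - s))"
  have "\<bar>corr b g n s\<bar> \<le> (\<integral>y. \<bar>b n y * g n (y + s)\<bar> \<partial>lborel)"
    unfolding corr_def by (rule integral_abs_bound)
  also have "\<dots> \<le> (\<integral>y. indicator {l..<u} y \<partial>lborel)"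
  proof (rule integral_mono)
    show "integrable lborel (\<lambda>y. \<bar>b n y * g n (y + s)\<bar>)"
      using tow_integrable2[OF assms, of 0 s] by simp
    show "integrable lborel (indicator {l..<u} :: real \<Rightarrow> real)"
      by (intro integrable_real_indicator) (auto simp: u_def)
    show "\<bar>b n y * g n (y + s)\<bar> \<le> indicator {l..<u} y" for y
    proof (cases "y \<in> {l..<u}")
      case True
      then show ?thesis
        using tow_seqD(2)[OF assms(1,3), of y] tow_seqD(2)[OF assms(2,3), of "y + s"]
        by (simp add: abs_mult mult_le_one)
    next
      case False
      then have "y \<notin> {0..<H n} \<or> y + s \<notin> {0..<H n}" by (auto simp: l_def u_def)
      then show ?thesis
        using False tow_seqD(3)[OF assms(1,3), of y] tow_seqD(3)[OF assms(2,3), of "y + s"] by auto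
    qed
  qed
  also have "\<dots> = u - l" by (simp add: u_def)
  also have "\<dots> = max 0 (H n - \<bar>s\<bar>)"
    using H_pos[of n] by (simp add: u_def l_def max_def min_def abs_if)
  finally show ?thesis .
qed

lemma corr_eq_0:
  assumes "tow_seq n0 b" "tow_seq n0 g" "n \<ge> n0" "H n \<le> \<bar>s\<bar>"
  shows "corr b g n s = 0"
  using corr_bound[OF assms(1-3), of s] assms(4) by simp

lemma corr_rec:
  assumes "tow_seq n0 b" "tow_seq n0 g" "n \<ge> n0"
  shows "corr b g (Suc n) t = (\<Sum>i\<le>n. \<Sum>j\<le>n. corr b g n (t + S n i - S n j))"
proof -
  have "b (Suc n) y * g (Suc n) (y + t)
      = (\<Sum>i\<le>n. \<Sum>j\<le>n. b n (y + (- S n i)) * g n (y + (t - S n j)))" for y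
    unfolding tow_seqD(4)[OF assms(1,3)] tow_seqD(4)[OF assms(2,3)] sum_product
    by (simp add: algebra_simps)
  then have "corr b g (Suc n) t
      = (\<Sum>i\<le>n. \<Sum>j\<le>n. \<integral>y. b n (y + (- S n i)) * g n (y + (t - S n j)) \<partial>lborel)"
    unfolding corr_def
    by (simp add: Bochner_Integration.integral_sum Bochner_Integration.integrable_sum
        tow_integrable2[OF assms] del: add_uminus_conv_diff)
  also have "\<dots> = (\<Sum>i\<le>n. \<Sum>j\<le>n. corr b g n (t + S n i - S n j))"
    unfolding corr_shift[OF assms] by (simp add: algebra_simps)
  finally show ?thesis .
qed

text \<open>For \<open>t \<le> H n\<close> the \<open>i\<close>-th copy of tower \<open>n\<close>
  can meet only itself and the next copy, which starts \<open>H n + i * q\<close> higher.\<close>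

lemma corr_expand:
  assumes "tow_seq n0 b" "tow_seq n0 g" "n \<ge> n0" "0 \<le> t" "t \<le> H n"
  shows "corr b g (Suc n) t
     = real (Suc n) * corr b g n t + (\<Sum>i<n. corr b g n (t - H n - real i * q))"
proof -
  have zero: "corr b g n (t + S n i - S n j) = 0" if "j < i \<or> Suc i < j" for i j
  proof (rule corr_eq_0[OF assms(1-3)])
    show "H n \<le> \<bar>t + S n i - S n j\<bar>"
    proof (cases "j < i")
      case True
      then have "S n j + H n \<le> S n i"
        using S_mono[of "Suc j" i n] q_pos by (simp add: S_Suc) (smt (verit) mult_nonneg_nonneg of_nat_0_le_iff)
      then show ?thesis using assms(4) by linarith
    next
      case False
      then have "S n (Suc (Suc i)) \<le> S n j" using that S_mono[of "Suc (Suc i)" j n] by simp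
      moreover have "S n i + 2 * H n \<le> S n (Suc (Suc i))" using q_pos by (simp add: S_Suc)
      ultimately show ?thesis using assms(5) by linarith
    qed
  qed
  have row: "(\<Sum>j\<le>n. corr b g n (t + S n i - S n j))
      = corr b g n t + (if i < n then corr b g n (t - H n - real i * q) else 0)" if "i \<le> n" for i
  proof -
    have "(\<Sum>j\<le>n. corr b g n (t + S n i - S n j))
        = (\<Sum>j\<in>(if i < n then {i, Suc i} else {i}). corr b g n (t + S n i - S n j))"
    proof (rule sum.mono_neutral_right)
      show "\<forall>j\<in>{..n} - (if i < n then {i, Suc i} else {i}). corr b g n (t + S n i - S n j) = 0"
        using that by (intro ballI zero) (auto split: if_splits)
    qed (use that in auto)
    then show ?thesis by (auto simp: S_Suc algebra_simps)
  qed
  have "corr b g (Suc n) t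
     = (\<Sum>i\<le>n. corr b g n t + (if i < n then corr b g n (t - H n - real i * q) else 0))"
    unfolding corr_rec[OF assms(1-3)] by (intro sum.cong refl row) simp
  also have "\<dots> = real (Suc n) * corr b g n t
      + (\<Sum>i\<le>n. if i < n then corr b g n (t - H n - real i * q) else 0)"
    by (simp add: sum.distrib)
  also have "(\<Sum>i\<le>n. if i < n then corr b g n (t - H n - real i * q) else 0)
      = (\<Sum>i<n. corr b g n (t - H n - real i * q))"
    by (rule sum.mono_neutral_cong_right) auto
  finally show ?thesis .
qed

lemma w_mult_Suc: "w (Suc n) * real (Suc n) = w n" by (simp add: w_Suc)

text \<open>Successive copies start at least \<open>H n\<close> apart, so each of the
  \<open>n\<close> crossings overlaps over a length of at most \<open>t\<close>.\<close>

lemma corr_step: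
  assumes "tow_seq n0 b" "tow_seq n0 g" "n \<ge> n0" "0 \<le> t" "t \<le> H n"
  shows "\<bar>w (Suc n) * corr b g (Suc n) t - w n * corr b g n t\<bar> \<le> w n * t"
proof -
  have "w (Suc n) * corr b g (Suc n) t - w n * corr b g n t
      = w (Suc n) * (\<Sum>i<n. corr b g n (t - H n - real i * q))"
    unfolding corr_expand[OF assms] w_mult_Suc[of n, symmetric] by (simp add: algebra_simps)
  also have "\<bar>\<dots>\<bar> \<le> w (Suc n) * (\<Sum>i<n. t)"
  proof -
    have "\<bar>\<Sum>i<n. corr b g n (t - H n - real i * q)\<bar> \<le> (\<Sum>i<n. t)"
    proof (rule order_trans[OF sum_abs], rule sum_mono)
      fix i
      have "0 \<le> real i * q" using q_pos by simp
      then show "\<bar>corr b g n (t - H n - real i * q)\<bar> \<le> t"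
        using corr_bound[OF assms(1-3), of "t - H n - real i * q"] assms(4,5) by linarith
    qed
    then show ?thesis using w_pos[of "Suc n"] by (simp add: abs_mult)
  qed
  also have "\<dots> \<le> w (Suc n) * (real (Suc n) * t)"
    using w_pos[of "Suc n"] assms by (intro mult_left_mono) (auto intro: mult_right_mono)
  also have "\<dots> = w n * t" using w_mult_Suc[of n] by (simp only: mult.assoc[symmetric])
  finally show ?thesis .
qed

text \<open>In a higher tower only the pairs that cross the top of tower \<open>m\<close> are new, and they have measure at most
  \<open>w n * t\<close> at each stage.\<close>

lemma corr_stable:
  assumes "tow_seq n0 b" "tow_seq n0 g" "m \<ge> n0" "m \<ge> 1" "m \<le> n" "0 \<le> t" "t \<le> H m"
  shows "\<bar>w n * corr b g n t - w m * corr b g m t\<bar> \<le> 2 * w m * t"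
proof -
  have "\<bar>w n * corr b g n t - w m * corr b g m t\<bar> \<le> 2 * w m * t - 2 * w n * t"
    using \<open>m \<le> n\<close>
  proof (induction n rule: dec_induct)
    case (step n)
    have "w (Suc n) \<le> w n / 2"
      using step assms w_pos[of n] unfolding w_Suc by (intro divide_left_mono) auto
    then have "2 * w (Suc n) * t \<le> 2 * (w n / 2) * t" using assms by (intro mult_right_mono) auto
    moreover have "\<bar>w (Suc n) * corr b g (Suc n) t - w n * corr b g n t\<bar> \<le> w n * t"
      using step assms H_mono[of m n] by (intro corr_step[OF assms(1,2)]) auto
    ultimately show ?case using step.IH by linarith
  qed simp
  moreover have "0 \<le> w n * t" using w_pos[of n] assms by simp
  ultimately show ?thesis by linarith
qed

end

section \<open>The stride q: averages over one spacer height and correlations near a tower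
  height\<close>

lemma card_arith_progression_le:
  fixes a h q :: real
  assumes "q > 0" "h > 0"
  shows "real (card {j::nat. j < M \<and> 0 \<le> a + real j * q \<and> a + real j * q < h}) \<le> h / q + 1"
proof (cases "{j::nat. j < M \<and> 0 \<le> a + real j * q \<and> a + real j * q < h} = {}")
  case True
  show ?thesis using assms unfolding True by simp
next
  case False
  define J where "J = {j::nat. j < M \<and> 0 \<le> a + real j * q \<and> a + real j * q < h}"
  have fin: "finite J" "J \<noteq> {}" using False by (auto simp: J_def)
  define i where "i = Min J"
  have i: "i \<in> J" "\<And>j. j \<in> J \<Longrightarrow> i \<le> j" using fin by (auto simp: i_def)
  have "J \<subseteq> {i..<i + nat \<lceil>h / q\<rceil>}"
  proof
    fix j assume j: "j \<in> J"
    have "(real j - real i) * q < h" using j i(1) unfolding J_def by (auto simp: algebra_simps)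
    then have "real j - real i < h / q" using assms by (simp add: pos_less_divide_eq)
    then have "int j - int i < \<lceil>h / q\<rceil>" by linarith
    then show "j \<in> {i..<i + nat \<lceil>h / q\<rceil>}" using i(2)[OF j] by auto
  qed
  from card_mono[OF _ this] have "card J \<le> nat \<lceil>h / q\<rceil>" by simp
  moreover have "0 \<le> h / q" using assms by simp
  ultimately show ?thesis unfolding J_def[symmetric] by linarith
qed

lemma triangle_int: "\<exists>z::int. real i * (real i - 1) / 2 = of_int z"
proof (induction i)
  case (Suc i)
  then obtain z where z: "real i * (real i - 1) / 2 = of_int z" by auto
  have "real (Suc i) * (real (Suc i) - 1) / 2 = real i * (real i - 1) / 2 + real i"
    by (simp add: field_simps)
  then show ?case using z by (metis of_int_add of_int_of_nat_eq)
qed (auto intro: exI[of _ 0])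

context tower_data
begin

text \<open>Induction on the stage: copy \<open>k\<close> inside tower \<open>n + 1\<close> is copy
  \<open>k mod K\<close> of subcolumn \<open>k div K\<close>. The congruence for the full height
  \<open>H n\<close> is carried along because it fixes where the next subcolumn starts modulo
  \<open>q\<close>.\<close>

lemma copies:
  assumes "tow_seq m g" "m \<le> n"
  shows "\<exists>K t. (\<forall>k<K. 0 \<le> t k \<and> t k + H m \<le> H n) \<and>
     (\<forall>j k. j < k \<longrightarrow> k < K \<longrightarrow> t j + H m \<le> t k) \<and>
     (\<forall>k<K. \<exists>z::int. t k = real k * H m + of_int z * q) \<and>
     (\<exists>z::int. H n = real K * H m + of_int z * q) \<and>
     (\<forall>y. g n y = (\<Sum>k<K. g m (y - t k)))"
  using assms(2)
proof (induction n rule: dec_induct)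
  case base
  show ?case
    by (rule exI[of _ 1], rule exI[of _ "\<lambda>_. 0"]) (auto intro!: exI[of _ 0])
next
  case (step n)
  then obtain K t z0 where
    t1: "\<And>k. k < K \<Longrightarrow> 0 \<le> t k" "\<And>k. k < K \<Longrightarrow> t k + H m \<le> H n" and
    t2: "\<And>j k. j < k \<Longrightarrow> k < K \<Longrightarrow> t j + H m \<le> t k" and
    t3: "\<And>k. k < K \<Longrightarrow> \<exists>z::int. t k = real k * H m + of_int z * q" and
    t4: "H n = real K * H m + of_int z0 * q" and
    t5: "\<And>y. g n y = (\<Sum>k<K. g m (y - t k))"
    by metis
  define t' where "t' k = S n (k div K) + t (k mod K)" for k
  have dm: "k mod K < K" "k div K < Suc n" if "k < Suc n * K" for k
  proof -
    have "K > 0" using that by (cases K) auto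
    then show "k mod K < K" by simp
    show "k div K < Suc n" using that by (rule less_mult_imp_div_less)
  qed
  have S_mod: "\<exists>z::int. S n i = real (i * K) * H m + of_int z * q" for i
  proof -
    obtain z where z: "real i * (real i - 1) / 2 = of_int z" using triangle_int by blast
    have "S n i = real (i * K) * H m + of_int (int i * z0 + z) * q"
      unfolding S_def z t4 by (simp add: algebra_simps)
    then show ?thesis by blast
  qed
  show ?case
  proof (intro exI[of _ "Suc n * K"] exI[of _ t'] conjI allI impI)
    fix k assume k: "k < Suc n * K"
    show "0 \<le> t' k" using t1(1)[OF dm(1)[OF k]] S_nonneg unfolding t'_def by simp
    show "t' k + H m \<le> H (Suc n)"
      using t1(2)[OF dm(1)[OF k]] S_add_le[of "k div K" n] dm(2)[OF k] unfolding t'_def by simp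
    obtain z1 where z1: "S n (k div K) = real (k div K * K) * H m + of_int z1 * q"
      using S_mod by blast
    obtain z2 where z2: "t (k mod K) = real (k mod K) * H m + of_int z2 * q"
      using t3[OF dm(1)[OF k]] by blast
    have e: "real (k div K * K) + real (k mod K) = real k"
      unfolding of_nat_add[symmetric] by simp
    have "t' k = (real (k div K * K) + real (k mod K)) * H m + of_int (z1 + z2) * q"
      unfolding t'_def z1 z2 by (simp add: algebra_simps)
    then have "t' k = real k * H m + of_int (z1 + z2) * q" unfolding e .
    then show "\<exists>z::int. t' k = real k * H m + of_int z * q" by blast
  next
    fix j k assume jk: "j < k" "k < Suc n * K"
    then have j: "j < Suc n * K" by simp
    show "t' j + H m \<le> t' k"
    proof (cases "j div K = k div K")
      case True
      then have "j mod K < k mod K" using jk(1)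
        by (metis add_less_cancel_left mult_div_mod_eq)
      then show ?thesis using t2 dm(1)[OF jk(2)] True unfolding t'_def by simp
    next
      case False
      then have lt: "Suc (j div K) \<le> k div K" using jk(1) div_le_mono[of j k K] by simp
      have "t' j + H m \<le> S n (Suc (j div K))"
        using t1(2)[OF dm(1)[OF j]] mult_nonneg_nonneg[of "real (j div K)" q] q_pos
        unfolding t'_def S_Suc by linarith
      also have "\<dots> \<le> S n (k div K)" by (rule S_mono[OF lt])
      also have "\<dots> \<le> t' k" using t1(1)[OF dm(1)[OF jk(2)]] unfolding t'_def by simp
      finally show ?thesis .
    qed
  next
    show "\<exists>z::int. H (Suc n) = real (Suc n * K) * H m + of_int z * q"
      using S_mod[of "Suc n"] by (simp add: S_top)
  next
    fix y
    have "(\<Sum>k<Suc n * K. g m (y - t' k)) = (\<Sum>i<Suc n. \<Sum>k<K. g m (y - t' (i * K + k)))"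
      by (rule sum_blocks)
    also have "\<dots> = (\<Sum>i<Suc n. \<Sum>k<K. g m ((y - S n i) - t k))"
      by (intro sum.cong refl) (simp add: t'_def algebra_simps)
    also have "\<dots> = g (Suc n) y"
      using step.hyps by (simp add: tow_seqD(4)[OF assms(1)] t5 lessThan_Suc_atMost)
    finally show "g (Suc n) y = (\<Sum>k<Suc n * K. g m (y - t' k))" ..
  qed
qed

text \<open>All spacers have height \<open>q\<close>, so the \<open>k\<close>-th copy of tower \<open>m\<close> starts at a height congruent to \<open>k * H m\<close>
  modulo \<open>q\<close>. The sum is thus, up to the two boundary copies, a Birkhoff sum of the mean-zero
  periodization along consecutive points of an irrational rotation.\<close>

lemma sup_bound:
  assumes g: "tow_seq m g" and eq: "equi q (H m) (H m) (g m)" and zero: "integral\<^sup>L lborel (g m) = 0"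
    and "\<epsilon> > 0"
  shows "\<exists>M0. \<forall>M\<ge>M0. \<forall>n\<ge>m. \<forall>y. \<bar>\<Sum>j<M. g n (y + real j * q)\<bar> \<le> \<epsilon> * real M"
proof -
  define h where "h = H m"
  have h: "h > 0" using H_pos by (simp add: h_def)
  define \<psi> where "\<psi> = g m"
  obtain G where "periodization q h h \<psi> G" using eq unfolding equi_def h_def \<psi>_def by blast
  note G = periodizationD[OF this]
  obtain K0 where K0: "\<And>K s. K \<ge> K0 \<Longrightarrow> \<bar>\<Sum>k<K. G (s - real k * h)\<bar> / real K < \<epsilon> / 2 * h / q"
    using uniform_limitD[OF G(4), of "\<epsilon> / 2 * h / q"] \<open>\<epsilon> > 0\<close> h q_pos zero
    unfolding eventually_sequentially \<psi>_def by auto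
  \<comment> \<open>At most \<open>D\<close> sampled points fall into one copy, which bounds the
    contribution of any single copy.\<close>
  define D where "D = h / q + 1"
  have D: "D > 0" using h q_pos by (simp add: D_def add_pos_pos)
  \<comment> \<open>Two copies can be cut by the ends of the window, and a run of fewer than
    \<open>K0\<close> full copies is estimated trivially.\<close>
  define C where "C = (real K0 + 2) * D"
  show ?thesis
  proof (intro exI[of _ "nat \<lceil>2 * C / \<epsilon>\<rceil>"] allI impI)
    fix M n y assume M: "nat \<lceil>2 * C / \<epsilon>\<rceil> \<le> M" and n: "m \<le> n"
    obtain K t where
      t2: "\<And>j k. j < k \<Longrightarrow> k < K \<Longrightarrow> t j + h \<le> t k" and
      t3: "\<And>k. k < K \<Longrightarrow> \<exists>z::int. t k = real k * h + of_int z * q" and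
      t5: "\<And>y. g n y = (\<Sum>k<K. \<psi> (y - t k))"
      using copies[OF g n] unfolding h_def \<psi>_def by metis
    define F where "F k = (\<Sum>j<M. \<psi> (y - t k + real j * q))" for k
    have sumF: "(\<Sum>j<M. g n (y + real j * q)) = (\<Sum>k<K. F k)"
      unfolding t5 F_def by (subst sum.swap) (simp add: algebra_simps)
    have F_bd: "\<bar>F k\<bar> \<le> D" for k
    proof -
      have "\<bar>F k\<bar> \<le> (\<Sum>j<M. if 0 \<le> y - t k + real j * q \<and> y - t k + real j * q < h then 1 else 0)"
        unfolding F_def
      proof (rule order_trans[OF sum_abs], rule sum_mono)
        fix j
        show "\<bar>\<psi> (y - t k + real j * q)\<bar> \<le> (if 0 \<le> y - t k + real j * q \<and> y - t k + real j * q < h then 1 else 0)"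
          using tow_seqD(2,3)[OF g order_refl, of "y - t k + real j * q"] unfolding \<psi>_def h_def by auto
      qed
      also have "\<dots> = real (card {j. j < M \<and> 0 \<le> y - t k + real j * q \<and> y - t k + real j * q < h})"
        by (subst sum.If_cases) (auto simp: lessThan_def Collect_conj_eq[symmetric])
      also have "\<dots> \<le> D" unfolding D_def by (rule card_arith_progression_le[OF q_pos h])
      finally show ?thesis .
    qed
    have F_out: "F k = 0" if "t k + h \<le> y \<or> y + real M * q \<le> t k" for k
      unfolding F_def
    proof (rule sum.neutral, safe)
      fix j assume "j < M"
      then have "real j * q \<le> real M * q" "0 \<le> real j * q" using q_pos by auto
      moreover have "real j * q < real M * q" using \<open>j < M\<close> q_pos by simp
      ultimately have "y - t k + real j * q \<notin> {0..<H m}" using that unfolding h_def by auto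
      then show "\<psi> (y - t k + real j * q) = 0" unfolding \<psi>_def by (rule tow_seqD(3)[OF g order_refl])
    qed
    \<comment> \<open>\<open>P\<close> collects the copies lying wholly in the window from
      \<open>y\<close> to \<open>y + M * q\<close>, \<open>L\<close> and \<open>R\<close> those that
      straddle its lower or upper end. Disjointness of the copies leaves at most one index in each
      of \<open>L\<close> and \<open>R\<close>.\<close>
    define P L R where "P = {k. k < K \<and> y \<le> t k \<and> t k + h \<le> y + real M * q}"
      and "L = {k. k < K \<and> y - h < t k \<and> t k < y}"
      and "R = {k. k < K \<and> k \<notin> L \<and> y + real M * q - h < t k \<and> t k < y + real M * q}"
    have inj: "j = k" if "j < K" "k < K" "\<bar>t j - t k\<bar> < h" for j k
      using t2[of j k] t2[of k j] that by (cases j k rule: linorder_cases) auto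
    have edge: "\<bar>sum F A\<bar> \<le> D" if A: "\<And>j k. j \<in> A \<Longrightarrow> k \<in> A \<Longrightarrow> j = k" for A
    proof (cases "A = {}")
      case False
      then obtain k where "k \<in> A" by blast
      then have "A = {k}" by (auto intro: A)
      then show ?thesis using F_bd by simp
    qed (use D in simp)
    have 1: "\<bar>sum F L\<bar> \<le> D" by (rule edge) (rule inj, auto simp: L_def)
    have 2: "\<bar>sum F R\<bar> \<le> D" by (rule edge) (rule inj, auto simp: R_def)
    have 3: "\<bar>sum F P\<bar> \<le> (\<epsilon> / 2 * h / q) * (real M * q / h) + real K0 * D"
    proof (cases "P = {}")
      case True
      then show ?thesis using \<open>\<epsilon> > 0\<close> q_pos h D by simp
    next
      case False
      have "finite P" unfolding P_def by simp
      define k0 k1 where "k0 = Min P" and "k1 = Max P"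
      have k01: "k0 \<in> P" "k1 \<in> P" "k0 \<le> k1"
        using False \<open>finite P\<close> unfolding k0_def k1_def by auto
      have t_mono: "t j \<le> t k" if "j \<le> k" "k < K" for j k
        using t2[of j k] that h by (cases "j = k") auto
      have P: "P = {k0..<k0 + Suc (k1 - k0)}"
      proof (intro set_eqI iffI)
        fix k assume "k \<in> P"
        then show "k \<in> {k0..<k0 + Suc (k1 - k0)}"
          using \<open>finite P\<close> k01 unfolding k0_def k1_def by (auto simp: less_Suc_eq_le)
      next
        fix k assume "k \<in> {k0..<k0 + Suc (k1 - k0)}"
        then have "k0 \<le> k" "k \<le> k1" using k01 by auto
        moreover have "k1 < K" "y \<le> t k0" "t k1 + h \<le> y + real M * q"
          using k01 unfolding P_def by auto
        ultimately have "k < K" "t k0 \<le> t k" "t k \<le> t k1"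
          using t_mono[of k0 k] t_mono[of k k1] by auto
        then show "k \<in> P"
          using \<open>y \<le> t k0\<close> \<open>t k1 + h \<le> y + real M * q\<close> unfolding P_def by auto
      qed
      define c where "c = Suc (k1 - k0)"
      \<comment> \<open>The \<open>c\<close> full copies are disjoint and of height
        \<open>h\<close>, so at most \<open>M * q / h\<close> of them fit into the window.\<close>
      have "t k0 + real i * h \<le> t (k0 + i)" if "k0 + i < K" for i
        using that
      proof (induction i)
        case (Suc i)
        then show ?case using t2[of "k0 + i" "k0 + Suc i"] by (auto simp: algebra_simps)
      qed simp
      from this[of "k1 - k0"] have "real c * h \<le> real M * q"
        using k01 unfolding P_def c_def by (auto simp: algebra_simps)
      then have cM: "real c \<le> real M * q / h" using h by (simp add: pos_le_divide_eq)
      have FG: "F (k0 + i) = G ((y - real k0 * h) - real i * h)" if "i < c" for i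
      proof -
        have k: "k0 + i \<in> P" using that unfolding P c_def by simp
        then obtain z where z: "t (k0 + i) = real (k0 + i) * h + real_of_int z * q"
          using t3[of "k0 + i"] unfolding P_def by blast
        have "F (k0 + i) = G (y - t (k0 + i))"
          unfolding F_def using k unfolding P_def by (intro G(2)) auto
        also have "y - t (k0 + i) = ((y - real k0 * h) - real i * h) + real_of_int (- z) * q"
          unfolding z by (simp add: algebra_simps)
        finally show ?thesis unfolding G(3) .
      qed
      have PF: "sum F P = (\<Sum>i<c. F (k0 + i))"
        unfolding P c_def[symmetric]
        by (rule sum.reindex_bij_witness[of _ "\<lambda>i. k0 + i" "\<lambda>k. k - k0"]) auto
      show ?thesis
      proof (cases "c \<ge> K0")
        case True
        have "sum F P = (\<Sum>i<c. G ((y - real k0 * h) - real i * h))"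
          unfolding PF by (rule sum.cong) (auto simp: FG)
        moreover have "real c > 0" by (simp add: c_def)
        ultimately have "\<bar>sum F P\<bar> \<le> (\<epsilon> / 2 * h / q) * real c"
          using less_imp_le[OF K0[OF True, of "y - real k0 * h"]] by (simp add: pos_divide_le_eq)
        also have "\<dots> \<le> (\<epsilon> / 2 * h / q) * (real M * q / h)"
          using cM \<open>\<epsilon> > 0\<close> h q_pos by (intro mult_left_mono) auto
        finally show ?thesis using D mult_nonneg_nonneg[of "real K0" D] by linarith
      next
        case False
        have "\<bar>sum F P\<bar> \<le> (\<Sum>i<c. D)"
          unfolding PF by (rule order_trans[OF sum_abs]) (intro sum_mono F_bd)
        also have "\<dots> \<le> real K0 * D" using False D by (simp add: mult_right_mono)
        finally show ?thesis using \<open>\<epsilon> > 0\<close> h q_pos by (simp add: add_increasing)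
      qed
    qed
    have "(\<Sum>k<K. F k) = sum F (P \<union> L \<union> R)"
    proof (rule sum.mono_neutral_right)
      show "\<forall>k\<in>{..<K} - (P \<union> L \<union> R). F k = 0"
      proof
        fix k assume "k \<in> {..<K} - (P \<union> L \<union> R)"
        then have "t k + h \<le> y \<or> y + real M * q \<le> t k"
          unfolding P_def L_def R_def by auto
        then show "F k = 0" by (rule F_out)
      qed
    qed (auto simp: P_def L_def R_def)
    also have "\<dots> = sum F P + sum F L + sum F R"
    proof -
      have fin: "finite P" "finite L" "finite R" by (auto simp: P_def L_def R_def)
      have "P \<inter> L = {}" "(P \<union> L) \<inter> R = {}" by (auto simp: P_def L_def R_def)
      then show ?thesis using fin by (simp add: sum.union_disjoint)
    qed
    finally have "\<bar>\<Sum>k<K. F k\<bar> \<le> (\<epsilon> / 2 * h / q) * (real M * q / h) + real K0 * D + D + D"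
      using 1 2 3 by linarith
    also have "\<dots> = \<epsilon> / 2 * real M + C"
      using h q_pos by (simp add: C_def algebra_simps)
    also have "\<dots> \<le> \<epsilon> * real M"
    proof -
      have "2 * C / \<epsilon> \<le> real M" using M by linarith
      then show ?thesis using \<open>\<epsilon> > 0\<close> by (simp add: field_simps)
    qed
    finally show "\<bar>\<Sum>j<M. g n (y + real j * q)\<bar> \<le> \<epsilon> * real M" unfolding sumF .
  qed
qed

lemma sum_corr:
  assumes "tow_seq m b" "tow_seq m g" "n \<ge> m" "finite I"
  shows "(\<Sum>i\<in>I. corr b g n (- a i)) = (\<integral>y. b n y * (\<Sum>i\<in>I. g n (y - a i)) \<partial>lborel)"
proof -
  have "integrable lborel (\<lambda>y. b n y * g n (y - a i))" for i
    using tow_integrable2[OF assms(1-3), of 0 "- a i"] by simp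
  then show ?thesis
    unfolding corr_def by (simp add: sum_distrib_left Bochner_Integration.integral_sum)
qed

lemma tow_integrable_sum:
  assumes "tow_seq m g" "n \<ge> m"
  shows "integrable lborel (\<lambda>y. \<Sum>i\<in>I. g n (y - a i))"
  using tow_integrable[OF assms, of "- a i" for i] by (intro Bochner_Integration.integrable_sum) simp

text \<open>The factor \<open>b\<close> is bounded by 1 and is dropped, leaving a norm of a sum of
  translates of \<open>g\<close>. The L1 form serves the strides \<open>k * q\<close>, the supremum
  form below serves the stride \<open>q\<close>.\<close>

lemma sum_corr_le_L1:
  assumes "tow_seq m b" "tow_seq m g" "n \<ge> m" "finite I"
  shows "\<bar>\<Sum>i\<in>I. corr b g n (- a i)\<bar> \<le> (\<integral>y. \<bar>\<Sum>i\<in>I. g n (y - a i)\<bar> \<partial>lborel)"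
  unfolding sum_corr[OF assms]
proof (rule order_trans[OF integral_abs_bound], rule integral_mono')
  show "integrable lborel (\<lambda>y. \<bar>\<Sum>i\<in>I. g n (y - a i)\<bar>)"
    by (intro integrable_abs tow_integrable_sum[OF assms(2,3)])
  show "\<bar>b n y * (\<Sum>i\<in>I. g n (y - a i))\<bar> \<le> \<bar>\<Sum>i\<in>I. g n (y - a i)\<bar>" for y
    using tow_seqD(2)[OF assms(1,3), of y] by (simp add: abs_mult mult_left_le_one_le)
qed simp

lemma sum_corr_le_sup:
  assumes "tow_seq m b" "tow_seq m g" "n \<ge> m" "finite I"
    and c: "\<And>y. \<bar>\<Sum>i\<in>I. g n (y - a i)\<bar> \<le> c"
  shows "\<bar>\<Sum>i\<in>I. corr b g n (- a i)\<bar> \<le> c * H n"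
proof -
  have c0: "0 \<le> c" using c[of 0] by linarith
  have "\<bar>\<Sum>i\<in>I. corr b g n (- a i)\<bar> \<le> (\<integral>y. c * indicator {0..<H n} y \<partial>lborel)"
    unfolding sum_corr[OF assms(1-4)]
  proof (rule order_trans[OF integral_abs_bound], rule integral_mono')
    show "integrable lborel (\<lambda>y. c * indicator {0..<H n} y :: real)"
      using H_pos[of n] by (intro integrable_mult_right integrable_real_indicator) auto
    show "\<bar>b n y * (\<Sum>i\<in>I. g n (y - a i))\<bar> \<le> c * indicator {0..<H n} y" for y
    proof (cases "y \<in> {0..<H n}")
      case True
      have "\<bar>b n y\<bar> * \<bar>\<Sum>i\<in>I. g n (y - a i)\<bar> \<le> 1 * c"
        using c[of y] tow_seqD(2)[OF assms(1,3), of y] by (intro mult_mono) auto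
      then show ?thesis using True by (simp add: abs_mult)
    next
      case False
      then show ?thesis using tow_seqD(3)[OF assms(1,3) False] c0 by simp
    qed
  qed (use c0 in simp)
  also have "\<dots> = c * H n" using H_pos[of n] by simp
  finally show ?thesis .
qed

lemma staircase_sum_le:
  assumes "tow_seq m b" "tow_seq m g" "n \<ge> m"
    and M0: "\<And>M n y. M0 \<le> M \<Longrightarrow> n \<ge> m \<Longrightarrow> \<bar>\<Sum>j<M. g n (y + real j * q)\<bar> \<le> \<epsilon> * real M"
    and "M0 \<le> M"
  shows "\<bar>\<Sum>i<M. corr b g n (s - real i * q)\<bar> \<le> \<epsilon> * real M * H n"
proof -
  have "\<bar>\<Sum>i<M. corr b g n (- (real i * q - s))\<bar> \<le> \<epsilon> * real M * H n"
  proof (rule sum_corr_le_sup[OF assms(1-3)])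
    fix y
    \<comment> \<open>Reversing the order turns the downward shifts into the upward progression of
      \<open>sup_bound\<close>.\<close>
    have "(\<Sum>i<M. g n (y - (real i * q - s))) = (\<Sum>j<M. g n ((y + s - (real M - 1) * q) + real j * q))"
      by (subst sum.nat_diff_reindex[symmetric], rule sum.cong)
         (auto simp: algebra_simps of_nat_diff Suc_le_eq)
    then show "\<bar>\<Sum>i<M. g n (y - (real i * q - s))\<bar> \<le> \<epsilon> * real M"
      using M0[OF assms(5,3)] by simp
  qed simp
  then show ?thesis by simp
qed

text \<open>A time just below \<open>H \<mu>\<close> moves each copy of tower \<open>\<mu>\<close> inside tower \<open>\<mu> + 1\<close> to the next one, delayed
  by \<open>i * q\<close> in the \<open>i\<close>-th subcolumn, so \<open>sup_bound\<close> applies to the sum over \<open>i\<close>.\<close>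

lemma near_return:
  assumes b: "tow_seq m b" and g: "tow_seq m g" and eq: "equi q (H m) (H m) (g m)"
    and zero: "integral\<^sup>L lborel (g m) = 0" and "\<epsilon> > 0"
  shows "\<exists>m0 \<rho>. 0 < \<rho> \<and> (\<forall>\<mu>\<ge>m0. \<forall>n>\<mu>. \<forall>t. (1 - \<rho>) * H \<mu> \<le> t \<longrightarrow> t \<le> H \<mu> \<longrightarrow>
      \<bar>w n * corr b g n t\<bar> \<le> \<epsilon>)"
proof -
  \<comment> \<open>For times within \<open>\<rho> * H \<mu>\<close> of the height, a copy overlaps
    itself over a length of at most \<open>\<rho> * H \<mu>\<close>, so the diagonal part costs at
    most \<open>\<rho> * W \<le> \<epsilon> / 4\<close>.\<close>
  define \<rho> where "\<rho> = min 1 (\<epsilon> / (4 * W))"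
  have \<rho>: "0 < \<rho>" "\<rho> \<le> 1" "\<rho> * W \<le> \<epsilon> / 4"
  proof -
    have "\<rho> * W \<le> \<epsilon> / (4 * W) * W" using W_pos unfolding \<rho>_def by (intro mult_right_mono) auto
    then show "\<rho> * W \<le> \<epsilon> / 4" using W_pos by simp
  qed (use W_pos \<open>\<epsilon> > 0\<close> in \<open>auto simp: \<rho>_def\<close>)
  obtain M0 where M0: "\<And>M n y. M0 \<le> M \<Longrightarrow> n \<ge> m \<Longrightarrow>
      \<bar>\<Sum>j<M. g n (y + real j * q)\<bar> \<le> (\<epsilon> / (4 * W)) * real M"
    using sup_bound[OF g eq zero, of "\<epsilon> / (4 * W)"] W_pos \<open>\<epsilon> > 0\<close> by auto
  \<comment> \<open>The term with \<open>8 * W / \<epsilon>\<close> pays for the passage from tower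
    \<open>\<mu> + 1\<close> to tower \<open>n\<close>, which by \<open>corr_stable\<close> costs at
    most \<open>2 * W / (\<mu> + 1)\<close>.\<close>
  define m0 where "m0 = m + M0 + nat \<lceil>8 * W / \<epsilon>\<rceil> + 1"
  have m0: "m \<le> m0" "M0 \<le> m0" "nat \<lceil>8 * W / \<epsilon>\<rceil> \<le> m0" "1 \<le> m0"
    unfolding m0_def by linarith+
  show ?thesis
  proof (intro exI[of _ m0] exI[of _ \<rho>] conjI allI impI)
    show "0 < \<rho>" by fact
  next
    fix \<mu> n t
    assume \<mu>: "m0 \<le> \<mu>" and n: "\<mu> < n" and t: "(1 - \<rho>) * H \<mu> \<le> t" "t \<le> H \<mu>"
    have t0: "0 \<le> t" using t(1) \<rho>(2) H_pos[of \<mu>] mult_nonneg_nonneg[of "1 - \<rho>" "H \<mu>"] by linarith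
    have \<mu>m: "\<mu> \<ge> m" using \<mu> m0 by simp
    have wH': "w \<mu> * H \<mu> \<le> W" by (rule wH)
    have "w (Suc \<mu>) * corr b g (Suc \<mu>) t
       = w \<mu> * corr b g \<mu> t + w (Suc \<mu>) * (\<Sum>i<\<mu>. corr b g \<mu> (t - H \<mu> - real i * q))"
      unfolding corr_expand[OF b g \<mu>m t0 t(2)] w_mult_Suc[of \<mu>, symmetric] by (simp add: algebra_simps)
    moreover have "\<bar>w \<mu> * corr b g \<mu> t\<bar> \<le> \<epsilon> / 4"
    proof -
      have "\<bar>corr b g \<mu> t\<bar> \<le> \<rho> * H \<mu>"
        using corr_bound[OF b g \<mu>m, of t] t t0 \<rho> H_pos[of \<mu>]
          mult_nonneg_nonneg[of \<rho> "H \<mu>"] by (simp add: algebra_simps)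
      then have "\<bar>w \<mu> * corr b g \<mu> t\<bar> \<le> w \<mu> * (\<rho> * H \<mu>)" using w_pos[of \<mu>] by (simp add: abs_mult)
      also have "\<dots> = \<rho> * (w \<mu> * H \<mu>)" by simp
      also have "\<dots> \<le> \<rho> * W" using wH' \<rho> by (intro mult_left_mono) auto
      finally show ?thesis using \<rho> by simp
    qed
    moreover have "\<bar>w (Suc \<mu>) * (\<Sum>i<\<mu>. corr b g \<mu> (t - H \<mu> - real i * q))\<bar> \<le> \<epsilon> / 4"
    proof -
      have "\<bar>\<Sum>i<\<mu>. corr b g \<mu> (t - H \<mu> - real i * q)\<bar> \<le> \<epsilon> / (4 * W) * real \<mu> * H \<mu>"
        using \<mu> m0 by (intro staircase_sum_le[OF b g \<mu>m M0]) auto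
      also have "\<dots> \<le> \<epsilon> / (4 * W) * real (Suc \<mu>) * H \<mu>"
        using W_pos \<open>\<epsilon> > 0\<close> H_pos[of \<mu>] by (intro mult_right_mono mult_left_mono) auto
      finally have "\<bar>w (Suc \<mu>) * (\<Sum>i<\<mu>. corr b g \<mu> (t - H \<mu> - real i * q))\<bar>
          \<le> w (Suc \<mu>) * (\<epsilon> / (4 * W) * real (Suc \<mu>) * H \<mu>)"
        unfolding abs_mult abs_of_pos[OF w_pos] using w_pos[of "Suc \<mu>"] by (intro mult_left_mono) auto
      also have "\<dots> = \<epsilon> / (4 * W) * ((w (Suc \<mu>) * real (Suc \<mu>)) * H \<mu>)" by (simp only: ac_simps)
      also have "\<dots> = \<epsilon> / (4 * W) * (w \<mu> * H \<mu>)" by (simp only: w_mult_Suc)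
      also have "\<dots> \<le> \<epsilon> / (4 * W) * W" using wH' W_pos \<open>\<epsilon> > 0\<close> by (intro mult_left_mono) auto
      also have "\<dots> = \<epsilon> / 4" using W_pos by simp
      finally show ?thesis .
    qed
    moreover have "\<bar>w n * corr b g n t - w (Suc \<mu>) * corr b g (Suc \<mu>) t\<bar> \<le> \<epsilon> / 4"
    proof -
      have "\<bar>w n * corr b g n t - w (Suc \<mu>) * corr b g (Suc \<mu>) t\<bar> \<le> 2 * w (Suc \<mu>) * t"
        using n \<mu>m t H_le_Suc[of \<mu>] t0 by (intro corr_stable[OF b g]) auto
      also have "\<dots> \<le> 2 * w (Suc \<mu>) * H \<mu>" using t w_pos[of "Suc \<mu>"] by (intro mult_left_mono) auto
      also have "\<dots> = 2 * (w \<mu> * H \<mu>) / real (Suc \<mu>)" by (simp add: w_Suc)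
      also have "\<dots> \<le> 2 * W / real (Suc \<mu>)" using wH' by (intro divide_right_mono) auto
      also have "\<dots> \<le> \<epsilon> / 4"
      proof -
        have "8 * W / \<epsilon> \<le> real (Suc \<mu>)" using \<mu> m0(3) by linarith
        then show ?thesis using \<open>\<epsilon> > 0\<close> by (simp add: field_simps)
      qed
      finally show ?thesis .
    qed
    ultimately show "\<bar>w n * corr b g n t\<bar> \<le> \<epsilon>" using \<open>\<epsilon> > 0\<close> by linarith
  qed
qed

end

section \<open>Growth of the heights and averages over large strides\<close>

lemma poly_le_fact:
  fixes A B C c :: real
  assumes "A > 0"
  shows "\<forall>\<^sub>F n in sequentially. B * (real n + c) ^ K * (real n)\<^sup>2 + C \<le> A * fact n"
proof -
  \<comment> \<open>The comparison of a polynomial with the factorial passes through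
    \<open>2 ^ n\<close>.\<close>
  have 1: "(\<lambda>n::nat. B * ((real n + c) ^ K * (real n)\<^sup>2 / 2 ^ n) + C / 2 ^ n) \<longlonglongrightarrow> B * 0 + 0"
  proof (intro tendsto_add tendsto_mult tendsto_const)
    show "(\<lambda>n::nat. (real n + c) ^ K * (real n)\<^sup>2 / 2 ^ n) \<longlonglongrightarrow> 0" by real_asymp
    show "(\<lambda>n::nat. C / 2 ^ n) \<longlonglongrightarrow> 0" by real_asymp
  qed
  have 2: "(\<lambda>n. 2 ^ n / fact n :: real) \<longlonglongrightarrow> 0"
    using summable_LIMSEQ_zero[OF summable_exp[of 2]] by (simp add: field_simps)
  have "(\<lambda>n. (B * ((real n + c) ^ K * (real n)\<^sup>2 / 2 ^ n) + C / 2 ^ n) * (2 ^ n / fact n)) \<longlonglongrightarrow> 0"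
    using tendsto_mult[OF 1 2] by simp
  then have "\<forall>\<^sub>F n in sequentially.
      (B * ((real n + c) ^ K * (real n)\<^sup>2 / 2 ^ n) + C / 2 ^ n) * (2 ^ n / fact n) < A"
    using assms by (rule order_tendstoD)
  then show ?thesis
  proof eventually_elim
    case (elim n)
    have "(B * ((real n + c) ^ K * (real n)\<^sup>2 / 2 ^ n) + C / 2 ^ n) * (2 ^ n / fact n)
        = (B * (real n + c) ^ K * (real n)\<^sup>2 + C) / fact n"
      by (simp add: field_simps)
    then show ?case using elim by (simp add: pos_divide_less_eq)
  qed
qed

context tower_data
begin

text \<open>By \<open>H_ge_quad\<close> the spacers inserted at this stage are together no taller
  than the \<open>n + 1\<close> copies.\<close>

lemma H_Suc_le: "2 \<le> n \<Longrightarrow> H (Suc n) \<le> 2 * real (Suc n) * H n"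
proof -
  assume n: "2 \<le> n"
  have "q * (real n * 1 / 2) \<le> q * (real n * (real n - 1) / 2)"
    using n q_pos by (intro mult_left_mono divide_right_mono mult_left_mono) auto
  also have "\<dots> \<le> H n" by (rule H_ge_quad)
  finally have "real (Suc n) * (q * real n / 2) \<le> real (Suc n) * H n" by (intro mult_left_mono) auto
  then show ?thesis unfolding H_Suc by (simp add: algebra_simps)
qed

lemma H_add_le:
  assumes "2 \<le> m"
  shows "H (m + j) \<le> (2 * real (m + j)) ^ j * H m"
proof (induction j)
  case (Suc j)
  have "H (m + Suc j) \<le> 2 * real (m + Suc j) * H (m + j)"
    using H_Suc_le[of "m + j"] assms by simp
  also have "\<dots> \<le> 2 * real (m + Suc j) * ((2 * real (m + j)) ^ j * H m)"
    by (intro mult_left_mono Suc.IH) auto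
  also have "\<dots> \<le> 2 * real (m + Suc j) * ((2 * real (m + Suc j)) ^ j * H m)"
    using H_pos[of m] by (intro mult_left_mono mult_right_mono power_mono) auto
  finally show ?case by simp
qed simp

text \<open>The first inequality makes tower heights from stage \<open>m\<close> on well
  approximable by multiples of the stride \<open>k * q\<close>; the second keeps the first
  \<open>M\<close> of these heights short against \<open>n\<close> strides. The least
  \<open>m\<close> with the first property works: failure at \<open>m - 1\<close> bounds
  \<open>H (m + M)\<close> by a polynomial in \<open>m\<close> times the stride, while
  \<open>H (m - 1) \<ge> fact (m - 1) * p\<close> forces that polynomial to be small against
  \<open>n\<close>.\<close>

lemma scale_choice:
  assumes "\<eta> > 0"
  shows "\<exists>n1. \<forall>n\<ge>n1. \<forall>k. 1 \<le> k \<longrightarrow> k \<le> n + 1 \<longrightarrow>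
    (\<exists>m\<ge>m0. real m * (real k * q) \<le> H m \<and> H (m + M) \<le> \<eta> * real n * (real k * q))"
proof -
  \<comment> \<open>Found by solving backwards: failure at stage \<open>j\<close> gives
    \<open>p * fact j \<le> H j < j * k * q \<le> 2 * n * j * q\<close>, and with this
    \<open>B\<close> the polynomial bound at \<open>j\<close> becomes the desired bound by
    \<open>\<eta> * n\<close>.\<close>
  define B where "B = 2 ^ Suc M * 2 / \<eta> * q"
  have "\<forall>\<^sub>F n in sequentially. B * (real n + (real M + 1)) ^ Suc M * (real n)\<^sup>2 + 0 \<le> p * fact n"
    using p_pos by (rule poly_le_fact)
  then obtain m1 where m1: "\<And>n. n \<ge> m1 \<Longrightarrow> B * (real n + (real M + 1)) ^ Suc M * (real n)\<^sup>2 \<le> p * fact n"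
    unfolding eventually_sequentially by auto
  define m2 where "m2 = m0 + m1 + 3"
  define n1 where "n1 = nat \<lceil>H (m2 + M) / (\<eta> * q)\<rceil> + 1"
  show ?thesis
  proof (rule exI[of _ n1], intro allI impI)
    fix n k :: nat
    assume n: "n1 \<le> n" and k: "1 \<le> k" "k \<le> n + 1"
    define P where "P m \<longleftrightarrow> m2 \<le> m \<and> real m * (real k * q) \<le> H m" for m
    have "\<exists>m. P m"
    proof -
      define m where "m = m2 + 2 * k + 1"
      have "real m * (real k * q) \<le> q * (real m * (real m - 1) / 2)"
      proof -
        have "real k \<le> (real m - 1) / 2" by (simp add: m_def)
        then have "(real m * q) * real k \<le> (real m * q) * ((real m - 1) / 2)"
          using q_pos by (intro mult_left_mono) auto
        then show ?thesis by (simp add: algebra_simps)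
      qed
      then have "real m * (real k * q) \<le> H m" using H_ge_quad[of m] by (rule order_trans)
      moreover have "m2 \<le> m" by (simp add: m_def)
      ultimately have "P m" unfolding P_def by blast
      then show ?thesis ..
    qed
    define m where "m = (LEAST m. P m)"
    have Pm: "P m" unfolding m_def using \<open>\<exists>m. P m\<close> by (rule LeastI_ex)
    have "H (m + M) \<le> \<eta> * real n * (real k * q)"
    \<comment> \<open>At the starting value \<open>m2\<close> minimality gives no information;
      \<open>n1\<close> is chosen for this case, using that the stride is at least
      \<open>q\<close>.\<close>
    proof (cases "m = m2")
      case True
      have "H (m2 + M) / (\<eta> * q) \<le> real n" using n unfolding n1_def by linarith
      then have "H (m2 + M) \<le> \<eta> * real n * (1 * q)"
        using assms q_pos by (simp add: pos_divide_le_eq algebra_simps)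
      also have "\<dots> \<le> \<eta> * real n * (real k * q)"
        using assms q_pos k by (intro mult_left_mono mult_right_mono) auto
      finally show ?thesis using True by simp
    next
      case False
      then obtain j where j: "m = Suc j" "m2 \<le> j"
        using Pm unfolding P_def by (cases m) auto
      have "\<not> P j" using not_less_Least[of j P] j unfolding m_def by auto
      then have Hj: "H j < real j * (real k * q)" using j unfolding P_def by simp
      have j3: "j \<ge> 3" "j \<ge> m1" using j unfolding m2_def by auto
      have kn: "real k \<le> 2 * real n" using k n unfolding n1_def by simp
      have "2 ^ Suc M * (real j + (real M + 1)) ^ Suc M * real j \<le> \<eta> * real n"
      proof -
        have "2 * (2 ^ Suc M * (real j + (real M + 1)) ^ Suc M * real j) / \<eta> * (q * real j)
           = B * (real j + (real M + 1)) ^ Suc M * (real j)\<^sup>2"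
          using assms by (simp add: B_def power2_eq_square field_simps)
        also have "\<dots> \<le> p * fact j" using m1 j3 by simp
        also have "\<dots> \<le> H j" using H_ge_fact[of j] by (simp add: mult.commute)
        also have "\<dots> \<le> real k * (q * real j)" using Hj by (simp add: algebra_simps)
        also have "\<dots> \<le> 2 * real n * (q * real j)" using kn q_pos by (intro mult_right_mono) auto
        finally have "2 * (2 ^ Suc M * (real j + (real M + 1)) ^ Suc M * real j) / \<eta> \<le> 2 * real n"
          using q_pos j3 by (subst (asm) mult_le_cancel_right) auto
        then show ?thesis using assms by (simp add: pos_divide_le_eq) (simp add: algebra_simps)
      qed
      then have *: "2 ^ Suc M * (real j + (real M + 1)) ^ Suc M * real j * (real k * q) \<le> \<eta> * real n * (real k * q)"
        using q_pos by (intro mult_right_mono) auto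
      have "H (m + M) = H (j + Suc M)" using j by simp
      also have "\<dots> \<le> (2 * real (j + Suc M)) ^ Suc M * H j" using j3 by (intro H_add_le) auto
      also have "\<dots> \<le> (2 * real (j + Suc M)) ^ Suc M * (real j * (real k * q))"
        using Hj by (intro mult_left_mono) auto
      also have "\<dots> = 2 ^ Suc M * (real j + (real M + 1)) ^ Suc M * real j * (real k * q)"
        unfolding power_mult_distrib by (simp add: algebra_simps)
      finally show ?thesis using * by linarith
    qed
    moreover have "m0 \<le> m" using Pm unfolding P_def m2_def by simp
    ultimately show "\<exists>m\<ge>m0. real m * (real k * q) \<le> H m \<and> H (m + M) \<le> \<eta> * real n * (real k * q)"
      using Pm unfolding P_def by blast
  qed
qed

lemma tow_L1_le:
  assumes "tow_seq m g" "n \<ge> m"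
  shows "w n * (\<integral>y. \<bar>g n (y - a)\<bar> \<partial>lborel) \<le> W"
proof -
  have "(\<integral>y. \<bar>g n (y - a)\<bar> \<partial>lborel) = (\<integral>y. \<bar>g n y\<bar> \<partial>lborel)"
    using integral_shift[of "\<lambda>y. \<bar>g n y\<bar>" "- a"] by simp
  also have "\<dots> \<le> (\<integral>y. indicator {0..<H n} y \<partial>lborel)"
  proof (rule integral_mono')
    show "integrable lborel (indicator {0..<H n} :: real \<Rightarrow> real)"
      using H_pos[of n] by (intro integrable_real_indicator) auto
    show "\<bar>g n y\<bar> \<le> indicator {0..<H n} y" for y
      using tow_seqD(2,3)[OF assms, of y] by (cases "y \<in> {0..<H n}") auto
  qed simp
  also have "\<dots> = H n" using H_pos[of n] by simp
  finally have "w n * (\<integral>y. \<bar>g n (y - a)\<bar> \<partial>lborel) \<le> w n * H n"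
    using w_pos[of n] by (intro mult_left_mono) auto
  then show ?thesis using wH[of n] by linarith
qed

text \<open>In the square of the sum, weighted by \<open>w n\<close>, the diagonal contributes at
  most \<open>M * W\<close> and the other pairs at most \<open>M^2 * \<epsilon>\<close>. The L1 norm
  then follows from \<open>\<bar>v\<bar> \<le> v^2 / (2 * D) + D / 2\<close> with
  \<open>D = \<delta> * M\<close>, a form of Cauchy-Schwarz on the support
  \<open>[0, 2 * H n)\<close>.\<close>

lemma shifted_sums_L1:
  fixes a :: "nat \<Rightarrow> real"
  assumes g: "tow_seq m g" and n: "n \<ge> m" and "\<epsilon> > 0" "\<delta> > 0" "M > 0"
    and corr: "\<And>l l'. l' < l \<Longrightarrow> l < M \<Longrightarrow> \<bar>w n * corr g g n (a l - a l')\<bar> \<le> \<epsilon>"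
    and a: "\<And>l. l < M \<Longrightarrow> 0 \<le> a l \<and> a l \<le> H n"
  shows "w n * (\<integral>y. \<bar>\<Sum>l<M. g n (y - a l)\<bar> \<partial>lborel) \<le> (W / (2 * \<delta> * M) + \<epsilon> / (2 * \<delta>) + \<delta> * W) * M"
proof -
  define v where "v y = (\<Sum>l<M. g n (y - a l))" for y
  have v2: "(v y)\<^sup>2 = (\<Sum>l<M. \<Sum>l'<M. g n (y + (- a l)) * g n (y + (- a l')))" for y
    unfolding v_def power2_eq_square sum_product by simp
  have int_v2: "integrable lborel (\<lambda>y. (v y)\<^sup>2)"
    unfolding v2 by (intro Bochner_Integration.integrable_sum tow_integrable2[OF g g n])
  have int_v: "integrable lborel v" unfolding v_def by (rule tow_integrable_sum[OF g n])
  have c: "\<bar>w n * corr g g n (a l - a l')\<bar> \<le> (if l = l' then W else 0) + \<epsilon>" if "l < M" "l' < M" for l l'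
  proof (cases l l' rule: linorder_cases)
    case less
    then show ?thesis using corr[of l l'] corr_sym[OF g n, of "a l' - a l"] that by simp
  next
    case equal
    have "\<bar>w n * corr g g n (a l - a l')\<bar> \<le> w n * H n"
      using corr_bound[OF g g n, of 0] w_pos[of n] H_pos[of n] equal by (simp add: abs_mult)
    then show ?thesis using wH[of n] equal \<open>\<epsilon> > 0\<close> by simp
  next
    case greater
    then show ?thesis using corr[of l' l] that by simp
  qed
  have "w n * (\<integral>y. (v y)\<^sup>2 \<partial>lborel) = (\<Sum>l<M. \<Sum>l'<M. w n * corr g g n (a l - a l'))"
    unfolding v2
    by (simp add: Bochner_Integration.integral_sum Bochner_Integration.integrable_sum
        tow_integrable2[OF g g n] corr_shift[OF g g n] sum_distrib_left del: add_uminus_conv_diff)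
  also have "\<dots> \<le> (\<Sum>l<M. \<Sum>l'<M. (if l = l' then W else 0) + \<epsilon>)"
    using c by (intro sum_mono) (auto simp: abs_le_iff)
  also have "\<dots> = real M * W + (real M)\<^sup>2 * \<epsilon>"
    by (simp add: sum.distrib power2_eq_square algebra_simps)
  finally have L2: "w n * (\<integral>y. (v y)\<^sup>2 \<partial>lborel) \<le> real M * W + (real M)\<^sup>2 * \<epsilon>" .
  define D where "D = \<delta> * M"
  have D: "D > 0" using assms by (simp add: D_def)
  have "(\<integral>y. \<bar>v y\<bar> \<partial>lborel) \<le> (\<integral>y. (v y)\<^sup>2 / (2 * D) + D / 2 * indicator {0..<2 * H n} y \<partial>lborel)"
  proof (rule integral_mono)
    show "integrable lborel (\<lambda>y. \<bar>v y\<bar>)" using int_v by simp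
    show "integrable lborel (\<lambda>y. (v y)\<^sup>2 / (2 * D) + D / 2 * indicator {0..<2 * H n} y)"
      using int_v2 H_pos[of n]
      by (intro Bochner_Integration.integrable_add integrable_divide integrable_mult_right integrable_real_indicator) auto
    show "\<bar>v y\<bar> \<le> (v y)\<^sup>2 / (2 * D) + D / 2 * indicator {0..<2 * H n} y" for y
    proof (cases "y \<in> {0..<2 * H n}")
      case True
      have "0 \<le> (\<bar>v y\<bar> - D)\<^sup>2" by simp
      then have "\<bar>v y\<bar> \<le> (v y)\<^sup>2 / (2 * D) + D / 2"
        using D by (simp add: power2_eq_square field_simps)
      then show ?thesis using True by simp
    next
      case False
      have "v y = 0" unfolding v_def
        using a False by (intro sum.neutral ballI tow_seqD(3)[OF g n]) fastforce
      then show ?thesis using D by simp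
    qed
  qed
  also have "\<dots> = (\<integral>y. (v y)\<^sup>2 \<partial>lborel) / (2 * D) + D * H n"
    using int_v2 H_pos[of n] D
    by (subst Bochner_Integration.integral_add) auto
  finally have "w n * (\<integral>y. \<bar>v y\<bar> \<partial>lborel) \<le> w n * ((\<integral>y. (v y)\<^sup>2 \<partial>lborel) / (2 * D) + D * H n)"
    using w_pos[of n] by (intro mult_left_mono) auto
  also have "\<dots> = (w n * (\<integral>y. (v y)\<^sup>2 \<partial>lborel)) / (2 * D) + D * (w n * H n)"
    by (simp add: algebra_simps)
  also have "\<dots> \<le> (real M * W + (real M)\<^sup>2 * \<epsilon>) / (2 * D) + D * W"
    using L2 D wH[of n] by (intro add_mono divide_right_mono mult_left_mono) auto
  also have "\<dots> = (W / (2 * \<delta> * M) + \<epsilon> / (2 * \<delta>) + \<delta> * W) * M"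
    using assms unfolding D_def by (simp add: field_simps power2_eq_square)
  finally show ?thesis unfolding v_def .
qed

end

text \<open>Valid whether or not \<open>s \<le> L\<close>: it compares the two ways of splitting the
  sum over the first \<open>L + s\<close> terms.\<close>

lemma sum_shift_diff:
  fixes x :: "nat \<Rightarrow> real"
  shows "(\<Sum>i<L. x i) = (\<Sum>i<L. x (i + s)) + ((\<Sum>i<s. x i) - (\<Sum>i<s. x (i + L)))"
proof -
  have "(\<Sum>i<L + s. x i) = (\<Sum>i<L. x i) + (\<Sum>i<s. x (i + L))" for L s :: nat
    by (induction s) (auto simp: algebra_simps)
  from this[of L s] this[of s L] show ?thesis by (simp add: add.commute)
qed

context tower_data
begin

text \<open>Uniformity in the stride \<open>k * q\<close>: averaging over shifts by multiples of the stride chosen close to the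
  rapidly growing heights \<open>H \<mu>, H (\<mu> + 1), \<dots>\<close> makes all differences of shifts near-return times, and
  \<open>scale_choice\<close> keeps the shifts short compared with \<open>n\<close> strides.\<close>

lemma strided_L1:
  assumes g: "tow_seq m g" and eq: "equi q (H m) (H m) (g m)"
    and zero: "integral\<^sup>L lborel (g m) = 0" and "\<epsilon> > 0"
  shows "\<exists>n1\<ge>m. \<forall>n\<ge>n1. \<forall>k L. 1 \<le> k \<longrightarrow> k \<le> n + 1 \<longrightarrow> L \<le> n + 1 \<longrightarrow>
    w n * (\<integral>y. \<bar>\<Sum>i<L. g n (y - real i * (real k * q))\<bar> \<partial>lborel) \<le> \<epsilon> * real n"
proof -
  \<comment> \<open>\<delta>, \<open>M\<close> and \<open>\<epsilon>'\<close> make each of the three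
    terms of \<open>shifted_sums_L1\<close> at most \<open>\<epsilon> / 16\<close>:
    \<open>\<delta> * W\<close>, the diagonal \<open>W / (2 * \<delta> * M)\<close> and the
    off-diagonal \<open>\<epsilon>' / (2 * \<delta>)\<close>.\<close>
  define \<delta> where "\<delta> = \<epsilon> / (16 * W)"
  have \<delta>: "\<delta> > 0" "\<delta> * W = \<epsilon> / 16" using \<open>\<epsilon> > 0\<close> W_pos by (auto simp: \<delta>_def)
  define M where "M = nat \<lceil>8 * W / (\<epsilon> * \<delta>)\<rceil> + 1"
  have M: "M > 0" "W / (2 * \<delta> * real M) \<le> \<epsilon> / 16"
  proof -
    have "8 * W / (\<epsilon> * \<delta>) \<le> real M" unfolding M_def by linarith
    then have "8 * W \<le> real M * (\<epsilon> * \<delta>)" using \<open>\<epsilon> > 0\<close> \<delta>(1) by (simp add: pos_divide_le_eq)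
    moreover have "0 < 2 * \<delta> * real M" using \<delta> by (simp add: M_def)
    ultimately show "W / (2 * \<delta> * real M) \<le> \<epsilon> / 16" by (simp add: pos_divide_le_eq algebra_simps)
  qed (simp add: M_def)
  define \<epsilon>' where "\<epsilon>' = \<epsilon> * \<delta> / 8"
  have \<epsilon>': "\<epsilon>' > 0" "\<epsilon>' / (2 * \<delta>) = \<epsilon> / 16" using \<open>\<epsilon> > 0\<close> \<delta>(1) by (auto simp: \<epsilon>'_def)
  obtain m1 \<rho> where \<rho>: "0 < \<rho>" and near: "\<And>\<mu> n t. m1 \<le> \<mu> \<Longrightarrow> \<mu> < n \<Longrightarrow>
      (1 - \<rho>) * H \<mu> \<le> t \<Longrightarrow> t \<le> H \<mu> \<Longrightarrow> \<bar>w n * corr g g n t\<bar> \<le> \<epsilon>'"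
    using near_return[OF g g eq zero \<epsilon>'(1)] by blast
  define m2 where "m2 = m1 + nat \<lceil>2 / \<rho>\<rceil> + 1"
  have m2: "m1 \<le> m2" "2 / \<rho> \<le> real m2" "0 < m2" unfolding m2_def by linarith+
  \<comment> \<open>Shifting the index by at most \<open>\<eta> * n\<close> costs at most
    \<open>2 * \<eta> * n * W\<close> in the L1 norm weighted by \<open>w n\<close>;
    \<open>\<eta> < 1/2\<close> keeps the stages in use below \<open>n\<close>.\<close>
  define \<eta> where "\<eta> = min (1/4) (\<epsilon> / (16 * W))"
  have \<eta>: "0 < \<eta>" "\<eta> < 1/2" "\<eta> * W \<le> \<epsilon> / 16"
  proof -
    have "\<eta> * W \<le> \<epsilon> / (16 * W) * W" using W_pos unfolding \<eta>_def by (intro mult_right_mono) auto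
    then show "\<eta> * W \<le> \<epsilon> / 16" using W_pos by simp
  qed (use W_pos \<open>\<epsilon> > 0\<close> in \<open>auto simp: \<eta>_def\<close>)
  obtain n0 where n0: "\<And>n k. n0 \<le> n \<Longrightarrow> 1 \<le> k \<Longrightarrow> k \<le> n + 1 \<Longrightarrow>
      \<exists>\<mu>\<ge>m2. real \<mu> * (real k * q) \<le> H \<mu> \<and> H (\<mu> + M) \<le> \<eta> * real n * (real k * q)"
    using scale_choice[OF \<eta>(1)] by meson
  show ?thesis
  proof (intro exI[of _ "m + n0 + 1"] conjI allI impI)
    fix n k L :: nat
    assume n: "m + n0 + 1 \<le> n" and k: "1 \<le> k" "k \<le> n + 1" and L: "L \<le> n + 1"
    have nm: "n \<ge> m" "n0 \<le> n" "n \<ge> 1" using n by auto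
    obtain \<mu> where \<mu>: "m2 \<le> \<mu>" "real \<mu> * (real k * q) \<le> H \<mu>" "H (\<mu> + M) \<le> \<eta> * real n * (real k * q)"
      using n0[OF nm(2) k] by blast
    define s where "s = real k * q"
    have s: "s > 0" using k q_pos by (simp add: s_def)
    \<comment> \<open>Otherwise \<open>H (n + 1)\<close> would be at most
      \<open>\<eta> * n * (n + 1) * q\<close>, which is less than the height of its last spacers
      alone.\<close>
    have \<mu>n: "\<mu> + M \<le> n"
    proof (rule ccontr)
      assume "\<not> \<mu> + M \<le> n"
      then have "H (Suc n) \<le> H (\<mu> + M)" by (intro H_mono) simp
      also have "\<dots> \<le> \<eta> * real n * (real (Suc n) * q)"
        using \<mu>(3) k \<eta> q_pos by (elim order_trans) (intro mult_left_mono mult_right_mono, auto)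
      also have "\<dots> < 1/2 * (real n * (real (Suc n) * q))"
        using \<eta>(2) nm q_pos by (simp only: mult.assoc) (intro mult_strict_right_mono, auto)
      also have "\<dots> = q * (real (Suc n) * (real (Suc n) - 1) / 2)" by simp
      also have "\<dots> \<le> H (Suc n)" by (rule H_ge_quad)
      finally show False by simp
    qed
    \<comment> \<open>\<open>a l\<close> is the largest multiple of the stride not exceeding
      \<open>H (\<mu> + l)\<close>. Being a multiple of the stride, it acts on the sum over
      \<open>i\<close> as a shift of the index by \<open>\<sigma> l\<close>.\<close>
    define \<sigma> where "\<sigma> l = nat \<lfloor>H (\<mu> + l) / s\<rfloor>" for l
    define a where "a l = real (\<sigma> l) * s" for l
    have \<sigma>_le: "real (\<sigma> l) \<le> H (\<mu> + l) / s" "H (\<mu> + l) / s < real (\<sigma> l) + 1" for l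
    proof -
      have "0 \<le> H (\<mu> + l) / s" using H_pos[of "\<mu> + l"] s by simp
      then show "real (\<sigma> l) \<le> H (\<mu> + l) / s" "H (\<mu> + l) / s < real (\<sigma> l) + 1"
        unfolding \<sigma>_def by linarith+
    qed
    have a_bd: "0 \<le> a l" "a l \<le> H (\<mu> + l)" "H (\<mu> + l) - s < a l" for l
      using \<sigma>_le[of l] s unfolding a_def by (auto simp: field_simps)
    have \<sigma>_\<eta>: "real (\<sigma> l) \<le> \<eta> * real n" if "l < M" for l
    proof -
      have "H (\<mu> + l) \<le> \<eta> * real n * s"
        using H_mono[of "\<mu> + l" "\<mu> + M"] \<mu>(3) that unfolding s_def by simp
      then have "H (\<mu> + l) / s \<le> \<eta> * real n" using s by (simp add: pos_divide_le_eq)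
      then show ?thesis using \<sigma>_le(1)[of l] by linarith
    qed
    \<comment> \<open>\<open>a l - a l'\<close> falls short of \<open>H (\<mu> + l)\<close> by less
      than \<open>s + a l'\<close>, and both \<open>s\<close> and \<open>a l'\<close> are at most
      \<open>H (\<mu> + l) / \<mu>\<close>: the stride by the choice of \<mu>, the smaller shift by
      one step of the height recursion. Since \<open>2 / \<rho> \<le> \<mu>\<close>, the difference
      is a near-return time.\<close>
    have corr: "\<bar>w n * corr g g n (a l - a l')\<bar> \<le> \<epsilon>'" if "l' < l" "l < M" for l l'
    proof (rule near)
      show "m1 \<le> \<mu> + l" "\<mu> + l < n" using \<mu> m2 \<mu>n that by auto
      show "a l - a l' \<le> H (\<mu> + l)" using a_bd[of l] a_bd[of l'] by linarith
      have \<mu>0: "real \<mu> > 0" using \<mu>(1) m2(3) by simp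
      have 1: "real \<mu> * s \<le> H (\<mu> + l)"
        using \<mu>(2) H_mono[of \<mu> "\<mu> + l"] unfolding s_def by simp
      obtain j where j: "l = Suc j" using \<open>l' < l\<close> by (cases l) auto
      have "real \<mu> * a l' \<le> real \<mu> * H (\<mu> + j)"
        using a_bd(2)[of l'] H_mono[of "\<mu> + l'" "\<mu> + j"] that j by (intro mult_left_mono) auto
      also have "\<dots> \<le> real (Suc (\<mu> + j)) * H (\<mu> + j)"
        using H_pos[of "\<mu> + j"] by (intro mult_right_mono) auto
      also have "\<dots> \<le> H (\<mu> + l)" using H_Suc_ge[of "\<mu> + j"] j by simp
      finally have "real \<mu> * (s + a l') \<le> 2 * H (\<mu> + l)" using 1 by (simp add: distrib_left)
      also have "\<dots> \<le> (real \<mu> * \<rho>) * H (\<mu> + l)"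
      proof (rule mult_right_mono)
        show "2 \<le> real \<mu> * \<rho>" using m2(2) \<mu>(1) \<rho> by (simp add: pos_divide_le_eq) (meson mult_right_mono less_imp_le of_nat_mono order_trans)
      qed (use H_pos[of "\<mu> + l"] in simp)
      finally have "s + a l' \<le> \<rho> * H (\<mu> + l)" using \<mu>0 by (simp add: mult.assoc)
      then show "(1 - \<rho>) * H (\<mu> + l) \<le> a l - a l'"
        using a_bd(3)[of l] by (simp add: algebra_simps)
    qed
    define v where "v y = (\<Sum>l<M. g n (y - a l))" for y
    have v_bd: "w n * (\<integral>y. \<bar>v y\<bar> \<partial>lborel) \<le> (\<epsilon> / 16 + \<epsilon> / 16 + \<epsilon> / 16) * M"
    proof -
      have "w n * (\<integral>y. \<bar>v y\<bar> \<partial>lborel) \<le> (W / (2 * \<delta> * M) + \<epsilon>' / (2 * \<delta>) + \<delta> * W) * M"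
        unfolding v_def
      proof (rule shifted_sums_L1[OF g nm(1) \<epsilon>'(1) \<delta>(1) M(1) corr])
        show "0 \<le> a l \<and> a l \<le> H n" if "l < M" for l
          using a_bd[of l] H_mono[of "\<mu> + l" n] \<mu>n that by simp
      qed
      also have "\<dots> \<le> (\<epsilon> / 16 + \<epsilon> / 16 + \<epsilon> / 16) * M"
        using M(2) \<epsilon>'(2) \<delta>(2) by (intro mult_right_mono add_mono) auto
      finally show ?thesis .
    qed
    define x where "x i y = g n (y - real i * s)" for i y
    have int_x: "integrable lborel (x i)" for i
      using tow_integrable[OF g nm(1), of "- (real i * s)"] by (simp add: x_def[abs_def])
    have int_v: "integrable lborel v" unfolding v_def by (rule tow_integrable_sum[OF g nm(1)])
    have int_v': "integrable lborel (\<lambda>y. \<bar>v (y - c)\<bar>)" for c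
      using integrable_abs[OF int_v[unfolded integrable_shift[of v "- c", symmetric]]] by simp
    have x_L1: "w n * (\<integral>y. \<bar>x i y\<bar> \<partial>lborel) \<le> W" for i
      unfolding x_def by (rule tow_L1_le[OF g nm(1)])
    \<comment> \<open>Shifting the index by \<open>\<sigma> l\<close> and adding over
      \<open>l\<close> turns \<open>M\<close> times the sum into a sum of translates of
      \<open>v\<close>, up to \<open>\<sigma> l\<close> terms at each end.\<close>
    have pt: "real M * \<bar>\<Sum>i<L. x i y\<bar>
        \<le> (\<Sum>i<L. \<bar>v (y - real i * s)\<bar>) + (\<Sum>l<M. \<Sum>i<\<sigma> l. \<bar>x i y\<bar> + \<bar>x (i + L) y\<bar>)" for y
    proof -
      have "real M * (\<Sum>i<L. x i y) = (\<Sum>l<M. \<Sum>i<L. x i y)" by simp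
      also have "\<dots> = (\<Sum>l<M. (\<Sum>i<L. x (i + \<sigma> l) y) + ((\<Sum>i<\<sigma> l. x i y) - (\<Sum>i<\<sigma> l. x (i + L) y)))"
        by (rule sum.cong[OF refl]) (rule sum_shift_diff[of "\<lambda>i. x i y"])
      also have "\<dots> = (\<Sum>i<L. v (y - real i * s)) + (\<Sum>l<M. \<Sum>i<\<sigma> l. x i y - x (i + L) y)"
      proof -
        have "(\<Sum>l<M. \<Sum>i<L. x (i + \<sigma> l) y) = (\<Sum>i<L. v (y - real i * s))"
          by (subst sum.swap) (simp add: v_def x_def a_def algebra_simps)
        then show ?thesis by (simp add: sum.distrib sum_subtractf)
      qed
      finally have eq: "real M * (\<Sum>i<L. x i y)
          = (\<Sum>i<L. v (y - real i * s)) + (\<Sum>l<M. \<Sum>i<\<sigma> l. x i y - x (i + L) y)" .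
      have "real M * \<bar>\<Sum>i<L. x i y\<bar> = \<bar>real M * (\<Sum>i<L. x i y)\<bar>" by (simp only: abs_mult abs_of_nat)
      also have "\<dots> = \<bar>(\<Sum>i<L. v (y - real i * s)) + (\<Sum>l<M. \<Sum>i<\<sigma> l. x i y - x (i + L) y)\<bar>"
        by (simp only: eq)
      also have "\<dots> \<le> (\<Sum>i<L. \<bar>v (y - real i * s)\<bar>) + (\<Sum>l<M. \<Sum>i<\<sigma> l. \<bar>x i y\<bar> + \<bar>x (i + L) y\<bar>)"
        by (intro order_trans[OF abs_triangle_ineq] add_mono sum_abs order_trans[OF sum_abs] sum_mono
             abs_triangle_ineq4)
      finally show ?thesis .
    qed
    have "real M * (\<integral>y. \<bar>\<Sum>i<L. x i y\<bar> \<partial>lborel)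
        \<le> (\<integral>y. (\<Sum>i<L. \<bar>v (y - real i * s)\<bar>) + (\<Sum>l<M. \<Sum>i<\<sigma> l. \<bar>x i y\<bar> + \<bar>x (i + L) y\<bar>) \<partial>lborel)"
      unfolding integral_mult_right_zero[symmetric]
      by (rule integral_mono[OF _ _ pt])
         (intro integrable_mult_right integrable_abs Bochner_Integration.integrable_sum
            Bochner_Integration.integrable_add int_x int_v')+
    also have "\<dots> = (\<Sum>i<L. \<integral>y. \<bar>v (y - real i * s)\<bar> \<partial>lborel)
        + (\<Sum>l<M. \<Sum>i<\<sigma> l. (\<integral>y. \<bar>x i y\<bar> \<partial>lborel) + (\<integral>y. \<bar>x (i + L) y\<bar> \<partial>lborel))"
      by (simp add: Bochner_Integration.integral_add Bochner_Integration.integral_sum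
          Bochner_Integration.integrable_sum Bochner_Integration.integrable_add int_x int_v')
    also have "(\<Sum>i<L. \<integral>y. \<bar>v (y - real i * s)\<bar> \<partial>lborel) = real L * (\<integral>y. \<bar>v y\<bar> \<partial>lborel)"
      using integral_shift[of "\<lambda>y. \<bar>v y\<bar>" "- c" for c] by simp
    finally have "w n * (real M * (\<integral>y. \<bar>\<Sum>i<L. x i y\<bar> \<partial>lborel)) \<le> w n * (real L * (\<integral>y. \<bar>v y\<bar> \<partial>lborel)
        + (\<Sum>l<M. \<Sum>i<\<sigma> l. (\<integral>y. \<bar>x i y\<bar> \<partial>lborel) + (\<integral>y. \<bar>x (i + L) y\<bar> \<partial>lborel)))"
      using w_pos[of n] by (intro mult_left_mono) auto
    also have "\<dots> = real L * (w n * (\<integral>y. \<bar>v y\<bar> \<partial>lborel))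
        + (\<Sum>l<M. \<Sum>i<\<sigma> l. w n * (\<integral>y. \<bar>x i y\<bar> \<partial>lborel) + w n * (\<integral>y. \<bar>x (i + L) y\<bar> \<partial>lborel))"
      by (simp add: distrib_left sum_distrib_left)
    also have "\<dots> \<le> real L * ((\<epsilon> / 16 + \<epsilon> / 16 + \<epsilon> / 16) * M) + (\<Sum>l<M. \<Sum>i<\<sigma> l. W + W)"
      by (intro add_mono mult_left_mono v_bd sum_mono x_L1) simp
    also have "\<dots> \<le> (2 * real n) * ((\<epsilon> / 16 + \<epsilon> / 16 + \<epsilon> / 16) * M) + (\<Sum>l<M. \<eta> * real n * (W + W))"
    proof (intro add_mono mult_right_mono sum_mono)
      show "real L \<le> 2 * real n" using L nm by simp
      show "0 \<le> (\<epsilon> / 16 + \<epsilon> / 16 + \<epsilon> / 16) * M" using \<open>\<epsilon> > 0\<close> by simp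
      show "(\<Sum>i<\<sigma> l. W + W) \<le> \<eta> * real n * (W + W)" if "l \<in> {..<M}" for l
        using \<sigma>_\<eta>[of l] that W_pos by (simp only: sum_constant card_lessThan) (intro mult_right_mono, auto)
    qed
    also have "\<dots> = real M * ((6 / 16 * \<epsilon> + 2 * (\<eta> * W)) * real n)"
      by (simp add: algebra_simps)
    also have "\<dots> \<le> real M * (\<epsilon> * real n)"
      using \<eta>(3) \<open>\<epsilon> > 0\<close> by (intro mult_left_mono mult_right_mono) auto
    finally have "real M * (w n * (\<integral>y. \<bar>\<Sum>i<L. x i y\<bar> \<partial>lborel)) \<le> real M * (\<epsilon> * real n)"
      by (simp only: mult.left_commute)
    then show "w n * (\<integral>y. \<bar>\<Sum>i<L. g n (y - real i * (real k * q))\<bar> \<partial>lborel) \<le> \<epsilon> * real n"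
      using M(1) unfolding x_def s_def by simp
  qed simp
qed

section \<open>Correlations between consecutive tower heights\<close>

lemma H_ge_cube: "q * (real n * (real n - 1) * (real n - 2) / 2) \<le> H n"
proof (cases n)
  case (Suc m)
  have "real (Suc m) * (q * (real m * (real m - 1) / 2)) \<le> real (Suc m) * H m"
    using H_ge_quad[of m] by (intro mult_left_mono) auto
  then show ?thesis using H_Suc_ge[of m] Suc by (simp add: algebra_simps)
qed (use H_pos in \<open>auto intro: less_imp_le\<close>)

text \<open>\<open>H_ge_quad\<close> is only of the order of the spacers added in one stage; one
  further step of the recursion gives the cubic bound, which beats any multiple of a square.\<close>

lemma H_dominates_square:
  assumes "c > 0"
  shows "\<forall>\<^sub>F n in sequentially. q * (real n + 1)\<^sup>2 \<le> c * H n"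
proof -
  have "\<forall>\<^sub>F n::nat in sequentially. (real n + 1)\<^sup>2 \<le> c * (real n * (real n - 1) * (real n - 2) / 2)"
    using assms by real_asymp
  then show ?thesis
  proof eventually_elim
    case (elim n)
    then have "q * (real n + 1)\<^sup>2 \<le> q * (c * (real n * (real n - 1) * (real n - 2) / 2))"
      using q_pos by (intro mult_left_mono) auto
    also have "\<dots> = c * (q * (real n * (real n - 1) * (real n - 2) / 2))" by simp
    also have "\<dots> \<le> c * H n" using H_ge_cube assms by (intro mult_left_mono) auto
    finally show ?case .
  qed
qed

lemma S_diff_ge:
  assumes "i \<le> j"
  shows "(real j - real i) * H n \<le> S n j - S n i"
proof -
  have "real i * (real i - 1) \<le> real j * (real j - 1)"
    using assms by (cases "i = 0"; cases "j = 0") (auto intro!: mult_mono)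
  then have "q * (real i * (real i - 1) / 2) \<le> q * (real j * (real j - 1) / 2)"
    using q_pos by (intro mult_left_mono) auto
  then show ?thesis unfolding S_def by (simp add: algebra_simps)
qed

lemma S_diff_le:
  assumes "j \<le> n"
  shows "S n j - S n i \<le> (real j - real i) * H n + q * (real n)\<^sup>2 / 2"
proof -
  have "real j * (real j - 1) \<le> real n * real n"
    using assms by (cases "j = 0") (auto intro!: mult_mono)
  then have "q * (real j * (real j - 1) / 2) \<le> q * (real n)\<^sup>2 / 2"
    using q_pos by (simp add: power2_eq_square)
  moreover have "0 \<le> q * (real i * (real i - 1) / 2)"
    using q_pos by (cases "i = 0") auto
  moreover have "S n j - S n i = (real j - real i) * H n
      + (q * (real j * (real j - 1) / 2) - q * (real i * (real i - 1) / 2))"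
    unfolding S_def by (simp add: algebra_simps)
  ultimately show ?thesis by linarith
qed

lemma S_add_diff:
  "S n (i + k) - S n i = real k * H n + q * (real k * (real k - 1) / 2) + real i * (real k * q)"
  by (simp add: S_def field_simps)

text \<open>In time \<open>t\<close> the \<open>i\<close>-th copy of tower \<open>n\<close> can only meet the copies \<open>i + k - 1\<close>, \<open>i + k\<close> and \<open>i + k + 1\<close>; the
  first overlap is as small as the total height of the new spacers.\<close>

lemma corr_block:
  assumes b: "tow_seq m b" and g: "tow_seq m g" and n: "n \<ge> m" and k: "k \<ge> 1"
    and \<tau>: "t = real k * H n + \<tau>" "0 \<le> \<tau>" "\<tau> < H n" and Hn: "q * (real n)\<^sup>2 \<le> H n"
  shows "\<bar>corr b g (Suc n) t\<bar> \<le>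
      (\<integral>y. \<bar>\<Sum>i<n + 1 - k. g n (y - real i * (real k * q))\<bar> \<partial>lborel)
    + (\<integral>y. \<bar>\<Sum>i<n - k. g n (y - real i * (real (k + 1) * q))\<bar> \<partial>lborel)
    + real (Suc n) * (q * (real n)\<^sup>2 / 2)"
proof -
  define c where "c i j = corr b g n (t + S n i - S n j)" for i j
  have q2: "0 \<le> q * (real n)\<^sup>2 / 2" using q_pos by simp
  have zero: "c i j = 0" if "j \<le> n" "Suc j < i + k \<or> i + k + 1 < j" for i j
    unfolding c_def
  proof (rule corr_eq_0[OF b g n])
    show "H n \<le> \<bar>t + S n i - S n j\<bar>"
    proof (cases "Suc j < i + k")
      case True
      then have "real j - real i \<le> real k - 2" by linarith
      then have "(real j - real i) * H n \<le> (real k - 2) * H n" using H_pos[of n] by (intro mult_right_mono) auto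
      then have "2 * H n - q * (real n)\<^sup>2 / 2 \<le> t + S n i - S n j"
        using S_diff_le[OF that(1), of i] \<tau> by (simp add: algebra_simps)
      then show ?thesis using Hn by linarith
    next
      case False
      then have "real k + 2 \<le> real j - real i" using that by linarith
      then have "(real k + 2) * H n \<le> (real j - real i) * H n" using H_pos[of n] by (intro mult_right_mono) auto
      also have "\<dots> \<le> S n j - S n i" using False that by (intro S_diff_ge) auto
      finally show ?thesis using \<tau> by (simp add: algebra_simps)
    qed
  qed
  have small: "\<bar>c i j\<bar> \<le> q * (real n)\<^sup>2 / 2" if "j \<le> n" "Suc j = i + k" for i j
  proof -
    have ji: "real j - real i = real k - 1" using that by linarith
    have "H n - q * (real n)\<^sup>2 / 2 \<le> t + S n i - S n j"
      using S_diff_le[OF that(1), of i] \<tau> unfolding ji by (simp add: algebra_simps)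
    then show ?thesis using corr_bound[OF b g n, of "t + S n i - S n j"] q2 Hn unfolding c_def by linarith
  qed
  have row: "(\<Sum>j\<le>n. c i j) = (if i + k \<le> n then c i (i + k) else 0)
      + (if i + k + 1 \<le> n then c i (i + k + 1) else 0)
      + (if i + k - 1 \<le> n then c i (i + k - 1) else 0)" for i
  proof -
    have "(\<Sum>j\<le>n. c i j) = (\<Sum>j\<in>{j \<in> {i + k, i + k + 1, i + k - 1}. j \<le> n}. c i j)"
      by (rule sum.mono_neutral_right) (auto intro!: zero)
    also have "\<dots> = (\<Sum>j\<in>{i + k, i + k + 1, i + k - 1}. if j \<le> n then c i j else 0)"
      by (rule sum.inter_filter) simp
    \<comment> \<open>Because \<open>k \<ge> 1\<close>, truncated subtraction is harmless and the
      three indices are distinct.\<close>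
    also have "\<dots> = (if i + k \<le> n then c i (i + k) else 0)
      + (if i + k + 1 \<le> n then c i (i + k + 1) else 0)
      + (if i + k - 1 \<le> n then c i (i + k - 1) else 0)"
      using k by (subst sum.insert sum.empty; auto)+
    finally show ?thesis .
  qed
  \<comment> \<open>Along the diagonal \<open>j = i + \<kappa>\<close> the offset is a constant plus
    \<open>i * \<kappa> * q\<close> by \<open>S_add_diff\<close>, and the constant disappears in the
    L1 norm.\<close>
  have strip: "\<bar>\<Sum>i\<le>n. if i + \<kappa> \<le> n then c i (i + \<kappa>) else 0\<bar>
      \<le> (\<integral>y. \<bar>\<Sum>i<n + 1 - \<kappa>. g n (y - real i * (real \<kappa> * q))\<bar> \<partial>lborel)" for \<kappa>
  proof -
    define e where "e = real \<kappa> * H n + q * (real \<kappa> * (real \<kappa> - 1) / 2) - t"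
    have "(\<Sum>i\<le>n. if i + \<kappa> \<le> n then c i (i + \<kappa>) else 0) = (\<Sum>i<n + 1 - \<kappa>. c i (i + \<kappa>))"
      by (rule sum.mono_neutral_cong_right) auto
    also have "\<dots> = (\<Sum>i<n + 1 - \<kappa>. corr b g n (- (e + real i * (real \<kappa> * q))))"
    proof (rule sum.cong[OF refl])
      fix i
      show "c i (i + \<kappa>) = corr b g n (- (e + real i * (real \<kappa> * q)))"
        using S_add_diff[of n i \<kappa>] unfolding c_def e_def by (intro arg_cong[of _ _ "corr b g n"]) linarith
    qed
    also have "\<bar>\<dots>\<bar> \<le> (\<integral>y. \<bar>\<Sum>i<n + 1 - \<kappa>. g n (y - (e + real i * (real \<kappa> * q)))\<bar> \<partial>lborel)"
      by (rule sum_corr_le_L1[OF b g n]) simp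
    also have "\<dots> = (\<integral>y. \<bar>\<Sum>i<n + 1 - \<kappa>. g n (y - real i * (real \<kappa> * q))\<bar> \<partial>lborel)"
      using integral_shift[of "\<lambda>y. \<bar>\<Sum>i<n + 1 - \<kappa>. g n (y - real i * (real \<kappa> * q))\<bar>" "- e"]
      by (simp add: algebra_simps)
    finally show ?thesis .
  qed
  have edge: "\<bar>\<Sum>i\<le>n. if i + k - 1 \<le> n then c i (i + k - 1) else 0\<bar> \<le> real (Suc n) * (q * (real n)\<^sup>2 / 2)"
  proof -
    have "\<bar>\<Sum>i\<le>n. if i + k - 1 \<le> n then c i (i + k - 1) else 0\<bar> \<le> (\<Sum>i\<le>n. q * (real n)\<^sup>2 / 2)"
    proof (rule order_trans[OF sum_abs], rule sum_mono)
      fix i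
      show "\<bar>if i + k - 1 \<le> n then c i (i + k - 1) else 0\<bar> \<le> q * (real n)\<^sup>2 / 2"
        using small[of "i + k - 1" i] k q2 by auto
    qed
    then show ?thesis by simp
  qed
  have "corr b g (Suc n) t = (\<Sum>i\<le>n. \<Sum>j\<le>n. c i j)"
    unfolding corr_rec[OF b g n] c_def ..
  also have "\<dots> = (\<Sum>i\<le>n. if i + k \<le> n then c i (i + k) else 0)
      + (\<Sum>i\<le>n. if i + (k + 1) \<le> n then c i (i + (k + 1)) else 0)
      + (\<Sum>i\<le>n. if i + k - 1 \<le> n then c i (i + k - 1) else 0)"
    unfolding row sum.distrib by (simp only: add.assoc)
  finally show ?thesis
    using strip[of k] strip[of "k + 1"] edge by simp
qed

text \<open>For \<open>k * H n \<le> t < (k + 1) * H n\<close> the correlation in tower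
  \<open>n + 1\<close> reduces to sums of strides \<open>k * q\<close> and
  \<open>(k + 1) * q\<close>. Since \<open>t\<close> may be as large as the whole height of tower
  \<open>n + 1\<close>, the result is stated one tower higher, where the points crossing the top of
  tower \<open>n + 1\<close> contribute one more sum of stride \<open>q\<close>.\<close>

theorem corr_tendsto_0:
  assumes b: "tow_seq m b" and g: "tow_seq m g" and eq: "equi q (H m) (H m) (g m)"
    and zero: "integral\<^sup>L lborel (g m) = 0" and "\<epsilon> > 0"
  shows "\<exists>n1. \<forall>n\<ge>n1. \<forall>t. H n \<le> t \<longrightarrow> t \<le> H (Suc n) \<longrightarrow> \<bar>w (n + 2) * corr b g (n + 2) t\<bar> \<le> \<epsilon>"
proof -
  obtain n1 where n1: "n1 \<ge> m" "\<And>n k L. n1 \<le> n \<Longrightarrow> 1 \<le> k \<Longrightarrow> k \<le> n + 1 \<Longrightarrow> L \<le> n + 1 \<Longrightarrow>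
      w n * (\<integral>y. \<bar>\<Sum>i<L. g n (y - real i * (real k * q))\<bar> \<partial>lborel) \<le> \<epsilon> / 8 * real n"
    using strided_L1[OF g eq zero, of "\<epsilon> / 8"] \<open>\<epsilon> > 0\<close> by (metis zero_less_divide_iff zero_less_numeral)
  obtain n2 where n2: "\<And>n. n \<ge> n2 \<Longrightarrow> q * (real n + 1)\<^sup>2 \<le> H n"
    using H_dominates_square[of 1] unfolding eventually_sequentially by auto
  obtain n3 where n3: "\<And>n. n \<ge> n3 \<Longrightarrow> q * (real n + 1)\<^sup>2 \<le> \<epsilon> / (4 * W) * H n"
    using H_dominates_square[of "\<epsilon> / (4 * W)"] W_pos \<open>\<epsilon> > 0\<close> unfolding eventually_sequentially by auto
  obtain M0 where M0: "\<And>M n y. M0 \<le> M \<Longrightarrow> n \<ge> m \<Longrightarrow>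
      \<bar>\<Sum>j<M. g n (y + real j * q)\<bar> \<le> (\<epsilon> / (4 * W)) * real M"
    using sup_bound[OF g eq zero, of "\<epsilon> / (4 * W)"] W_pos \<open>\<epsilon> > 0\<close> by auto
  show ?thesis
  proof (intro exI[of _ "n1 + n2 + n3 + M0 + 1"] allI impI)
    fix n t assume n: "n1 + n2 + n3 + M0 + 1 \<le> n" and t: "H n \<le> t" "t \<le> H (Suc n)"
    have nm: "n \<ge> m" "n1 \<le> n" "n \<ge> 1" using n n1(1) by auto
    have Hn: "q * (real n + 1)\<^sup>2 \<le> H n" using n2[of n] n by simp
    have Hn': "q * (real n)\<^sup>2 \<le> H n"
      using q_pos Hn by (elim order_trans[rotated]) (intro mult_left_mono power_mono, auto)
    define k where "k = nat \<lfloor>t / H n\<rfloor>"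
    define \<tau> where "\<tau> = t - real k * H n"
    have kt: "real k \<le> t / H n" "t / H n < real k + 1"
    proof -
      have "0 \<le> t / H n" using t H_pos[of n] by simp
      then show "real k \<le> t / H n" "t / H n < real k + 1" unfolding k_def by linarith+
    qed
    have \<tau>: "0 \<le> \<tau>" "\<tau> < H n"
      using kt H_pos[of n] unfolding \<tau>_def by (auto simp: field_simps)
    have "1 \<le> t / H n" using t H_pos[of n] by simp
    then have k1: "k \<ge> 1" using kt by linarith
    \<comment> \<open>Spacers let \<open>t\<close> exceed \<open>(n + 1) * H n\<close>, but by less
      than one tower height.\<close>
    have k2: "k \<le> n + 1"
    proof -
      have "q * (real (Suc n) * real n / 2) \<le> q * ((real n + 1)\<^sup>2 / 2)"
        using q_pos by (intro mult_left_mono) (auto simp: power2_eq_square algebra_simps)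
      also have "\<dots> < H n" using Hn H_pos[of n] by simp
      finally have "H (Suc n) < real (n + 2) * H n" unfolding H_Suc by (simp add: algebra_simps)
      then have "t / H n < real (n + 2)" using t H_pos[of n] by (simp add: pos_divide_less_eq)
      then show ?thesis using kt by linarith
    qed
    have 1: "\<bar>w (Suc n) * corr b g (Suc n) t\<bar> \<le> \<epsilon> / 2"
    proof -
      let ?A = "\<integral>y. \<bar>\<Sum>i<n + 1 - k. g n (y - real i * (real k * q))\<bar> \<partial>lborel"
      let ?B = "\<integral>y. \<bar>\<Sum>i<n - k. g n (y - real i * (real (k + 1) * q))\<bar> \<partial>lborel"
      have A: "w n * ?A \<le> \<epsilon> / 8 * real n"
        using k1 k2 by (intro n1(2) nm) auto
      have B: "w n * ?B \<le> \<epsilon> / 8 * real n"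
      proof (cases "k \<le> n")
        case True
        then show ?thesis by (intro n1(2) nm) auto
      next
        case False
        \<comment> \<open>For \<open>k > n\<close> the sum over \<open>i < n - k\<close> is
          empty.\<close>
        then show ?thesis using \<open>\<epsilon> > 0\<close> by simp
      qed
      have "real (Suc n) * \<bar>w (Suc n) * corr b g (Suc n) t\<bar> = w n * \<bar>corr b g (Suc n) t\<bar>"
        using w_mult_Suc[of n] w_pos[of "Suc n"] by (simp add: abs_mult mult.commute mult.left_commute)
      also have "\<dots> \<le> w n * (?A + ?B + real (Suc n) * (q * (real n)\<^sup>2 / 2))"
        using w_pos[of n] by (intro mult_left_mono corr_block[OF b g nm(1) k1 _ \<tau> Hn']) (auto simp: \<tau>_def)
      also have "\<dots> = w n * ?A + w n * ?B + real (Suc n) * (w n * (q * (real n)\<^sup>2 / 2))"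
        by (simp add: algebra_simps)
      also have "\<dots> \<le> \<epsilon> / 8 * real (Suc n) + \<epsilon> / 8 * real (Suc n) + real (Suc n) * (\<epsilon> / 4)"
      proof (intro add_mono mult_left_mono)
        show "w n * ?A \<le> \<epsilon> / 8 * real (Suc n)" "w n * ?B \<le> \<epsilon> / 8 * real (Suc n)"
          using A B \<open>\<epsilon> > 0\<close> by (auto elim!: order_trans)
        have "(real n)\<^sup>2 / 2 \<le> (real n + 1)\<^sup>2"
          using power_mono[of "real n" "real n + 1" 2] zero_le_power2[of "real n"] by linarith
        then have "q * ((real n)\<^sup>2 / 2) \<le> q * (real n + 1)\<^sup>2"
          using q_pos by (intro mult_left_mono) auto
        then have "w n * (q * (real n)\<^sup>2 / 2) \<le> w n * (q * (real n + 1)\<^sup>2)"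
          using w_pos[of n] by (intro mult_left_mono) auto
        also have "\<dots> \<le> w n * (\<epsilon> / (4 * W) * H n)"
          using n3[of n] n w_pos[of n] by (intro mult_left_mono) auto
        also have "\<dots> = \<epsilon> / (4 * W) * (w n * H n)" by (simp only: ac_simps)
        also have "\<dots> \<le> \<epsilon> / (4 * W) * W" using W_pos \<open>\<epsilon> > 0\<close> wH by (intro mult_left_mono) auto
        finally show "w n * (q * (real n)\<^sup>2 / 2) \<le> \<epsilon> / 4" using W_pos by simp
      qed simp
      also have "\<dots> = real (Suc n) * (\<epsilon> / 2)" by (simp add: algebra_simps)
      finally show ?thesis by (simp only: mult_le_cancel_left_pos of_nat_0_less_iff zero_less_Suc)
    qed
    have 2: "\<bar>w (n + 2) * (\<Sum>i<Suc n. corr b g (Suc n) (t - H (Suc n) - real i * q))\<bar> \<le> \<epsilon> / 4"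
    proof -
      have "\<bar>\<Sum>i<Suc n. corr b g (Suc n) (t - H (Suc n) - real i * q)\<bar> \<le> \<epsilon> / (4 * W) * real (Suc n) * H (Suc n)"
        using n nm by (intro staircase_sum_le[OF b g _ M0]) auto
      also have "\<dots> \<le> \<epsilon> / (4 * W) * real (Suc (Suc n)) * H (Suc n)"
        using W_pos \<open>\<epsilon> > 0\<close> H_pos[of "Suc n"] by (intro mult_right_mono mult_left_mono) auto
      finally have "\<bar>w (n + 2) * (\<Sum>i<Suc n. corr b g (Suc n) (t - H (Suc n) - real i * q))\<bar>
          \<le> w (n + 2) * (\<epsilon> / (4 * W) * real (Suc (Suc n)) * H (Suc n))"
        unfolding abs_mult abs_of_pos[OF w_pos] using w_pos[of "n + 2"] by (intro mult_left_mono) auto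
      also have "\<dots> = \<epsilon> / (4 * W) * ((w (Suc (Suc n)) * real (Suc (Suc n))) * H (Suc n))"
        by (simp add: ac_simps)
      also have "\<dots> = \<epsilon> / (4 * W) * (w (Suc n) * H (Suc n))" by (simp only: w_mult_Suc)
      also have "\<dots> \<le> \<epsilon> / (4 * W) * W" using wH W_pos \<open>\<epsilon> > 0\<close> by (intro mult_left_mono) auto
      also have "\<dots> = \<epsilon> / 4" using W_pos by simp
      finally show ?thesis .
    qed
    have "w (n + 2) * corr b g (n + 2) t
       = w (Suc n) * corr b g (Suc n) t
         + w (n + 2) * (\<Sum>i<Suc n. corr b g (Suc n) (t - H (Suc n) - real i * q))"
    proof -
      have "0 \<le> t" using t H_pos[of n] by linarith
      then have "corr b g (Suc (Suc n)) t = real (Suc (Suc n)) * corr b g (Suc n) t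
          + (\<Sum>i<Suc n. corr b g (Suc n) (t - H (Suc n) - real i * q))"
        using t nm by (intro corr_expand[OF b g]) auto
      then show ?thesis
        unfolding w_mult_Suc[of "Suc n", symmetric] add_2_eq_Suc' by (simp only: algebra_simps)
    qed
    then show "\<bar>w (n + 2) * corr b g (n + 2) t\<bar> \<le> \<epsilon>" using 1 2 \<open>\<epsilon> > 0\<close> by linarith
  qed
qed

end

section \<open>The columns of the staircase\<close>

text \<open>Number of spacers over the subcolumns before the \<open>i\<close>-th, in the form in
  which \<open>levels\<close> computes it.\<close>

definition tri :: "nat \<Rightarrow> nat" where "tri i = (i * (i - 1)) div 2"

lemma tri_0 [simp]: "tri 0 = 0" by (simp add: tri_def)

lemma tri_Suc: "tri (Suc i) = tri i + i"
proof -
  have "Suc i * (Suc i - 1) = i * (i - 1) + 2 * i" by (cases i) auto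
  then show ?thesis unfolding tri_def by simp
qed

lemma tri_mono: "i \<le> j \<Longrightarrow> tri i \<le> tri j"
  by (rule lift_Suc_mono_le[of tri]) (auto simp: tri_Suc)

lemma real_tri: "real (tri i) = real i * (real i - 1) / 2"
  by (induction i) (auto simp: tri_Suc field_simps)

lemma tri_decomp: "m < tri N \<Longrightarrow> \<exists>i<N. \<exists>k<i. m = tri i + k"
proof (induction N)
  case (Suc N)
  show ?case
  proof (cases "m < tri N")
    case True
    then show ?thesis using Suc.IH by (meson less_SucI)
  next
    case False
    then have "m = tri N + (m - tri N)" "m - tri N < N" using Suc.prems by (auto simp: tri_Suc)
    then show ?thesis by blast
  qed
qed simp

lemma tri_decomp_unique:
  assumes "tri i + k = tri i' + k'" "k < i" "k' < i'"
  shows "i = i'" "k = k'"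
proof -
  have False if "i < i'" "tri i + k = tri i' + k'" "k < i" for i i' k k'
    using tri_mono[of "Suc i" i'] that by (simp add: tri_Suc)
  from this[of i i' k k'] this[of i' i k' k] assms show "i = i'"
    by (cases i i' rule: linorder_cases) auto
  then show "k = k'" using assms by simp
qed

abbreviation lv :: "nat \<Rightarrow> real list" where "lv \<equiv> levels staircase_r"
abbreviation ht :: "nat \<Rightarrow> nat" where "ht n \<equiv> length (lv n)"
abbreviation wd :: "nat \<Rightarrow> real" where "wd \<equiv> width staircase_r"
abbreviation ea :: real where "ea \<equiv> stair_a staircase_r"

text \<open>The levels of column \<open>n\<close> fill \<open>[0, col_end n)\<close>, and the
  spacers of the next stage are laid out from \<open>col_end n\<close> on.\<close>

definition col_end :: "nat \<Rightarrow> real" where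
  "col_end n = ea + spacer_used staircase_r n"

text \<open>Index in column \<open>n + 1\<close> of the bottom level of subcolumn \<open>i\<close>:
  the subcolumns before it contribute their levels and their spacers.\<close>

definition blk :: "nat \<Rightarrow> nat \<Rightarrow> nat" where
  "blk n i = i * ht n + tri i"

lemma blk_0 [simp]: "blk n 0 = 0" by (simp add: blk_def)

lemma blk_Suc: "blk n (Suc i) = blk n i + ht n + i"
  by (simp add: blk_def tri_Suc)

lemma blk_mono: "i \<le> j \<Longrightarrow> blk n i \<le> blk n j"
  by (rule lift_Suc_mono_le[of "blk n"]) (auto simp: blk_Suc)

lemma concat_blocks:
  assumes "\<And>i. i < m \<Longrightarrow> length (B i) = h + i"
  shows "length (concat (map B [0..<m])) = m * h + tri m \<and>
    (\<forall>i<m. \<forall>j<h + i. concat (map B [0..<m]) ! (i * h + tri i + j) = B i ! j)"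
  using assms
proof (induction m)
  case (Suc m)
  have IH: "length (concat (map B [0..<m])) = m * h + tri m"
    "\<And>i j. i < m \<Longrightarrow> j < h + i \<Longrightarrow> concat (map B [0..<m]) ! (i * h + tri i + j) = B i ! j"
    using Suc by auto
  have len: "length (concat (map B [0..<Suc m])) = Suc m * h + tri (Suc m)"
    using IH(1) Suc.prems[of m] by (simp add: tri_Suc)
  have "concat (map B [0..<Suc m]) ! (i * h + tri i + j) = B i ! j" if "i < Suc m" "j < h + i" for i j
  proof (cases "i = m")
    case True
    have e: "i * h + tri i + j = length (concat (map B [0..<m])) + j" using IH(1) True by simp
    show ?thesis unfolding e using True by (simp add: nth_append_length_plus)
  next
    case False
    then have "i < m" using that by simp
    have "i * h + tri i + j < Suc i * h + tri (Suc i)" using that by (simp add: tri_Suc)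
    also have "\<dots> \<le> m * h + tri m"
      using \<open>i < m\<close> by (intro add_mono mult_right_mono tri_mono) auto
    finally show ?thesis using IH(2)[OF \<open>i < m\<close> that(2)] by (simp add: nth_append IH(1))
  qed
  with len show ?case by blast
qed simp

lemma levels_Suc:
  "ht (Suc n) = blk n (Suc n)"
  "i \<le> n \<Longrightarrow> j < ht n \<Longrightarrow> lv (Suc n) ! (blk n i + j) = lv n ! j + real i * wd (Suc n)"
  "i \<le> n \<Longrightarrow> k < i \<Longrightarrow> lv (Suc n) ! (blk n i + ht n + k) = col_end n + real (tri i + k) * wd (Suc n)"
proof -
  define B where "B i = map (\<lambda>x. x + real i * wd (Suc n)) (lv n)
                     @ map (\<lambda>k. ea + spacer_used staircase_r n + real (tri i + k) * wd (Suc n)) [0..<i]" for i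
  have eq: "lv (Suc n) = concat (map B [0..<Suc n])"
    by (simp only: levels.simps B_def[abs_def] tri_def staircase_r_def)
  note C = concat_blocks[of "Suc n" B "ht n"]
  have len: "length (B i) = ht n + i" for i by (simp add: B_def)
  show "ht (Suc n) = blk n (Suc n)"
    using C len unfolding eq blk_def by blast
  have nth: "lv (Suc n) ! (blk n i + j) = B i ! j" if "i \<le> n" "j < ht n + i" for i j
    using C len that unfolding eq blk_def by (meson less_Suc_eq_le)
  show "i \<le> n \<Longrightarrow> j < ht n \<Longrightarrow> lv (Suc n) ! (blk n i + j) = lv n ! j + real i * wd (Suc n)"
    using nth[of i j] by (simp add: B_def nth_append)
  show "i \<le> n \<Longrightarrow> k < i \<Longrightarrow> lv (Suc n) ! (blk n i + ht n + k) = col_end n + real (tri i + k) * wd (Suc n)"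
    using nth[of i "ht n + k"] by (simp add: B_def nth_append col_end_def add.assoc)
qed

declare levels.simps(2) [simp del]

lemma blk_index:
  assumes "idx < ht (Suc n)"
  shows "\<exists>i\<le>n. (\<exists>j<ht n. idx = blk n i + j) \<or> (\<exists>k<i. idx = blk n i + ht n + k)"
proof -
  have "idx < blk n m \<Longrightarrow> \<exists>i<m. (\<exists>j<ht n. idx = blk n i + j) \<or> (\<exists>k<i. idx = blk n i + ht n + k)" for m
  proof (induction m)
    case (Suc m)
    consider "idx < blk n m" | "blk n m \<le> idx" "idx < blk n m + ht n" | "blk n m + ht n \<le> idx" by linarith
    then show ?case
    proof cases
      case 1
      then show ?thesis using Suc.IH by (meson less_SucI)
    next
      case 2
      then show ?thesis by (intro exI[of _ m] conjI disjI1 exI[of _ "idx - blk n m"]) auto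
    next
      case 3
      then show ?thesis using Suc.prems
        by (intro exI[of _ m] conjI disjI2 exI[of _ "idx - blk n m - ht n"]) (auto simp: blk_Suc)
    qed
  qed simp
  from this[of "Suc n"] show ?thesis using assms levels_Suc(1) by (simp add: less_Suc_eq_le)
qed

section \<open>Lengths of the levels and total length one\<close>

lemma uwidth_eq: "uwidth staircase_r n = 1 / fact n"
proof (induction n)
  case (Suc n)
  have "uwidth staircase_r (Suc n) = (1 / fact n) / real (Suc n)"
    by (simp only: uwidth.simps Suc staircase_r_def)
  then show ?case by (simp add: mult.commute)
qed simp

lemma tri_over_fact: "real (tri (Suc n)) / fact (Suc n) = real n / (2 * fact n)"
proof -
  have "real (tri (Suc n)) = real (Suc n) * (real n / 2)" by (simp add: real_tri)
  moreover have "fact (Suc n) = real (Suc n) * fact n" by simp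
  ultimately have "real (tri (Suc n)) / fact (Suc n) = (real (Suc n) * (real n / 2)) / (real (Suc n) * fact n)"
    by (simp only:)
  also have "\<dots> = (real n / 2) / fact n" by (rule mult_divide_mult_cancel_left) simp
  finally show ?thesis by simp
qed

lemma uwidth_tri:
  "uwidth staircase_r (Suc n) * real ((staircase_r (Suc n) * (staircase_r (Suc n) - 1)) div 2)
    = real n / (2 * fact n)"
proof -
  have "uwidth staircase_r (Suc n) * real (tri (Suc n)) = real n / (2 * fact n)"
    unfolding uwidth_eq using tri_over_fact[of n] by simp
  then show ?thesis unfolding tri_def staircase_r_def .
qed

lemma summable_spacers: "summable (\<lambda>n. real n / (2 * fact n))"
proof (subst summable_Suc_iff[symmetric])
  have eq: "real (Suc n) / (2 * fact (Suc n)) = (1/2) * (inverse (fact n) * 1 ^ n)" for n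
  proof -
    have "real (Suc n) / (2 * fact (Suc n)) = (real (Suc n) * 1) / (real (Suc n) * (2 * fact n))" by simp
    also have "\<dots> = 1 / (2 * fact n)" by (rule mult_divide_mult_cancel_left) simp
    finally show ?thesis by (simp add: inverse_eq_divide)
  qed
  show "summable (\<lambda>n. real (Suc n) / (2 * fact (Suc n)))"
    unfolding eq by (rule summable_mult[OF summable_exp])
qed

lemma stair_a_eq: "ea = 1 / (1 + (\<Sum>n. real n / (2 * fact n)))"
  unfolding stair_a_def uwidth_tri ..

lemma spacers_nonneg: "0 \<le> (\<Sum>n. real n / (2 * fact n))"
  by (rule suminf_nonneg[OF summable_spacers]) simp

lemma ea_pos: "0 < ea" unfolding stair_a_eq using spacers_nonneg by simp

lemma wd_eq: "wd n = ea / fact n"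
  by (simp add: width_def uwidth_eq)

lemma wd_pos: "0 < wd n" using ea_pos by (simp add: wd_eq)

lemma wd_0: "wd 0 = ea" by (simp add: wd_eq)

lemma wd_Suc: "wd (Suc n) = wd n / real (Suc n)"
  by (simp add: wd_eq)

lemma wd_mult_Suc: "real (Suc n) * wd (Suc n) = wd n"
  by (simp add: wd_Suc)

lemma col_end_0: "col_end 0 = ea" by (simp add: col_end_def spacer_used_def)

lemma col_end_Suc: "col_end (Suc n) = col_end n + real (tri (Suc n)) * wd (Suc n)"
  unfolding col_end_def spacer_used_def by (simp add: tri_def staircase_r_def)

lemma col_end_mono: "m \<le> n \<Longrightarrow> col_end m \<le> col_end n"
  by (rule lift_Suc_mono_le[of col_end]) (auto simp: col_end_Suc less_imp_le[OF wd_pos])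

lemma ea_le_col_end: "ea \<le> col_end n" using col_end_mono[of 0 n] by (simp add: col_end_0)

lemma col_end_eq: "col_end n = ea * (1 + (\<Sum>k<n. real k / (2 * fact k)))"
proof (induction n)
  case (Suc n)
  have "real (tri (Suc n)) * wd (Suc n) = ea * (real n / (2 * fact n))"
    unfolding wd_eq tri_over_fact[symmetric] by simp
  then show ?case by (simp add: col_end_Suc Suc algebra_simps)
qed (simp add: col_end_0)

text \<open>This is the normalization behind \<open>stair_a\<close>: the initial interval and all
  spacers together have length 1.\<close>

lemma col_end_tendsto: "col_end \<longlonglongrightarrow> 1"
proof -
  have "(\<lambda>n. ea * (1 + (\<Sum>k<n. real k / (2 * fact k)))) \<longlonglongrightarrow> ea * (1 + (\<Sum>n. real n / (2 * fact n)))"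
    by (intro tendsto_intros summable_LIMSEQ summable_spacers)
  moreover have "ea * (1 + (\<Sum>n. real n / (2 * fact n))) = 1"
    unfolding stair_a_eq using spacers_nonneg by simp
  ultimately show ?thesis by (simp add: col_end_eq[abs_def])
qed

lemma col_end_le_1: "col_end n \<le> 1"
  using col_end_mono by (intro incseq_le[OF _ col_end_tendsto]) (auto simp: incseq_def)

lemma ex_col_end: "x < 1 \<Longrightarrow> \<exists>n\<ge>m. x < col_end n"
proof -
  assume "x < 1"
  then obtain N where "\<And>n. n \<ge> N \<Longrightarrow> x < col_end n"
    using order_tendstoD(1)[OF col_end_tendsto, of x] unfolding eventually_sequentially by blast
  then show ?thesis by (intro exI[of _ "max m N"]) auto
qed

text \<open>In contrast to \<open>in_level\<close> the top level is included, so that the levels of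
  one column partition \<open>[0, col_end n)\<close>.\<close>

definition in_lv :: "nat \<Rightarrow> nat \<Rightarrow> real \<Rightarrow> bool" where
  "in_lv n j x \<longleftrightarrow> j < ht n \<and> lv n ! j \<le> x \<and> x < lv n ! j + wd n"

section \<open>Each column partitions an initial interval\<close>

lemma ex_subinterval:
  fixes y d :: real
  assumes "d > 0" "0 \<le> y" "y < real N * d"
  obtains i where "i < N" "real i * d \<le> y" "y < real i * d + d"
proof -
  define i where "i = nat \<lfloor>y / d\<rfloor>"
  have "0 \<le> y / d" using assms by simp
  then have "real i \<le> y / d" "y / d < real i + 1" unfolding i_def by linarith+
  then have i: "real i * d \<le> y" "y < real i * d + d" using assms(1) by (auto simp: field_simps)
  then have "real i * d < real N * d" using assms by linarith
  then have "i < N" using assms(1) by simp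
  with i that show ?thesis by blast
qed

lemma subinterval_unique:
  fixes y d :: real
  assumes "d > 0" "real i * d \<le> y" "y < real i * d + d" "real j * d \<le> y" "y < real j * d + d"
  shows "i = j"
proof -
  have "real i * d < (real j + 1) * d" "real j * d < (real i + 1) * d"
    using assms by (auto simp: algebra_simps)
  then have "real i < real j + 1" "real j < real i + 1" using assms(1) by auto
  then show ?thesis by linarith
qed

lemma subcolumn_bounds:
  assumes "i \<le> n"
  shows "0 \<le> real i * wd (Suc n)" "real i * wd (Suc n) + wd (Suc n) \<le> wd n"
proof -
  have "real i * wd (Suc n) + wd (Suc n) = real (Suc i) * wd (Suc n)" by (simp add: algebra_simps)
  also have "\<dots> \<le> real (Suc n) * wd (Suc n)" using assms wd_pos[of "Suc n"] by (intro mult_right_mono) auto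
  finally show "real i * wd (Suc n) + wd (Suc n) \<le> wd n" unfolding wd_mult_Suc .
qed (use wd_pos[of "Suc n"] in simp)

lemma blk_less_ht:
  assumes "i \<le> n" "j < ht n + i"
  shows "blk n i + j < ht (Suc n)"
proof -
  have "blk n i + j < blk n (Suc i)" using assms by (simp add: blk_Suc)
  also have "\<dots> \<le> ht (Suc n)" unfolding levels_Suc(1) using assms by (intro blk_mono) auto
  finally show ?thesis .
qed

lemma in_lv_Suc_old:
  assumes "i \<le> n" "j < ht n"
  shows "in_lv (Suc n) (blk n i + j) x \<longleftrightarrow>
     lv n ! j + real i * wd (Suc n) \<le> x \<and> x < lv n ! j + real i * wd (Suc n) + wd (Suc n)"
  using blk_less_ht[of i n j] assms unfolding in_lv_def by (simp add: levels_Suc(2)[OF assms])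

lemma in_lv_Suc_new:
  assumes "i \<le> n" "k < i"
  shows "in_lv (Suc n) (blk n i + ht n + k) x \<longleftrightarrow>
     col_end n + real (tri i + k) * wd (Suc n) \<le> x \<and> x < col_end n + real (tri i + k) * wd (Suc n) + wd (Suc n)"
  using blk_less_ht[of i n "ht n + k"] assms unfolding in_lv_def
  by (simp add: levels_Suc(3)[OF assms] add.assoc[symmetric])

lemma in_lv_old_imp:
  assumes "i \<le> n" "j < ht n" "in_lv (Suc n) (blk n i + j) x"
  shows "in_lv n j x"
proof -
  note subcolumn_bounds[OF assms(1)]
  moreover have "lv n ! j + real i * wd (Suc n) \<le> x" "x < lv n ! j + real i * wd (Suc n) + wd (Suc n)"
    using assms(3) unfolding in_lv_Suc_old[OF assms(1,2)] by auto
  ultimately show ?thesis unfolding in_lv_def using assms(2) by (intro conjI; linarith)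
qed

lemma in_lv_split:
  assumes "in_lv n j x"
  obtains i where "i \<le> n" "in_lv (Suc n) (blk n i + j) x"
proof -
  have j: "j < ht n" "0 \<le> x - lv n ! j" "x - lv n ! j < real (Suc n) * wd (Suc n)"
    using assms unfolding in_lv_def wd_mult_Suc by auto
  obtain i where "i < Suc n" "real i * wd (Suc n) \<le> x - lv n ! j" "x - lv n ! j < real i * wd (Suc n) + wd (Suc n)"
    using ex_subinterval[OF wd_pos j(2,3)] .
  then show ?thesis using that[of i] j(1) by (simp add: in_lv_Suc_old)
qed

lemma new_spacer_bounds:
  assumes "i \<le> n" "k < i" "in_lv (Suc n) (blk n i + ht n + k) x"
  shows "col_end n \<le> x" "x < col_end (Suc n)"
proof -
  have 1: "col_end n + real (tri i + k) * wd (Suc n) \<le> x" "x < col_end n + real (tri i + k) * wd (Suc n) + wd (Suc n)"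
    using assms in_lv_Suc_new by auto
  then show "col_end n \<le> x" using wd_pos[of "Suc n"] by (smt (verit) mult_nonneg_nonneg of_nat_0_le_iff)
  have "tri i + k + 1 \<le> tri (Suc i)" using assms by (simp add: tri_Suc)
  also have "\<dots> \<le> tri (Suc n)" using assms by (intro tri_mono) auto
  finally have "real (tri i + k + 1) * wd (Suc n) \<le> real (tri (Suc n)) * wd (Suc n)"
    using wd_pos[of "Suc n"] by (intro mult_right_mono) auto
  then show "x < col_end (Suc n)" using 1(2) by (simp add: col_end_Suc algebra_simps)
qed

lemma in_lv_range: "in_lv n j x \<Longrightarrow> 0 \<le> x \<and> x < col_end n"
proof (induction n arbitrary: j)
  case 0
  then show ?case by (auto simp: in_lv_def wd_0 col_end_0)
next
  case (Suc n)
  then have "j < ht (Suc n)" by (simp add: in_lv_def)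
  then obtain i where i: "i \<le> n" "(\<exists>j'<ht n. j = blk n i + j') \<or> (\<exists>k<i. j = blk n i + ht n + k)"
    using blk_index by blast
  then show ?case
  proof (elim disjE exE conjE)
    fix j' assume "j' < ht n" "j = blk n i + j'"
    then have "in_lv n j' x" using in_lv_old_imp i Suc.prems by blast
    then show ?thesis using Suc.IH col_end_mono[of n "Suc n"] by fastforce
  next
    fix k assume "k < i" "j = blk n i + ht n + k"
    then show ?thesis using new_spacer_bounds[of i n k x] i Suc.prems ea_le_col_end[of n] ea_pos by auto
  qed
qed

lemma in_lv_ex: "0 \<le> x \<Longrightarrow> x < col_end n \<Longrightarrow> \<exists>j. in_lv n j x"
proof (induction n)
  case 0
  then show ?case by (auto simp: in_lv_def wd_0 col_end_0)
next
  case (Suc n)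
  show ?case
  proof (cases "x < col_end n")
    case True
    then obtain j where "in_lv n j x" using Suc by blast
    then obtain i where "in_lv (Suc n) (blk n i + j) x" by (rule in_lv_split)
    then show ?thesis ..
  next
    case False
    then have "0 \<le> x - col_end n" "x - col_end n < real (tri (Suc n)) * wd (Suc n)"
      using Suc.prems by (auto simp: col_end_Suc)
    then obtain m where m: "m < tri (Suc n)" "real m * wd (Suc n) \<le> x - col_end n"
      "x - col_end n < real m * wd (Suc n) + wd (Suc n)"
      using ex_subinterval[OF wd_pos] by blast
    obtain i k where ik: "i < Suc n" "k < i" "m = tri i + k" using tri_decomp[OF m(1)] by blast
    then have "in_lv (Suc n) (blk n i + ht n + k) x"
      using m in_lv_Suc_new[of i n k x] by simp
    then show ?thesis by blast
  qed
qed

text \<open>Old levels lie to the left of \<open>col_end n\<close> and new spacers to its right.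
  Among pieces of one old level the position determines the subcolumn; among new spacers it
  determines the running number, hence subcolumn and place by
  \<open>tri_decomp_unique\<close>.\<close>

lemma in_lv_unique: "in_lv n j x \<Longrightarrow> in_lv n j' x \<Longrightarrow> j = j'"
proof (induction n arbitrary: j j')
  case 0
  then show ?case by (simp add: in_lv_def)
next
  case (Suc n)
  have "j < ht (Suc n)" "j' < ht (Suc n)" using Suc.prems by (auto simp: in_lv_def)
  then obtain i i' where i: "i \<le> n" "(\<exists>l<ht n. j = blk n i + l) \<or> (\<exists>k<i. j = blk n i + ht n + k)"
    and i': "i' \<le> n" "(\<exists>l<ht n. j' = blk n i' + l) \<or> (\<exists>k<i'. j' = blk n i' + ht n + k)"
    using blk_index[of j n] blk_index[of j' n] by blast
  have old: "x < col_end n" if "l < ht n" "in_lv (Suc n) (blk n i + l) x" "i \<le> n" for i l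
    using in_lv_range[OF in_lv_old_imp[OF that(3,1,2)]] by simp
  from i(2) i'(2) show ?case
  proof (elim disjE exE conjE)
    fix l l' assume l: "l < ht n" "j = blk n i + l" "l' < ht n" "j' = blk n i' + l'"
    have "in_lv n l x" "in_lv n l' x"
      using in_lv_old_imp[of i n l x] in_lv_old_imp[of i' n l' x] l Suc.prems i i' by auto
    then have "l = l'" by (rule Suc.IH)
    have "i = i'"
      using Suc.prems l in_lv_Suc_old[OF i(1) l(1), of x] in_lv_Suc_old[OF i'(1) l(3), of x] \<open>l = l'\<close>
      by (intro subinterval_unique[OF wd_pos[of "Suc n"], of _ "x - lv n ! l"]) auto
    then show ?thesis using l \<open>l = l'\<close> by simp
  next
    fix l k assume "l < ht n" "j = blk n i + l" "k < i'" "j' = blk n i' + ht n + k"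
    then show ?thesis using old[of l i] new_spacer_bounds(1)[of i' n k x] Suc.prems i i' by simp
  next
    fix l k assume "l < ht n" "j' = blk n i' + l" "k < i" "j = blk n i + ht n + k"
    then show ?thesis using old[of l i'] new_spacer_bounds(1)[of i n k x] Suc.prems i i' by simp
  next
    fix k k' assume k: "k < i" "j = blk n i + ht n + k" "k' < i'" "j' = blk n i' + ht n + k'"
    have "tri i + k = tri i' + k'"
      using Suc.prems k in_lv_Suc_new[OF i(1) k(1), of x] in_lv_Suc_new[OF i'(1) k(3), of x]
      by (intro subinterval_unique[OF wd_pos[of "Suc n"], of _ "x - col_end n"]) auto
    then show ?thesis using tri_decomp_unique[of i k i' k'] k by simp
  qed
qed

lemma ht_pos: "0 < ht n"
  by (induction n) (auto simp: levels_Suc(1) blk_Suc)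

lemma lv_0: "lv n ! 0 = 0"
proof (induction n)
  case (Suc n)
  then show ?case using levels_Suc(2)[of 0 n 0] ht_pos[of n] by simp
qed simp

section \<open>The staircase map on levels\<close>

lemma in_level_iff: "in_level staircase_r n j x \<longleftrightarrow> in_lv n j x \<and> Suc j < ht n"
  unfolding in_level_def in_lv_def by auto

text \<open>Cutting keeps neighbours together: above a piece of a non-top level sits the matching
  piece of the level above, at the same displacement.\<close>

lemma in_lv_up:
  assumes "in_lv n j x" "Suc j < ht n"
  shows "\<exists>j'. in_lv (Suc n) j' x \<and> Suc j' < ht (Suc n) \<and>
    lv (Suc n) ! Suc j' - lv (Suc n) ! j' = lv n ! Suc j - lv n ! j"
proof -
  obtain i where i: "i \<le> n" "in_lv (Suc n) (blk n i + j) x" using in_lv_split[OF assms(1)] .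
  have "Suc (blk n i + j) < ht (Suc n)" using blk_less_ht[OF i(1), of "Suc j"] assms by simp
  moreover have "lv (Suc n) ! Suc (blk n i + j) - lv (Suc n) ! (blk n i + j) = lv n ! Suc j - lv n ! j"
    using levels_Suc(2)[OF i(1), of "Suc j"] levels_Suc(2)[OF i(1), of j] assms by simp
  ultimately show ?thesis using i by blast
qed

lemma in_lv_up_le:
  assumes "in_lv n j x" "Suc j < ht n" "n \<le> m"
  shows "\<exists>j'. in_lv m j' x \<and> Suc j' < ht m \<and> lv m ! Suc j' - lv m ! j' = lv n ! Suc j - lv n ! j"
  using assms(3)
proof (induction m rule: dec_induct)
  case base
  then show ?case using assms by blast
next
  case (step m)
  then obtain j' where "in_lv m j' x" "Suc j' < ht m" "lv m ! Suc j' - lv m ! j' = lv n ! Suc j - lv n ! j"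
    by blast
  then show ?case using in_lv_up[of m j' x] by auto
qed

text \<open>\<open>cs_map\<close> picks some column and level containing the point. The choice does
  not matter: two candidates can be compared in the later of the two columns, where the level is
  unique and the displacement is preserved.\<close>

lemma staircase_eq:
  assumes "in_lv n j x" "Suc j < ht n"
  shows "staircase x = x - lv n ! j + lv n ! Suc j"
proof -
  define nj where "nj = (SOME nj. in_level staircase_r (fst nj) (snd nj) x)"
  obtain n' j' where nj': "nj = (n', j')" by (cases nj)
  have ex: "\<exists>nj. in_level staircase_r (fst nj) (snd nj) x"
    using assms by (intro exI[of _ "(n, j)"]) (simp add: in_level_iff)
  have "in_level staircase_r (fst nj) (snd nj) x"
    unfolding nj_def using ex by (rule someI_ex)
  then have *: "in_lv n' j' x" "Suc j' < ht n'" unfolding nj' by (auto simp: in_level_iff)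
  have "staircase x = x - lv n' ! j' + lv n' ! Suc j'"
    using ex unfolding staircase_def cs_map_def nj_def[symmetric] nj' by auto
  moreover have "lv n' ! Suc j' - lv n' ! j' = lv n ! Suc j - lv n ! j"
  proof -
    obtain k where k: "in_lv (max n n') k x" "lv (max n n') ! Suc k - lv (max n n') ! k = lv n ! Suc j - lv n ! j"
      using in_lv_up_le[OF assms, of "max n n'"] by auto
    obtain k' where k': "in_lv (max n n') k' x" "lv (max n n') ! Suc k' - lv (max n n') ! k' = lv n' ! Suc j' - lv n' ! j'"
      using in_lv_up_le[OF *, of "max n n'"] by auto
    show ?thesis using in_lv_unique[OF k(1) k'(1)] k(2) k'(2) by simp
  qed
  ultimately show ?thesis by simp
qed

lemma staircase_orbit:
  assumes "0 \<le> u" "u < wd n" "j < ht n"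
  shows "(staircase ^^ j) u = u + lv n ! j"
  using assms(3)
proof (induction j)
  case 0
  then show ?case by (simp add: lv_0)
next
  case (Suc j)
  then have "in_lv n j (u + lv n ! j)" using assms by (simp add: in_lv_def)
  from staircase_eq[OF this Suc.prems] show ?case using Suc by simp
qed

text \<open>No level straddles \<open>ea\<close>, the jump of the roof function, so the roof is
  constant on every level.\<close>

lemma lv_ea: "j < ht n \<Longrightarrow> lv n ! j + wd n \<le> ea \<or> ea \<le> lv n ! j"
proof (induction n arbitrary: j)
  case 0
  then show ?case by (simp add: wd_0)
next
  case (Suc n)
  obtain i where i: "i \<le> n" "(\<exists>l<ht n. j = blk n i + l) \<or> (\<exists>k<i. j = blk n i + ht n + k)"
    using blk_index[OF Suc.prems] by blast
  then show ?case
  proof (elim disjE exE conjE)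
    fix l assume l: "l < ht n" "j = blk n i + l"
    note subcolumn_bounds[OF i(1)]
    then show ?thesis using Suc.IH[OF l(1)] unfolding l(2) levels_Suc(2)[OF i(1) l(1)]
      by (elim disjE, intro disjI1, linarith, intro disjI2, linarith)
  next
    fix k assume k: "k < i" "j = blk n i + ht n + k"
    have "0 \<le> real (tri i + k) * wd (Suc n)" using wd_pos[of "Suc n"] by simp
    then show ?thesis using ea_le_col_end[of n] unfolding k(2) levels_Suc(3)[OF i(1) k(1)]
      by (intro disjI2) linarith
  qed
qed

lemma wd_ht: "wd n * real (ht n) = col_end n"
proof (induction n)
  case (Suc n)
  have "wd (Suc n) * real (ht (Suc n)) = (real (Suc n) * wd (Suc n)) * real (ht n) + real (tri (Suc n)) * wd (Suc n)"
    unfolding levels_Suc(1) blk_def by (simp add: algebra_simps)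
  then show ?case unfolding wd_mult_Suc Suc col_end_Suc .
qed (simp add: wd_0 col_end_0)

section \<open>The suspension flow in tower coordinates\<close>

lemma birkhoff_sum_Suc: "birkhoff_sum T f (Suc n) x = birkhoff_sum T f n x + f ((T ^^ n) x)"
  by (simp add: birkhoff_sum_def)

lemma birkhoff_sum_0 [simp]: "birkhoff_sum T f 0 x = 0"
  by (simp add: birkhoff_sum_def)

lemma birkhoff_sum_add:
  "birkhoff_sum T f (m + n) x = birkhoff_sum T f m x + birkhoff_sum T f n ((T ^^ m) x)"
proof (induction n)
  case (Suc n)
  have "(T ^^ (m + n)) x = (T ^^ n) ((T ^^ m) x)"
    by (metis add.commute comp_apply funpow_add)
  then show ?case using Suc by (simp add: birkhoff_sum_Suc)
qed simp

text \<open>The positive lower bound makes the Birkhoff sums increasing and unbounded, so that for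
  nonnegative \<open>y + t\<close> the number of returns selected by \<open>LEAST\<close> in
  \<open>susp_flow\<close> exists.\<close>

locale pos_roof =
  fixes T f :: "real \<Rightarrow> real" and c :: real
  assumes c_pos: "c > 0" and f_ge: "\<And>x. c \<le> f x"
begin

lemma f_pos: "0 < f x" using c_pos f_ge[of x] by linarith

lemma bs_mono: "m \<le> n \<Longrightarrow> birkhoff_sum T f m x \<le> birkhoff_sum T f n x"
  by (rule lift_Suc_mono_le[of "\<lambda>m. birkhoff_sum T f m x"]) (auto simp: birkhoff_sum_Suc less_imp_le[OF f_pos])

lemma susp_flow_eq:
  assumes "birkhoff_sum T f k x \<le> y + t" "y + t < birkhoff_sum T f (Suc k) x"
  shows "susp_flow T f t (x, y) = ((T ^^ k) x, y + t - birkhoff_sum T f k x)"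
proof -
  have "(LEAST k. y + t < birkhoff_sum T f (Suc k) x) = k"
  proof (rule Least_equality)
    show "y + t < birkhoff_sum T f (Suc k) x" by (rule assms(2))
  next
    fix j assume "y + t < birkhoff_sum T f (Suc j) x"
    then show "k \<le> j" using bs_mono[of "Suc j" k x] assms(1) by (cases "k \<le> j") auto
  qed
  then show ?thesis by (simp add: susp_flow_def)
qed

lemma bs_ge: "real n * c \<le> birkhoff_sum T f n x"
proof (induction n)
  case (Suc n)
  then show ?case using f_ge[of "(T ^^ n) x"] by (simp add: birkhoff_sum_Suc algebra_simps)
qed simp

lemma bs_ex:
  assumes "0 \<le> s"
  obtains k where "birkhoff_sum T f k x \<le> s" "s < birkhoff_sum T f (Suc k) x"
proof -
  obtain n where "s / c < real n" using reals_Archimedean2 by blast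
  then have "s < birkhoff_sum T f n x" using bs_ge[of n x] c_pos by (simp add: pos_divide_less_eq)
  then have ex: "\<exists>n. s < birkhoff_sum T f n x" ..
  define m where "m = (LEAST n. s < birkhoff_sum T f n x)"
  have m: "s < birkhoff_sum T f m x" unfolding m_def using ex by (rule LeastI_ex)
  then obtain k where k: "m = Suc k" using assms by (cases m) auto
  have "\<not> s < birkhoff_sum T f k x" using not_less_Least[of k "\<lambda>n. s < birkhoff_sum T f n x"] k unfolding m_def by auto
  with m k that show ?thesis by (simp add: not_less)
qed

lemma bs_ex_less:
  assumes "0 \<le> s" "s < birkhoff_sum T f n x"
  obtains k where "k < n" "birkhoff_sum T f k x \<le> s" "s < birkhoff_sum T f (Suc k) x"
proof -
  obtain k where k: "birkhoff_sum T f k x \<le> s" "s < birkhoff_sum T f (Suc k) x"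
    using bs_ex[OF assms(1)] .
  then have "k < n" using bs_mono[of n k x] assms(2) by (cases "k < n") auto
  with k that show ?thesis by blast
qed

text \<open>Returns are counted in two batches, and the cocycle identity
  \<open>birkhoff_sum_add\<close> matches the heights.\<close>

lemma susp_flow_add:
  assumes "0 \<le> y" "0 \<le> s" "0 \<le> t"
  shows "susp_flow T f t (susp_flow T f s (x, y)) = susp_flow T f (s + t) (x, y)"
proof -
  have "0 \<le> y + s" using assms by simp
  then obtain k where k: "birkhoff_sum T f k x \<le> y + s" "y + s < birkhoff_sum T f (Suc k) x"
    by (rule bs_ex)
  define x' y' where "x' = (T ^^ k) x" and "y' = y + s - birkhoff_sum T f k x"
  have e1: "susp_flow T f s (x, y) = (x', y')" unfolding x'_def y'_def by (rule susp_flow_eq[OF k])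
  have "0 \<le> y' + t" using k assms by (simp add: y'_def)
  then obtain l where l: "birkhoff_sum T f l x' \<le> y' + t" "y' + t < birkhoff_sum T f (Suc l) x'"
    by (rule bs_ex)
  have "susp_flow T f (s + t) (x, y) = ((T ^^ (k + l)) x, y + (s + t) - birkhoff_sum T f (k + l) x)"
  proof (rule susp_flow_eq)
    show "birkhoff_sum T f (k + l) x \<le> y + (s + t)"
      using l(1) unfolding birkhoff_sum_add x'_def y'_def by simp
    show "y + (s + t) < birkhoff_sum T f (Suc (k + l)) x"
      using l(2) birkhoff_sum_add[of T f k "Suc l" x] unfolding x'_def y'_def by simp
  qed
  moreover have "(T ^^ (k + l)) x = (T ^^ l) x'"
    unfolding x'_def by (metis add.commute comp_apply funpow_add)
  ultimately show ?thesis
    unfolding e1 susp_flow_eq[OF l] by (simp add: birkhoff_sum_add x'_def y'_def)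
qed

end

section \<open>Flow towers over the columns\<close>

locale staircase_flow =
  fixes p q :: real and f :: "real \<Rightarrow> real"
  assumes q_gt_0: "q > 0" and p_gt_q: "p > q"
    and rat_indep: "rationally_independent p q"
    and f_eq: "\<And>x. f x = (if x < stair_a staircase_r then p else q)"
begin

sublocale pos_roof staircase f q
  by unfold_locales (use q_gt_0 p_gt_q in \<open>auto simp: f_eq\<close>)

text \<open>Height of the floor of level \<open>j\<close> in a flow tower. The orbit of 0 suffices
  because 0 is the left endpoint of every bottom level and the roof is constant on levels; for the
  same reason the value does not depend on the column.\<close>

definition \<theta> :: "nat \<Rightarrow> real" where "\<theta> j = birkhoff_sum staircase f j 0"

definition fht :: "nat \<Rightarrow> real" where "fht n = \<theta> (ht n)"

lemma \<theta>_0 [simp]: "\<theta> 0 = 0" by (simp add: \<theta>_def)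

lemma f_level:
  assumes "0 \<le> u" "u < wd n" "j < ht n"
  shows "f (u + lv n ! j) = f (lv n ! j)"
  using lv_ea[OF assms(3)] assms by (auto simp: f_eq)

lemma \<theta>_Suc:
  assumes "j < ht n"
  shows "\<theta> (Suc j) = \<theta> j + f (lv n ! j)"
  using staircase_orbit[of 0 n j] assms wd_pos[of n] by (simp add: \<theta>_def birkhoff_sum_Suc)

lemma bs_\<theta>:
  assumes "0 \<le> u" "u < wd n" "j \<le> ht n"
  shows "birkhoff_sum staircase f j u = \<theta> j"
  using assms(3)
proof (induction j)
  case (Suc j)
  then show ?case
    using \<theta>_Suc[of j n] staircase_orbit[OF assms(1,2), of j] f_level[OF assms(1,2), of j]
    by (simp add: birkhoff_sum_Suc)
qed simp

lemma \<theta>_blk_old: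
  assumes "i \<le> n" "j \<le> ht n"
  shows "\<theta> (blk n i + j) = \<theta> (blk n i) + \<theta> j"
  using assms(2)
proof (induction j)
  case (Suc j)
  have "f (real i * wd (Suc n) + lv n ! j) = f (lv n ! j)"
    using subcolumn_bounds[OF assms(1)] Suc.prems wd_pos[of "Suc n"] by (intro f_level) auto
  then show ?case
    using Suc \<theta>_Suc[OF blk_less_ht[OF assms(1), of j]] \<theta>_Suc[of j n] levels_Suc(2)[OF assms(1), of j]
    by (simp add: add.commute)
qed simp

lemma \<theta>_blk_new:
  assumes "i \<le> n" "k \<le> i"
  shows "\<theta> (blk n i + ht n + k) = \<theta> (blk n i) + fht n + real k * q"
  using assms(2)
proof (induction k)
  case 0
  then show ?case using \<theta>_blk_old[OF assms(1) order_refl] by (simp add: fht_def)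
next
  case (Suc k)
  have "0 \<le> real (tri i + k) * wd (Suc n)" using wd_pos[of "Suc n"] by simp
  then have "f (lv (Suc n) ! (blk n i + ht n + k)) = q"
    using levels_Suc(3)[OF assms(1), of k] Suc.prems ea_le_col_end[of n] by (simp add: f_eq)
  then show ?case
    using Suc \<theta>_Suc[OF blk_less_ht[OF assms(1), of "ht n + k"]] by (simp add: algebra_simps)
qed

lemma \<theta>_blk:
  assumes "i \<le> Suc n"
  shows "\<theta> (blk n i) = real i * fht n + q * (real i * (real i - 1) / 2)"
  using assms
proof (induction i)
  case (Suc i)
  then have "\<theta> (blk n (Suc i)) = \<theta> (blk n i) + fht n + real i * q"
    using \<theta>_blk_new[of i n i] by (simp add: blk_Suc)
  then show ?case using Suc by (simp add: field_simps)
qed simp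

lemma fht_0: "fht 0 = p"
  using \<theta>_Suc[of 0 0] ea_pos by (simp add: fht_def f_eq)

lemma fht_Suc: "fht (Suc n) = real (Suc n) * fht n + q * (real (Suc n) * real n / 2)"
  using \<theta>_blk[of "Suc n" n] by (simp add: fht_def levels_Suc(1))

text \<open>The left-hand side is the area of flow tower \<open>n\<close>, which lies over total
  base length \<open>col_end n \<le> 1\<close> under a roof of at most \<open>p\<close>.\<close>

lemma fht_le: "wd n * fht n \<le> p"
proof -
  have "\<theta> j \<le> real j * p" if "j \<le> ht n" for j
    using that
  proof (induction j)
    case (Suc j)
    moreover have "f (lv n ! j) \<le> p" using p_gt_q f_eq[of "lv n ! j"] by auto
    ultimately show ?case using \<theta>_Suc[of j n] by (simp add: algebra_simps)
  qed simp
  then have "wd n * fht n \<le> wd n * (real (ht n) * p)"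
    unfolding fht_def using wd_pos[of n] by (intro mult_left_mono) auto
  also have "\<dots> = col_end n * p" using wd_ht[of n] by simp
  also have "\<dots> \<le> 1 * p" using col_end_le_1 p_gt_q q_gt_0 by (intro mult_right_mono) auto
  finally show ?thesis by simp
qed

lemma ratio_irrational: "p / q \<notin> \<rat>"
proof
  assume "p / q \<in> \<rat>"
  then obtain a b where "p / q = of_int a / of_int b" "b > 0" by (rule Rats_cases')
  then have "of_int b * p + of_int (- a) * q = 0" using q_gt_0 by (simp add: field_simps)
  with rat_indep have "b = 0 \<and> - a = 0" unfolding rationally_independent_def by blast
  then show False using \<open>b > 0\<close> by simp
qed

sublocale tower_data p q p fht wd
  by unfold_locales
    (use q_gt_0 p_gt_q ratio_irrational fht_0 fht_Suc wd_pos wd_Suc fht_le in auto)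

lemma S_eq: "i \<le> Suc n \<Longrightarrow> S n i = \<theta> (blk n i)"
  by (simp add: S_def \<theta>_blk)

text \<open>Coordinates on all flow towers at once: the bottom level of every column has left endpoint \<open>0\<close>, so tower
  \<open>n\<close> is the image of \<open>[0, wd n) \<times> [0, fht n)\<close>.\<close>

definition kap :: "real \<Rightarrow> real \<Rightarrow> real \<times> real" where
  "kap u \<eta> = susp_flow staircase f \<eta> (u, 0)"

lemma kap_eq:
  assumes "0 \<le> u" "u < wd n" "j < ht n" "\<theta> j \<le> \<eta>" "\<eta> < \<theta> (Suc j)"
  shows "kap u \<eta> = (u + lv n ! j, \<eta> - \<theta> j)"
  unfolding kap_def
  using susp_flow_eq[of j u 0 \<eta>] bs_\<theta>[OF assms(1,2), of j] bs_\<theta>[OF assms(1,2), of "Suc j"]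
    staircase_orbit[OF assms(1-3)] assms by simp

lemma \<theta>_ex:
  assumes "0 \<le> \<eta>" "\<eta> < fht n"
  obtains j where "j < ht n" "\<theta> j \<le> \<eta>" "\<eta> < \<theta> (Suc j)"
  using bs_ex_less[of \<eta> "ht n" 0] assms unfolding \<theta>_def fht_def by metis

text \<open>Change of coordinates between consecutive towers: the \<open>i\<close>-th copy of tower
  \<open>n\<close> inside tower \<open>n + 1\<close> is its \<open>i\<close>-th vertical
  slice.\<close>

lemma kap_old:
  assumes "i \<le> n" "0 \<le> \<eta>" "\<eta> < fht n" "0 \<le> u" "u < wd (Suc n)"
  shows "kap u (S n i + \<eta>) = kap (u + real i * wd (Suc n)) \<eta>"
proof -
  obtain j where j: "j < ht n" "\<theta> j \<le> \<eta>" "\<eta> < \<theta> (Suc j)" using \<theta>_ex[OF assms(2,3)] .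
  have S: "S n i = \<theta> (blk n i)" using assms by (simp add: S_eq)
  have "kap u (S n i + \<eta>) = (u + lv (Suc n) ! (blk n i + j), S n i + \<eta> - \<theta> (blk n i + j))"
    using j \<theta>_blk_old[OF assms(1), of j] \<theta>_blk_old[OF assms(1), of "Suc j"] S
    by (intro kap_eq[OF assms(4,5) blk_less_ht[OF assms(1)]]) auto
  also have "\<dots> = (u + real i * wd (Suc n) + lv n ! j, \<eta> - \<theta> j)"
    using j \<theta>_blk_old[OF assms(1), of j] S levels_Suc(2)[OF assms(1) j(1)] by simp
  also have "\<dots> = kap (u + real i * wd (Suc n)) \<eta>"
    using subcolumn_bounds[OF assms(1)] assms j by (intro kap_eq[symmetric]) auto
  finally show ?thesis .
qed

text \<open>Between the top of copy \<open>i\<close> and the start of the next copy the point runs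
  through the \<open>i\<close> new spacers, all of which lie to the right of
  \<open>col_end n\<close>; \<open>k\<close> is the spacer reached at height \<eta>.\<close>

lemma kap_new:
  assumes "i \<le> n" "0 \<le> \<eta>" "\<eta> < real i * q" "0 \<le> u" "u < wd (Suc n)"
  shows "col_end n \<le> fst (kap u (S n i + fht n + \<eta>))"
proof -
  define k where "k = nat \<lfloor>\<eta> / q\<rfloor>"
  have "0 \<le> \<eta> / q" using assms q_gt_0 by simp
  then have "real k \<le> \<eta> / q" "\<eta> / q < real k + 1" unfolding k_def by linarith+
  then have k: "real k * q \<le> \<eta>" "\<eta> < real (Suc k) * q" using q_gt_0 by (auto simp: field_simps)
  then have "real k * q < real i * q" using assms by linarith
  then have ki: "k < i" using q_gt_0 by simp
  have S: "S n i = \<theta> (blk n i)" using assms by (simp add: S_eq)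
  have "kap u (S n i + fht n + \<eta>)
      = (u + lv (Suc n) ! (blk n i + ht n + k), S n i + fht n + \<eta> - \<theta> (blk n i + ht n + k))"
    using k ki \<theta>_blk_new[OF assms(1), of k] \<theta>_blk_new[OF assms(1), of "Suc k"] S
      blk_less_ht[OF assms(1), of "ht n + k"]
    by (intro kap_eq[OF assms(4,5)]) (auto simp: add.assoc)
  moreover have "0 \<le> real (tri i + k) * wd (Suc n)" using wd_pos[of "Suc n"] by simp
  ultimately show ?thesis using levels_Suc(3)[OF assms(1) ki] assms by simp
qed

end

section \<open>Measurability and area in tower coordinates\<close>

lemma staircase_measurable: "staircase \<in> borel_measurable borel"
proof (rule borel_measurableI)
  fix U :: "real set" assume U: "open U"
  define D where "D n j = {x. in_lv n j x \<and> Suc j < ht n}" for n j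
  have D: "D n j \<in> sets borel" for n j
  proof -
    have "D n j = (if Suc j < ht n then {lv n ! j..<lv n ! j + wd n} else {})"
      by (auto simp: D_def in_lv_def)
    then show ?thesis by simp
  qed
  have "staircase -` U \<inter> space borel
    = (\<Union>n. \<Union>j. D n j \<inter> ((\<lambda>x. x - lv n ! j + lv n ! Suc j) -` U \<inter> space borel)) \<union> (U - (\<Union>n. \<Union>j. D n j))"
  proof (intro set_eqI)
    fix x
    show "x \<in> staircase -` U \<inter> space borel \<longleftrightarrow> x \<in> (\<Union>n. \<Union>j. D n j \<inter> ((\<lambda>x. x - lv n ! j + lv n ! Suc j) -` U \<inter> space borel)) \<union> (U - (\<Union>n. \<Union>j. D n j))"
    proof (cases "\<exists>n j. x \<in> D n j")
      case True
      have e: "x - lv n ! j + lv n ! Suc j = staircase x" if "x \<in> D n j" for n j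
        using that staircase_eq[of n j x] by (simp add: D_def)
      obtain n j where nj: "x \<in> D n j" using True by blast
      have "staircase x \<in> U \<longleftrightarrow> (\<exists>n j. x \<in> D n j \<and> x - lv n ! j + lv n ! Suc j \<in> U)"
        using nj e by metis
      then show ?thesis using nj by auto
    next
      case False
      then have "\<not> (\<exists>n j. in_level staircase_r n j x)" by (simp add: in_level_iff D_def)
      then have "staircase x = x"
        unfolding staircase_def cs_map_def by (rule if_not_P)
      then show ?thesis using False by auto
    qed
  qed
  also have "\<dots> \<in> sets borel"
  proof -
    have "(\<lambda>x. x - lv n ! j + lv n ! Suc j) -` U \<in> sets borel" for n j
      by (intro borel_open open_vimage U continuous_intros)
    then show ?thesis using D U by (auto intro!: sets.Un sets.Diff sets.Int sets.countable_UN)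
  qed
  finally show "staircase -` U \<inter> space borel \<in> sets borel" .
qed

abbreviation vol :: "'a::euclidean_space set \<Rightarrow> real" where "vol \<equiv> measure lborel"

lemma vimage_shift_emeasure:
  fixes c :: "'a::euclidean_space"
  assumes "A \<in> sets borel"
  shows "(\<lambda>z. c + z) -` A \<in> sets borel" "emeasure lborel ((\<lambda>z. c + z) -` A) = emeasure lborel A"
proof -
  have m: "(+) c \<in> borel \<rightarrow>\<^sub>M borel" by simp
  show "(\<lambda>z. c + z) -` A \<in> sets borel" using measurable_sets[OF m assms] by simp
  have "emeasure lborel A = emeasure (distr lborel borel ((+) c)) A" by (simp add: lborel_distr_plus)
  also have "\<dots> = emeasure lborel ((+) c -` A \<inter> space lborel)"
    using m assms by (intro emeasure_distr) auto
  finally show "emeasure lborel ((\<lambda>z. c + z) -` A) = emeasure lborel A" by simp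
qed

lemma emeasure_lborel_Times:
  assumes "A \<in> sets borel" "B \<in> sets borel"
  shows "emeasure lborel (A \<times> B :: (real \<times> real) set) = emeasure lborel A * emeasure lborel B"
  using lborel.emeasure_pair_measure_Times[of A lborel B] assms by (simp add: lborel_prod)

lemma borel_Times:
  assumes "A \<in> sets borel" "B \<in> sets borel"
  shows "(A \<times> B :: (real \<times> real) set) \<in> sets borel"
  using assms by (simp add: borel_prod[symmetric])

lemma measure_lborel_Times:
  assumes "A \<in> sets borel" "B \<in> sets borel"
  shows "vol (A \<times> B :: (real \<times> real) set) = vol A * vol B"
  using emeasure_lborel_Times[OF assms] by (simp add: measure_def enn2real_mult)

context staircase_flow
begin

definition Xs :: "(real \<times> real) set" where "Xs = susp_space f"

definition Tw :: "nat \<Rightarrow> (real \<times> real) set" where "Tw n = {z \<in> Xs. fst z < col_end n}"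

lemma mem_Xs: "(x, y) \<in> Xs \<longleftrightarrow> 0 \<le> x \<and> x < 1 \<and> 0 \<le> y \<and> y < f x"
  by (simp add: Xs_def susp_space_def)

lemma f_measurable: "f \<in> borel_measurable borel"
proof -
  have "f = (\<lambda>x. if x < ea then p else q)" using f_eq by auto
  then show ?thesis by simp
qed

lemma Xs_borel: "Xs \<in> sets borel"
proof -
  note [measurable] = f_measurable
  have "Xs = {z \<in> space (borel \<Otimes>\<^sub>M borel). 0 \<le> fst z \<and> fst z < 1 \<and> 0 \<le> snd z \<and> snd z < f (fst z)}"
    by (auto simp: mem_Xs space_pair_measure)
  also have "\<dots> \<in> sets (borel \<Otimes>\<^sub>M borel)" by measurable
  finally show ?thesis unfolding borel_prod .
qed

lemma Tw_borel: "Tw n \<in> sets borel"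
proof -
  have "Tw n = Xs \<inter> ({..<col_end n} \<times> UNIV)" by (auto simp: Tw_def)
  then show ?thesis by (simp add: Xs_borel borel_Times sets.Int)
qed

lemma Tw_subset: "Tw n \<subseteq> Xs" by (auto simp: Tw_def)

lemma Tw_mono: "m \<le> n \<Longrightarrow> Tw m \<subseteq> Tw n"
  using col_end_mono[of m n] by (auto simp: Tw_def)

lemma Un_Tw: "(\<Union>n. Tw n) = Xs"
proof
  show "Xs \<subseteq> (\<Union>n. Tw n)"
  proof
    fix z assume z: "z \<in> Xs"
    then have "fst z < 1" by (cases z) (simp add: mem_Xs)
    then show "z \<in> (\<Union>n. Tw n)" using ex_col_end[of "fst z" 0] z by (auto simp: Tw_def)
  qed
qed (auto simp: Tw_def)

lemma bounded_fmeasurable: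
  fixes A :: "(real \<times> real) set"
  assumes "A \<in> sets borel" "A \<subseteq> {a..b} \<times> {c..d}"
  shows "A \<in> fmeasurable lborel"
proof (rule fmeasurableI)
  have "bounded ({a..b} \<times> {c..d})" by (intro bounded_Times) auto
  then show "emeasure lborel A < \<infinity>" using bounded_subset[OF _ assms(2)] by (intro emeasure_bounded_finite)
qed (use assms in simp)

lemma Xs_fm: "A \<in> sets borel \<Longrightarrow> A \<subseteq> Xs \<Longrightarrow> A \<in> fmeasurable lborel"
proof (rule bounded_fmeasurable[of _ 0 1 0 p])
  assume "A \<subseteq> Xs"
  moreover have "Xs \<subseteq> {0..1} \<times> {0..p}"
  proof
    fix z assume "z \<in> Xs"
    moreover have "f x \<le> p" for x using p_gt_q f_eq[of x] by auto
    ultimately show "z \<in> {0..1} \<times> {0..p}"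
      by (cases z) (auto simp: mem_Xs intro: less_imp_le[OF less_le_trans])
  qed
  ultimately show "A \<subseteq> {0..1} \<times> {0..p}" by blast
qed

lemma kap_Tw:
  assumes "0 \<le> u" "u < wd n" "0 \<le> \<eta>" "\<eta> < fht n"
  shows "kap u \<eta> \<in> Tw n"
proof -
  obtain j where j: "j < ht n" "\<theta> j \<le> \<eta>" "\<eta> < \<theta> (Suc j)" using \<theta>_ex[OF assms(3,4)] .
  have "in_lv n j (u + lv n ! j)" using assms j by (simp add: in_lv_def)
  from in_lv_range[OF this] show ?thesis
    unfolding kap_eq[OF assms(1,2) j] Tw_def
    using j \<theta>_Suc[OF j(1)] f_level[OF assms(1,2) j(1)] col_end_le_1[of n] by (auto simp: mem_Xs)
qed

definition chart :: "nat \<Rightarrow> (real \<times> real) set \<Rightarrow> (real \<times> real) set" where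
  "chart n E = {(u, \<eta>). 0 \<le> u \<and> u < wd n \<and> 0 \<le> \<eta> \<and> \<eta> < fht n \<and> kap u \<eta> \<in> E}"

text \<open>Over a single level \<open>kap\<close> is the translation by \<open>c j\<close>. Both
  the set and its chart decompose into finitely many disjoint pieces, one for each level, that
  correspond under these translations.\<close>

lemma chart_emeasure:
  assumes E: "E \<in> sets borel" "E \<subseteq> Tw n"
  shows "chart n E \<in> sets borel" "emeasure lborel (chart n E) = emeasure lborel E"
proof -
  define c where "c j = (lv n ! j, - \<theta> j)" for j
  define L where "L j = E \<inter> ({lv n ! j..<lv n ! j + wd n} \<times> UNIV)" for j
  define P where "P j = (\<lambda>z. c j + z) -` L j" for j
  have L: "L j \<in> sets borel" for j
    unfolding L_def by (intro sets.Int E(1) borel_Times) auto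
  note P = vimage_shift_emeasure[OF L, of "c j" j for j, folded P_def]
  have P_iff: "(u, \<eta>) \<in> P j \<longleftrightarrow> 0 \<le> u \<and> u < wd n \<and> \<theta> j \<le> \<eta> \<and> \<eta> < \<theta> (Suc j) \<and> kap u \<eta> \<in> E"
    if j: "j < ht n" for u \<eta> j
  proof
    assume "(u, \<eta>) \<in> P j"
    then have *: "0 \<le> u" "u < wd n" "(u + lv n ! j, \<eta> - \<theta> j) \<in> E"
      by (auto simp: P_def L_def c_def add.commute)
    then have "(u + lv n ! j, \<eta> - \<theta> j) \<in> Xs" using E(2) Tw_subset by blast
    then have "\<theta> j \<le> \<eta>" "\<eta> < \<theta> (Suc j)"
      using \<theta>_Suc[OF j] f_level[OF *(1,2) j] by (auto simp: mem_Xs)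
    then show "0 \<le> u \<and> u < wd n \<and> \<theta> j \<le> \<eta> \<and> \<eta> < \<theta> (Suc j) \<and> kap u \<eta> \<in> E"
      using * kap_eq[OF *(1,2) j] by simp
  next
    assume *: "0 \<le> u \<and> u < wd n \<and> \<theta> j \<le> \<eta> \<and> \<eta> < \<theta> (Suc j) \<and> kap u \<eta> \<in> E"
    then show "(u, \<eta>) \<in> P j"
      using kap_eq[of u n j \<eta>] j by (auto simp: P_def L_def c_def add.commute)
  qed
  have \<theta>_mono: "\<theta> i \<le> \<theta> j" if "i \<le> j" for i j
    using bs_mono[OF that] by (simp add: \<theta>_def)
  have chart_eq: "chart n E = (\<Union>j<ht n. P j)"
  proof (intro set_eqI iffI)
    fix z assume "z \<in> chart n E"
    then obtain u \<eta> where z: "z = (u, \<eta>)" "0 \<le> u" "u < wd n" "0 \<le> \<eta>" "\<eta> < fht n" "kap u \<eta> \<in> E"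
      by (auto simp: chart_def)
    obtain j where "j < ht n" "\<theta> j \<le> \<eta>" "\<eta> < \<theta> (Suc j)" using \<theta>_ex[OF z(4,5)] .
    then show "z \<in> (\<Union>j<ht n. P j)" using P_iff z by auto
  next
    fix z assume "z \<in> (\<Union>j<ht n. P j)"
    then obtain j where j: "j < ht n" "z \<in> P j" by auto
    then show "z \<in> chart n E"
      using P_iff[OF j(1), of "fst z" "snd z"] \<theta>_mono[of 0 j] \<theta>_mono[of "Suc j" "ht n"]
      by (auto simp: chart_def fht_def)
  qed
  show "chart n E \<in> sets borel" unfolding chart_eq using P(1) by auto
  have E_eq: "E = (\<Union>j<ht n. L j)"
  proof (intro set_eqI iffI)
    fix z assume z: "z \<in> E"
    then have "0 \<le> fst z" "fst z < col_end n"
      using E(2) by (cases z; auto simp: Tw_def mem_Xs)+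
    then obtain j where "in_lv n j (fst z)" using in_lv_ex by blast
    then show "z \<in> (\<Union>j<ht n. L j)" using z by (cases z) (auto simp: L_def in_lv_def)
  qed (auto simp: L_def)
  have dL: "disjoint_family_on L {..<ht n}"
  unfolding disjoint_family_on_def
  proof (intro ballI impI)
    fix i j assume ij: "i \<in> {..<ht n}" "j \<in> {..<ht n}" "i \<noteq> j"
    show "L i \<inter> L j = {}"
    proof (rule ccontr)
      assume "L i \<inter> L j \<noteq> {}"
      then obtain x y where "(x, y) \<in> L i" "(x, y) \<in> L j" by auto
      then have "in_lv n i x" "in_lv n j x" using ij by (auto simp: L_def in_lv_def)
      then show False using in_lv_unique ij(3) by blast
    qed
  qed
  have dP: "disjoint_family_on P {..<ht n}"
  unfolding disjoint_family_on_def
  proof (intro ballI impI)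
    fix i j assume ij: "i \<in> {..<ht n}" "j \<in> {..<ht n}" "i \<noteq> j"
    show "P i \<inter> P j = {}"
    proof (rule ccontr)
      assume "P i \<inter> P j \<noteq> {}"
      then obtain u \<eta> where "(u, \<eta>) \<in> P i" "(u, \<eta>) \<in> P j" by auto
      then have "\<theta> i < \<theta> (Suc j)" "\<theta> j < \<theta> (Suc i)" using P_iff[of i] P_iff[of j] ij by auto
      then show False using \<theta>_mono[of "Suc i" j] \<theta>_mono[of "Suc j" i] ij(3)
        by (cases i j rule: linorder_cases) auto
    qed
  qed
  have "emeasure lborel (chart n E) = (\<Sum>j<ht n. emeasure lborel (P j))"
    unfolding chart_eq using P(1) dP by (intro sum_emeasure[symmetric]) auto
  also have "\<dots> = (\<Sum>j<ht n. emeasure lborel (L j))" by (simp add: P(2))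
  also have "\<dots> = emeasure lborel (\<Union>j<ht n. L j)"
    using L dL by (intro sum_emeasure) auto
  finally show "emeasure lborel (chart n E) = emeasure lborel E" using E_eq by simp
qed

lemma chart_measure:
  assumes "E \<in> sets borel" "E \<subseteq> Tw n"
  shows "vol (chart n E) = vol E"
  using chart_emeasure(2)[OF assms] by (simp add: measure_def)

lemma chart_fm:
  assumes "E \<in> sets borel" "E \<subseteq> Tw n"
  shows "chart n E \<in> fmeasurable lborel"
  by (rule bounded_fmeasurable[of _ 0 "wd n" 0 "fht n"])
     (use chart_emeasure(1)[OF assms] in \<open>auto simp: chart_def\<close>)

lemma measure_Tw: "vol (Tw n) = wd n * fht n"
proof -
  have "chart n (Tw n) = {0..<wd n} \<times> {0..<fht n}" using kap_Tw by (auto simp: chart_def)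
  then show ?thesis
    using chart_measure[OF Tw_borel order_refl, of n] wd_pos[of n] H_pos[of n]
    by (simp add: measure_lborel_Times)
qed

text \<open>The preimage of \<open>A\<close> under the time-\<open>t\<close> flow, as it occurs in
  the definition of mixing.\<close>

definition Fl :: "real \<Rightarrow> (real \<times> real) set \<Rightarrow> (real \<times> real) set" where
  "Fl t A = {z \<in> Xs. susp_flow staircase f t z \<in> A}"

lemma Fl_subset: "Fl t A \<subseteq> Xs" by (auto simp: Fl_def)

lemma Fl_borel:
  assumes A: "A \<in> sets borel" and "0 \<le> t"
  shows "Fl t A \<in> sets borel"
proof -
  note [measurable] = f_measurable staircase_measurable
  have T[measurable]: "(staircase ^^ k) \<in> borel_measurable borel" for k
    by (induction k) (auto intro: measurable_comp staircase_measurable)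
  have bs[measurable]: "birkhoff_sum staircase f k \<in> borel_measurable borel" for k
  proof -
    have eq: "birkhoff_sum staircase f k = (\<lambda>x. \<Sum>i<k. f ((staircase ^^ i) x))"
      by (auto simp: birkhoff_sum_def)
    show ?thesis unfolding eq by measurable
  qed
  have A': "A \<in> sets (borel \<Otimes>\<^sub>M borel)" using A unfolding borel_prod .
  have X': "Xs \<in> sets (borel \<Otimes>\<^sub>M borel)" using Xs_borel unfolding borel_prod .
  define \<Phi> where "\<Phi> k z = ((staircase ^^ k) (fst z), snd z + t - birkhoff_sum staircase f k (fst z))" for k z
  have [measurable]: "\<Phi> k \<in> borel \<Otimes>\<^sub>M borel \<rightarrow>\<^sub>M borel \<Otimes>\<^sub>M borel" for k unfolding \<Phi>_def by measurable
  define R where "R k = {z \<in> space (borel \<Otimes>\<^sub>M borel). birkhoff_sum staircase f k (fst z) \<le> snd z + t \<and>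
      snd z + t < birkhoff_sum staircase f (Suc k) (fst z)}" for k
  have R: "R k \<in> sets (borel \<Otimes>\<^sub>M borel)" for k unfolding R_def by measurable
  have "Fl t A = (\<Union>k. Xs \<inter> R k \<inter> (\<Phi> k -` A \<inter> space (borel \<Otimes>\<^sub>M borel)))"
  proof (intro set_eqI iffI)
    fix z assume z: "z \<in> Fl t A"
    obtain x y where xy: "z = (x, y)" by (cases z)
    have "0 \<le> y + t" using z assms xy by (auto simp: Fl_def mem_Xs)
    then obtain k where k: "birkhoff_sum staircase f k x \<le> y + t" "y + t < birkhoff_sum staircase f (Suc k) x"
      by (rule bs_ex)
    then show "z \<in> (\<Union>k. Xs \<inter> R k \<inter> (\<Phi> k -` A \<inter> space (borel \<Otimes>\<^sub>M borel)))"
      using z susp_flow_eq[OF k] by (auto simp: xy Fl_def R_def \<Phi>_def space_pair_measure)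
  next
    fix z assume "z \<in> (\<Union>k. Xs \<inter> R k \<inter> (\<Phi> k -` A \<inter> space (borel \<Otimes>\<^sub>M borel)))"
    then obtain k where k: "z \<in> Xs" "z \<in> R k" "\<Phi> k z \<in> A" by auto
    then show "z \<in> Fl t A"
      using susp_flow_eq[of k "fst z" "snd z" t] by (auto simp: Fl_def R_def \<Phi>_def)
  qed
  also have "\<dots> \<in> sets (borel \<Otimes>\<^sub>M borel)"
    using X' R A' by (intro sets.countable_UN) (auto intro!: sets.Int measurable_sets[where A = "borel \<Otimes>\<^sub>M borel"])
  finally show ?thesis unfolding borel_prod .
qed

text \<open>Flowing adds \<open>t\<close> to the height coordinate, even when the sum runs past the
  top of tower \<open>n\<close>.\<close>

lemma Fl_kap:
  assumes "0 \<le> u" "u < wd n" "0 \<le> \<eta>" "\<eta> < fht n" "0 \<le> t"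
  shows "kap u \<eta> \<in> Fl t A \<longleftrightarrow> kap u (\<eta> + t) \<in> A"
  using kap_Tw[OF assms(1-4)] Tw_subset susp_flow_add[of 0 \<eta> t u] assms
  by (auto simp: Fl_def kap_def)

end

lemma measure_Diff_bounds:
  assumes "C \<in> fmeasurable M" "T \<in> fmeasurable M"
  shows "measure M (C - T) \<le> measure M C" "measure M C \<le> measure M (C - T) + measure M T"
proof -
  have D: "C - T \<in> fmeasurable M" using assms by (intro fmeasurable.Diff)
  show "measure M (C - T) \<le> measure M C"
    using assms D by (intro measure_mono_fmeasurable) auto
  have "measure M C \<le> measure M ((C - T) \<union> T)"
    using assms D by (intro measure_mono_fmeasurable) auto
  also have "\<dots> \<le> measure M (C - T) + measure M T"
    using assms D by (intro measure_Un_le) auto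
  finally show "measure M C \<le> measure M (C - T) + measure M T" .
qed

context tower_data
begin

lemma H_at_top: "filterlim H at_top sequentially"
proof (rule filterlim_at_top_mono)
  show "filterlim (\<lambda>n. q * (real n * (real n - 1) / 2)) at_top sequentially"
    using q_pos by real_asymp
  show "\<forall>\<^sub>F n in sequentially. q * (real n * (real n - 1) / 2) \<le> H n"
    using H_ge_quad by simp
qed

text \<open>Every spacer pile is an integer multiple of \<open>q\<close>, so modulo \<open>q\<close>
  each height is a positive integer multiple of \<open>p\<close>.\<close>

lemma H_irrational: "H n / q \<notin> \<rat>"
proof -
  have "\<exists>a>0. \<exists>z::int. H n = real a * p + of_int z * q"
  proof (induction n)
    case 0
    show ?case by (intro exI[of _ 1] conjI exI[of _ 0]) (auto simp: H_0)
  next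
    case (Suc n)
    then obtain a z where az: "a > 0" "H n = real a * p + of_int z * q" by auto
    obtain z' where z': "real (Suc n) * (real (Suc n) - 1) / 2 = of_int z'" using triangle_int by blast
    have "H (Suc n) = real (Suc n) * H n + q * of_int z'"
      unfolding H_Suc z'[symmetric] by simp
    also have "\<dots> = real (Suc n * a) * p + of_int (int (Suc n) * z + z') * q"
      unfolding az(2) by (simp add: algebra_simps)
    finally have "H (Suc n) = real (Suc n * a) * p + of_int (int (Suc n) * z + z') * q" .
    moreover have "Suc n * a > 0" using az(1) by simp
    ultimately show ?case by blast
  qed
  then obtain a z where az: "a > 0" "H n = real a * p + of_int z * q" by auto
  show ?thesis
  proof
    assume "H n / q \<in> \<rat>"
    moreover have "p / q = (H n / q - of_int z) / of_nat a"
      using az q_pos by (simp add: field_simps)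
    ultimately have "p / q \<in> \<rat>" by (simp only: Rats_divide Rats_diff Rats_of_int Rats_of_nat)
    with irr show False ..
  qed
qed

lemma locate_block:
  assumes "0 \<le> y" "y < H (Suc n)"
  obtains i where "i \<le> n" "S n i \<le> y" "y < S n (Suc i)"
proof -
  have "\<exists>i<m. S n i \<le> y \<and> y < S n (Suc i)" if "y < S n m" for m
    using that
  proof (induction m)
    case 0
    then show ?case using assms by simp
  next
    case (Suc m)
    show ?case
    proof (cases "y < S n m")
      case True
      then show ?thesis using Suc.IH by (meson less_SucI)
    next
      case False
      then show ?thesis using Suc.prems by (intro exI[of _ m]) auto
    qed
  qed
  from this[of "Suc n"] show ?thesis using that assms by (auto simp: S_top less_Suc_eq_le)
qed

end

section \<open>Invariance of area and full-width sets\<close>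

context staircase_flow
begin

lemma wd_tendsto_0: "wd \<longlonglongrightarrow> 0"
proof -
  have "(\<lambda>n. ea * (inverse (fact n) * 1 ^ n)) \<longlonglongrightarrow> ea * 0"
    by (intro tendsto_mult tendsto_const summable_LIMSEQ_zero summable_exp)
  then show ?thesis by (simp add: wd_eq[abs_def] divide_inverse)
qed

lemma measure_Int_Tw:
  assumes "A \<in> sets borel" "A \<subseteq> Xs"
  shows "(\<lambda>n. vol (A \<inter> Tw n)) \<longlonglongrightarrow> vol A"
proof -
  have eq: "(\<Union>n. A \<inter> Tw n) = A" using assms(2) Un_Tw by auto
  have "(\<lambda>n. vol (A \<inter> Tw n)) \<longlonglongrightarrow> vol (\<Union>n. A \<inter> Tw n)"
  proof (rule Lim_measure_incseq)
    show "range (\<lambda>n. A \<inter> Tw n) \<subseteq> sets lborel" using assms Tw_borel by auto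
    show "incseq (\<lambda>n. A \<inter> Tw n)" using Tw_mono by (auto simp: incseq_def)
    show "emeasure lborel (\<Union>n. A \<inter> Tw n) \<noteq> \<infinity>"
      unfolding eq using fmeasurableD2[OF Xs_fm[OF assms]] by simp
  qed
  then show ?thesis unfolding eq .
qed

lemma strip_fm: "{0..<wd n} \<times> {a..<b} \<in> fmeasurable lborel" for a b :: real
  by (rule bounded_fmeasurable[of _ 0 "wd n" a b]) (auto intro!: borel_Times)

lemma strip_measure: "a \<le> b \<Longrightarrow> vol ({0..<wd n} \<times> {a..<b}) = wd n * (b - a)" for a b :: real
  using wd_pos[of n] by (simp add: measure_lborel_Times)

text \<open>In tower coordinates the two sets differ by the vertical translation by
  \<open>t\<close>, apart from a top strip of the first and a bottom strip of the second, each of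
  area \<open>wd n * t\<close>.\<close>

lemma Fl_Tw_measure:
  assumes A: "A \<in> sets borel" and t: "0 \<le> t" "t \<le> fht n"
  shows "\<bar>vol (Fl t A \<inter> Tw n) - vol (A \<inter> Tw n)\<bar> \<le> wd n * t"
proof -
  define C1 C2 where "C1 = chart n (Fl t A \<inter> Tw n)" and "C2 = chart n (A \<inter> Tw n)"
  define T1 T2 where "T1 = {0..<wd n} \<times> {fht n - t..<fht n}" and "T2 = {0..<wd n} \<times> {0..<t}"
  have b: "Fl t A \<inter> Tw n \<in> sets borel" "A \<inter> Tw n \<in> sets borel"
    using Fl_borel[OF A t(1)] A Tw_borel by auto
  have fm: "C1 \<in> fmeasurable lborel" "C2 \<in> fmeasurable lborel"
    "T1 \<in> fmeasurable lborel" "T2 \<in> fmeasurable lborel"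
    unfolding C1_def C2_def T1_def T2_def by (intro chart_fm b Int_lower2 strip_fm)+
  have mT: "vol T1 = wd n * t" "vol T2 = wd n * t"
    unfolding T1_def T2_def using t by (auto simp: strip_measure)
  have "C1 - T1 = (\<lambda>z. (0, t) + z) -` (C2 - T2)"
  proof (intro set_eqI)
    fix z :: "real \<times> real"
    obtain u \<eta> where z: "z = (u, \<eta>)" by (cases z)
    show "z \<in> C1 - T1 \<longleftrightarrow> z \<in> (\<lambda>z. (0, t) + z) -` (C2 - T2)"
    proof (cases "0 \<le> u \<and> u < wd n \<and> 0 \<le> \<eta> \<and> \<eta> + t < fht n")
      case True
      then have "kap u \<eta> \<in> Tw n" "kap u (t + \<eta>) \<in> Tw n" using kap_Tw t by auto
      then show ?thesis using True t Fl_kap[of u n \<eta> t A]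
        by (auto simp: z C1_def C2_def T1_def T2_def chart_def add.commute)
    next
      case False
      then show ?thesis using t by (auto simp: z C1_def C2_def T1_def T2_def chart_def)
    qed
  qed
  moreover have "C2 - T2 \<in> sets borel"
    using chart_emeasure(1)[OF b(2) Int_lower2] unfolding C2_def T2_def
    by (intro sets.Diff borel_Times) auto
  ultimately have "vol (C1 - T1) = vol (C2 - T2)"
    using vimage_shift_emeasure(2)[of "C2 - T2" "(0, t)"] by (simp add: measure_def)
  moreover have "vol C1 = vol (Fl t A \<inter> Tw n)" "vol C2 = vol (A \<inter> Tw n)"
    unfolding C1_def C2_def by (intro chart_measure b Int_lower2)+
  ultimately show ?thesis
    using measure_Diff_bounds[OF fm(1,3)] measure_Diff_bounds[OF fm(2,4)] mT by linarith
qed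

text \<open>The towers exhaust the space while the strip area \<open>wd n * t\<close> tends to 0 for
  fixed \<open>t\<close>.\<close>

lemma Fl_measure:
  assumes A: "A \<in> sets borel" "A \<subseteq> Xs" and t: "0 \<le> t"
  shows "vol (Fl t A) = vol A"
proof -
  have "(\<lambda>n. vol (Fl t A \<inter> Tw n) - vol (A \<inter> Tw n))
      \<longlonglongrightarrow> vol (Fl t A) - vol A"
    by (intro tendsto_diff measure_Int_Tw A Fl_borel t Fl_subset)
  moreover have "(\<lambda>n. vol (Fl t A \<inter> Tw n) - vol (A \<inter> Tw n)) \<longlonglongrightarrow> 0"
  proof (rule Lim_null_comparison)
    show "\<forall>\<^sub>F n in sequentially. norm (vol (Fl t A \<inter> Tw n) - vol (A \<inter> Tw n)) \<le> wd n * t"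
      using H_at_top[unfolded filterlim_at_top, rule_format, of t]
      by eventually_elim (use Fl_Tw_measure[OF A(1) t] in auto)
    show "(\<lambda>n. wd n * t) \<longlonglongrightarrow> 0" using tendsto_mult_left_zero[OF wd_tendsto_0] .
  qed
  ultimately have "vol (Fl t A) - vol A = 0"
    by (rule LIMSEQ_unique)
  then show ?thesis by simp
qed

text \<open>Unions of full-width horizontal slices of tower \<open>n\<close>: membership depends on
  the height alone and is tested on the orbit of 0. These sets are the ones whose correlations live
  on the line.\<close>

definition cyl :: "nat \<Rightarrow> (real \<times> real) set \<Rightarrow> bool" where
  "cyl n A \<longleftrightarrow> A \<in> sets borel \<and> A \<subseteq> Tw n \<and>
     (\<forall>u \<eta>. 0 \<le> u \<longrightarrow> u < wd n \<longrightarrow> 0 \<le> \<eta> \<longrightarrow> \<eta> < fht n \<longrightarrow> (kap u \<eta> \<in> A \<longleftrightarrow> kap 0 \<eta> \<in> A))"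

definition trace :: "(real \<times> real) set \<Rightarrow> nat \<Rightarrow> real set" where
  "trace A n = {\<eta>. 0 \<le> \<eta> \<and> \<eta> < fht n \<and> kap 0 \<eta> \<in> A}"

definition prof :: "(real \<times> real) set \<Rightarrow> nat \<Rightarrow> real \<Rightarrow> real" where
  "prof A n = indicator (trace A n)"

lemma cylD:
  assumes "cyl n A"
  shows "A \<in> sets borel" "A \<subseteq> Tw n"
    "0 \<le> u \<Longrightarrow> u < wd n \<Longrightarrow> 0 \<le> \<eta> \<Longrightarrow> \<eta> < fht n \<Longrightarrow> kap u \<eta> \<in> A \<longleftrightarrow> kap 0 \<eta> \<in> A"
  using assms unfolding cyl_def by blast+

lemma cyl_Tw: "cyl n (Tw n)"
  unfolding cyl_def using Tw_borel kap_Tw wd_pos by auto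

lemma trace_Tw: "trace (Tw n) n = {0..<fht n}"
  unfolding trace_def using kap_Tw[of 0 n] wd_pos by auto

lemma cyl_chart:
  assumes "cyl n A"
  shows "chart n A = {0..<wd n} \<times> trace A n"
proof (intro set_eqI)
  fix z :: "real \<times> real"
  obtain u \<eta> where z: "z = (u, \<eta>)" by (cases z)
  show "z \<in> chart n A \<longleftrightarrow> z \<in> {0..<wd n} \<times> trace A n"
    using cylD(3)[OF assms, of u \<eta>] unfolding z chart_def trace_def by auto
qed

lemma trace_borel:
  assumes "cyl n A"
  shows "trace A n \<in> sets borel"
proof -
  have "chart n A \<in> sets (borel \<Otimes>\<^sub>M borel)"
    using chart_emeasure(1)[OF cylD(1,2)[OF assms]] unfolding borel_prod .
  from sets_Pair1[OF this, of 0] show ?thesis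
    using wd_pos[of n] by (simp add: cyl_chart[OF assms] vimage_def)
qed

lemma measure_cyl:
  assumes "cyl n A"
  shows "vol A = wd n * (\<integral>y. prof A n y \<partial>lborel)"
proof -
  have "vol A = vol (chart n A)"
    using chart_measure[OF cylD(1,2)[OF assms]] by simp
  also have "\<dots> = wd n * vol (trace A n)"
    unfolding cyl_chart[OF assms] using trace_borel[OF assms] wd_pos[of n]
    by (simp add: measure_lborel_Times)
  finally show ?thesis using trace_borel[OF assms] by (simp add: prof_def)
qed

text \<open>Inside tower \<open>n + 1\<close> the copies of tower \<open>n\<close> reproduce the old
  profile, while the new spacers lie outside \<open>Tw n\<close> and hence outside
  \<open>A\<close>.\<close>

lemma cyl_Suc:
  assumes A: "cyl n A"
  shows "cyl (Suc n) A" "prof A (Suc n) y = (\<Sum>i\<le>n. prof A n (y - S n i))"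
proof -
  have old: "kap u (S n i + \<eta>) \<in> A \<longleftrightarrow> kap 0 \<eta> \<in> A"
    if "i \<le> n" "0 \<le> \<eta>" "\<eta> < fht n" "0 \<le> u" "u < wd (Suc n)" for i u \<eta>
    using kap_old[OF that] cylD(3)[OF A, of "u + real i * wd (Suc n)" \<eta>] that subcolumn_bounds[OF that(1)] by simp
  have new: "kap u (S n i + fht n + \<eta>) \<notin> A"
    if "i \<le> n" "0 \<le> \<eta>" "\<eta> < real i * q" "0 \<le> u" "u < wd (Suc n)" for i u \<eta>
    using kap_new[OF that] cylD(2)[OF A] unfolding Tw_def by auto
  have dec: "kap u \<eta> \<in> A \<longleftrightarrow> \<eta> - S n i < fht n \<and> kap 0 (\<eta> - S n i) \<in> A"
    if "i \<le> n" "S n i \<le> \<eta>" "\<eta> < S n (Suc i)" "0 \<le> u" "u < wd (Suc n)" for i u \<eta>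
  proof (cases "\<eta> - S n i < fht n")
    case True
    then show ?thesis using old[of i "\<eta> - S n i" u] that by simp
  next
    case False
    then show ?thesis using new[of i "\<eta> - S n i - fht n" u] that by (simp add: S_Suc)
  qed
  have "kap u \<eta> \<in> A \<longleftrightarrow> kap 0 \<eta> \<in> A"
    if u: "0 \<le> u" "u < wd (Suc n)" "0 \<le> \<eta>" "\<eta> < fht (Suc n)" for u \<eta>
  proof -
    obtain i where "i \<le> n" "S n i \<le> \<eta>" "\<eta> < S n (Suc i)" using locate_block[OF u(3,4)] .
    from dec[OF this, of u] dec[OF this, of 0] show ?thesis using u wd_pos[of "Suc n"] by simp
  qed
  moreover have "A \<subseteq> Tw (Suc n)" using cylD(2)[OF A] Tw_mono[of n "Suc n"] by auto
  ultimately show "cyl (Suc n) A"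
    using cylD(1)[OF A] unfolding cyl_def by (intro conjI allI impI)
  show "prof A (Suc n) y = (\<Sum>i\<le>n. prof A n (y - S n i))"
  proof (cases "0 \<le> y \<and> y < fht (Suc n)")
    case True
    then obtain i where i: "i \<le> n" "S n i \<le> y" "y < S n (Suc i)" using locate_block by blast
    have "(\<Sum>j\<le>n. prof A n (y - S n j)) = (\<Sum>j\<in>{i}. prof A n (y - S n j))"
    proof (rule sum.mono_neutral_right)
      show "\<forall>j\<in>{..n} - {i}. prof A n (y - S n j) = 0"
      proof
        fix j assume j: "j \<in> {..n} - {i}"
        have "y - S n j < 0 \<or> fht n \<le> y - S n j"
        proof (cases "j < i")
          case True
          have "0 \<le> real j * q" using q_pos by simp
          then show ?thesis using S_mono[of "Suc j" i n] True i by (simp add: S_Suc)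
        next
          case False
          then show ?thesis using S_mono[of "Suc i" j n] j i by auto
        qed
        then show "prof A n (y - S n j) = 0" by (auto simp: prof_def trace_def)
      qed
    qed (use i in auto)
    also have "\<dots> = prof A (Suc n) y"
      using dec[OF i, of 0] True i wd_pos by (auto simp: prof_def trace_def indicator_def)
    finally show ?thesis ..
  next
    case False
    have "prof A n (y - S n i) = 0" if "i \<le> n" for i
      using False S_nonneg[of n i] S_add_le[OF that] by (auto simp: prof_def trace_def)
    then show ?thesis using False by (auto simp: prof_def trace_def)
  qed
qed

lemma cyl_mono:
  assumes "cyl n A" "n \<le> m"
  shows "cyl m A"
  using assms(2) by (induction m rule: dec_induct) (auto intro: assms(1) cyl_Suc(1))

lemma prof_tow_seq:
  assumes "cyl n A"
  shows "tow_seq n (prof A)"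
  unfolding tow_seq_def
proof (intro allI impI conjI)
  fix m y assume m: "n \<le> m"
  have c: "cyl m A" using cyl_mono[OF assms m] .
  show "prof A m \<in> borel_measurable borel" unfolding prof_def using trace_borel[OF c] by simp
  show "\<bar>prof A m y\<bar> \<le> 1" by (simp add: prof_def indicator_def)
  show "y \<notin> {0..<fht m} \<Longrightarrow> prof A m y = 0" by (auto simp: prof_def trace_def)
  show "prof A (Suc m) y = (\<Sum>i\<le>m. prof A m (y - S m i))" by (rule cyl_Suc(2)[OF c])
qed

lemma prof_equi:
  assumes "cyl n A" "equi q \<phi> (fht n) (prof A n)" "n \<le> m"
  shows "equi q \<phi> (fht m) (prof A m)"
  using assms(3)
proof (induction m rule: dec_induct)
  case (step m)
  have "equi q \<phi> (fht (Suc m)) (\<lambda>y. \<Sum>i\<le>m. prof A m (y - S m i))"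
    by (intro equi_sum equi_shift[OF step.IH]) (auto simp: S_nonneg S_add_le)
  also have "(\<lambda>y. \<Sum>i\<le>m. prof A m (y - S m i)) = prof A (Suc m)"
    using cyl_Suc(2)[OF cyl_mono[OF assms(1) step(1)]] by auto
  finally show ?case .
qed (use assms in simp)

text \<open>\<open>corr\<close> accounts for the points that stay in the tower up to time
  \<open>t\<close>. The others start in the top strip of height \<open>t\<close>, which has area
  \<open>wd n * t\<close>.\<close>

lemma Fl_corr:
  assumes A: "cyl n A" and B: "cyl n B" and t: "0 \<le> t" "t \<le> fht n"
  shows "\<bar>vol (Fl t A \<inter> B) - wd n * corr (prof B) (prof A) n t\<bar> \<le> wd n * t"
proof -
  have bA: "A \<in> sets borel" and bB: "B \<in> sets borel" "B \<subseteq> Tw n" using cylD(1,2)[OF A] cylD(1,2)[OF B] by auto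
  have b: "Fl t A \<inter> B \<in> sets borel" "Fl t A \<inter> B \<subseteq> Tw n"
    using Fl_borel[OF bA t(1)] bB by auto
  define V where "V = trace B n \<inter> (\<lambda>y. t + y) -` trace A n"
  have V: "V \<in> sets borel" unfolding V_def
    using trace_borel[OF A] trace_borel[OF B] vimage_shift_emeasure(1)[of "trace A n" t] by auto
  define C T where "C = chart n (Fl t A \<inter> B)" and "T = {0..<wd n} \<times> {fht n - t..<fht n}"
  have Vfm: "{0..<wd n} \<times> V \<in> fmeasurable lborel"
    using V by (intro bounded_fmeasurable[of _ 0 "wd n" 0 "fht n"] borel_Times) (auto simp: V_def trace_def)
  have fm: "C \<in> fmeasurable lborel" "T \<in> fmeasurable lborel"
    unfolding C_def T_def by (intro chart_fm b strip_fm)+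
  have mem: "(u, \<eta>) \<in> C \<longleftrightarrow> \<eta> \<in> V" if "0 \<le> u" "u < wd n" "0 \<le> \<eta>" "\<eta> + t < fht n" for u \<eta>
  proof -
    have "kap u \<eta> \<in> B \<longleftrightarrow> kap 0 \<eta> \<in> B" "kap u (\<eta> + t) \<in> A \<longleftrightarrow> kap 0 (\<eta> + t) \<in> A"
      using cylD(3)[OF B, of u \<eta>] cylD(3)[OF A, of u "\<eta> + t"] that t by auto
    then show ?thesis
      using that t Fl_kap[of u n \<eta> t A] by (auto simp: C_def V_def chart_def trace_def add.commute)
  qed
  have sub1: "{0..<wd n} \<times> V \<subseteq> C"
  proof
    fix z assume z: "z \<in> {0..<wd n} \<times> V"
    then have "snd z + t < fht n" "0 \<le> snd z" by (auto simp: V_def trace_def)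
    then show "z \<in> C" using z mem[of "fst z" "snd z"] by auto
  qed
  have sub2: "C \<subseteq> {0..<wd n} \<times> V \<union> T"
  proof
    fix z assume z: "z \<in> C"
    then have *: "0 \<le> fst z" "fst z < wd n" "0 \<le> snd z" "snd z < fht n"
      by (auto simp: C_def chart_def)
    show "z \<in> {0..<wd n} \<times> V \<union> T"
    proof (cases "snd z + t < fht n")
      case True
      then show ?thesis using * z mem[of "fst z" "snd z"] by (cases z) auto
    next
      case False
      then show ?thesis using * by (cases z) (auto simp: T_def)
    qed
  qed
  have mV: "vol ({0..<wd n} \<times> V) = wd n * corr (prof B) (prof A) n t"
  proof -
    have "corr (prof B) (prof A) n t = (\<integral>y. indicator V y \<partial>lborel)"
      unfolding corr_def by (rule Bochner_Integration.integral_cong)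
        (auto simp: prof_def V_def indicator_def add.commute)
    then show ?thesis using V wd_pos[of n] by (simp add: measure_lborel_Times)
  qed
  have mC: "vol C = vol (Fl t A \<inter> B)"
    unfolding C_def by (rule chart_measure[OF b])
  have "vol ({0..<wd n} \<times> V) \<le> vol C"
    using sub1 Vfm fm by (intro measure_mono_fmeasurable) auto
  moreover have "vol C \<le> vol ({0..<wd n} \<times> V \<union> T)"
    using sub2 Vfm fm by (intro measure_mono_fmeasurable) auto
  moreover have "vol ({0..<wd n} \<times> V \<union> T) \<le> vol ({0..<wd n} \<times> V) + vol T"
    using Vfm fm by (intro measure_Un_le) auto
  moreover have "vol T = wd n * t"
    unfolding T_def using t by (simp add: strip_measure)
  ultimately show ?thesis unfolding mV mC by linarith
qed

end

section \<open>Mixing for full-width sets\<close>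

context tower_data
begin

lemma corr_diff:
  assumes "tow_seq m b" "tow_seq m g" "tow_seq m h" "n \<ge> m"
  shows "corr b (\<lambda>n y. g n y - c * h n y) n t = corr b g n t - c * corr b h n t"
proof -
  have "integrable lborel (\<lambda>y. b n y * g n (y + t))" "integrable lborel (\<lambda>y. b n y * h n (y + t))"
    using tow_integrable2[OF assms(1,2,4), of 0 t] tow_integrable2[OF assms(1,3,4), of 0 t] by auto
  then show ?thesis
    unfolding corr_def by (simp add: right_diff_distrib mult.left_commute[of _ c])
qed

lemma bracket:
  assumes "H N \<le> t"
  obtains n where "N \<le> n" "H n \<le> t" "t < H (Suc n)"
proof -
  have "\<exists>k. t < H k"
    using H_at_top[unfolded filterlim_at_top_dense, rule_format, of t]
    unfolding eventually_sequentially by blast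
  define k where "k = (LEAST k. t < H k)"
  have k: "t < H k" unfolding k_def using \<open>\<exists>k. t < H k\<close> by (rule LeastI_ex)
  have "N < k"
  proof (rule ccontr)
    assume "\<not> N < k"
    then have "H k \<le> H N" by (intro H_mono) simp
    with k assms show False by simp
  qed
  then obtain n where n: "k = Suc n" by (cases k) auto
  have "\<not> t < H n" using not_less_Least[of n "\<lambda>k. t < H k"] n unfolding k_def by auto
  then show ?thesis using that[of n] n k \<open>N < k\<close> by simp
qed

end

context staircase_flow
begin

lemma measure_Tw_pos: "0 < vol (Tw n)"
  unfolding measure_Tw using wd_pos[of n] H_pos[of n] by simp

lemma measure_mono_Xs:
  "A \<in> sets borel \<Longrightarrow> B \<in> sets borel \<Longrightarrow> A \<subseteq> B \<Longrightarrow> B \<subseteq> Xs \<Longrightarrow> vol A \<le> vol B"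
  by (intro measure_mono_fmeasurable Xs_fm) auto

text \<open>The factor \<open>vol A / vol (Tw n1)\<close> is the one for which the profile of
  \<open>A\<close> minus that multiple of the profile of \<open>Tw n1\<close> has integral 0.
  Equidistribution of \<open>A\<close> is assumed for every irrational angle because the angle that
  finally occurs is the height of tower \<open>n1\<close>, which is chosen after
  \<open>n0\<close>.\<close>

lemma mix_relative:
  assumes A: "cyl n0 A" and B: "cyl n0 B"
    and eqA: "\<And>\<phi>. \<phi> / q \<notin> \<rat> \<Longrightarrow> equi q \<phi> (fht n0) (prof A n0)"
    and n1: "n0 \<le> n1" and "\<epsilon> > 0"
  shows "\<forall>\<^sub>F t in at_top. \<bar>vol (Fl t A \<inter> B)
     - vol A / vol (Tw n1) * vol (Fl t (Tw n1) \<inter> B)\<bar> \<le> \<epsilon>"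
proof -
  define m where "m = vol A / vol (Tw n1)"
  have A1: "cyl n1 A" and B1: "cyl n1 B" using cyl_mono[OF A n1] cyl_mono[OF B n1] by auto
  have m: "0 \<le> m" "m \<le> 1"
    using measure_mono_Xs[OF cylD(1)[OF A1] Tw_borel cylD(2)[OF A1] Tw_subset] measure_Tw_pos[of n1]
    unfolding m_def by auto
  define g where "g n y = prof A n y - m * prof (Tw n1) n y" for n y
  have tA: "tow_seq n1 (prof A)" and tB: "tow_seq n1 (prof B)" and tT: "tow_seq n1 (prof (Tw n1))"
    using prof_tow_seq[OF A1] prof_tow_seq[OF B1] prof_tow_seq[OF cyl_Tw] by auto
  have tg: "tow_seq n1 g"
    unfolding tow_seq_def
  proof (intro allI impI conjI)
    fix n y assume n: "n1 \<le> n"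
    show "g n \<in> borel_measurable borel"
      using tow_seqD(1)[OF tA n] tow_seqD(1)[OF tT n] unfolding g_def[abs_def] by measurable
    show "\<bar>g n y\<bar> \<le> 1" using m by (auto simp: g_def prof_def indicator_def)
    show "y \<notin> {0..<fht n} \<Longrightarrow> g n y = 0"
      using tow_seqD(3)[OF tA n, of y] tow_seqD(3)[OF tT n, of y] by (simp add: g_def)
    show "g (Suc n) y = (\<Sum>i\<le>n. g n (y - S n i))"
      unfolding g_def tow_seqD(4)[OF tA n] tow_seqD(4)[OF tT n]
      by (simp add: sum_subtractf sum_distrib_left)
  qed
  have "integral\<^sup>L lborel (g n1) = (\<integral>y. prof A n1 y \<partial>lborel) - m * (\<integral>y. prof (Tw n1) n1 y \<partial>lborel)"
    unfolding g_def[abs_def]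
    using tow_integrable[OF tA order_refl, of 0] tow_integrable[OF tT order_refl, of 0] by simp
  then have "wd n1 * integral\<^sup>L lborel (g n1) = vol A - m * vol (Tw n1)"
    unfolding measure_cyl[OF A1] measure_cyl[OF cyl_Tw] by (simp add: right_diff_distrib mult.left_commute)
  then have zero: "integral\<^sup>L lborel (g n1) = 0"
    using measure_Tw_pos[of n1] wd_pos[of n1] by (simp add: m_def)
  have eqT: "equi q (fht n1) (fht n1) (prof (Tw n1) n1)"
    unfolding prof_def trace_Tw using H_pos[of n1] by (intro equi_interval q_pos H_irrational) auto
  have "equi q (fht n1) (fht n1) (\<lambda>y. prof A n1 y + (- m) * prof (Tw n1) n1 y)"
    by (intro equi_add equi_scale eqT prof_equi[OF A eqA n1] H_irrational)
  then have eqg: "equi q (fht n1) (fht n1) (g n1)" by (simp add: g_def[abs_def])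
  obtain n2 where n2: "\<And>n t. n2 \<le> n \<Longrightarrow> fht n \<le> t \<Longrightarrow> t \<le> fht (Suc n) \<Longrightarrow>
      \<bar>wd (n + 2) * corr (prof B) g (n + 2) t\<bar> \<le> \<epsilon> / 2"
    using corr_tendsto_0[OF tB tg eqg zero, of "\<epsilon> / 2"] \<open>\<epsilon> > 0\<close> by auto
  \<comment> \<open>The last summand makes the boundary loss in tower \<open>n + 2\<close>, which is
    at most \<open>p / (n + 2)\<close>, no larger than \<open>\<epsilon> / 4\<close>.\<close>
  define N where "N = n1 + n2 + nat \<lceil>4 * p / \<epsilon>\<rceil>"
  have "\<bar>vol (Fl t A \<inter> B) - m * vol (Fl t (Tw n1) \<inter> B)\<bar> \<le> \<epsilon>" if t: "fht N \<le> t" for t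
  proof -
    obtain n where n: "N \<le> n" "fht n \<le> t" "t < fht (Suc n)" using bracket[OF t] .
    \<comment> \<open>In tower \<open>n + 1\<close> almost every point may leave within time
      \<open>t\<close>; one stage higher the loss carries an extra factor
      \<open>1 / (n + 2)\<close>.\<close>
    define k where "k = n + 2"
    have k: "n1 \<le> k" using n(1) by (simp add: k_def N_def)
    have t0: "0 \<le> t" "t \<le> fht k"
      using n H_pos[of n] H_mono[of "Suc n" k] by (auto simp: k_def)
    have small: "wd k * t \<le> \<epsilon> / 4"
    proof -
      have "wd k * t \<le> wd k * fht (Suc n)" using n wd_pos[of k] by (intro mult_left_mono) auto
      also have "\<dots> = wd (Suc n) * fht (Suc n) / real (n + 2)" by (simp add: k_def wd_Suc)
      also have "\<dots> \<le> p / real (n + 2)" by (intro divide_right_mono fht_le) simp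
      also have "\<dots> \<le> \<epsilon> / 4"
      proof -
        have "4 * p / \<epsilon> \<le> real (n + 2)" using n(1) unfolding N_def by linarith
        then show ?thesis using \<open>\<epsilon> > 0\<close> by (simp add: field_simps)
      qed
      finally show ?thesis .
    qed
    define a e where "a = vol (Fl t A \<inter> B)" and "e = vol (Fl t (Tw n1) \<inter> B)"
    have 1: "\<bar>a - wd k * corr (prof B) (prof A) k t\<bar> \<le> \<epsilon> / 4"
      using Fl_corr[OF cyl_mono[OF A1 k] cyl_mono[OF B1 k] t0] small unfolding a_def by linarith
    have 2: "\<bar>e - wd k * corr (prof B) (prof (Tw n1)) k t\<bar> \<le> \<epsilon> / 4"
      using Fl_corr[OF cyl_mono[OF cyl_Tw k] cyl_mono[OF B1 k] t0] small unfolding e_def by linarith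
    have 3: "\<bar>m * (e - wd k * corr (prof B) (prof (Tw n1)) k t)\<bar> \<le> 1 * (\<epsilon> / 4)"
      unfolding abs_mult using 2 m by (intro mult_mono) auto
    have 4: "\<bar>wd k * (corr (prof B) (prof A) k t - m * corr (prof B) (prof (Tw n1)) k t)\<bar> \<le> \<epsilon> / 2"
    proof -
      have "corr (prof B) g k t = corr (prof B) (prof A) k t - m * corr (prof B) (prof (Tw n1)) k t"
        unfolding g_def[abs_def] by (rule corr_diff[OF tB tA tT k])
      then show ?thesis using n2[of n t] n by (simp add: k_def N_def)
    qed
    have "a - m * e = (a - wd k * corr (prof B) (prof A) k t)
       - m * (e - wd k * corr (prof B) (prof (Tw n1)) k t)
       + wd k * (corr (prof B) (prof A) k t - m * corr (prof B) (prof (Tw n1)) k t)"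
      by (simp add: algebra_simps)
    then show ?thesis using 1 3 4 unfolding a_def e_def by linarith
  qed
  then show ?thesis unfolding m_def eventually_at_top_linorder by blast
qed

text \<open>\<open>mix_relative\<close> compares \<open>A\<close> with \<open>Tw n1\<close>, and
  \<open>Tw n1\<close> misses only area \<open>X - \<tau> n1\<close>, before and after flowing.
  First \<open>n1\<close> is taken large, then \<open>t\<close>.\<close>

lemma mix_cyl:
  assumes A: "cyl n0 A" and B: "cyl n0 B"
    and eqA: "\<And>\<phi>. \<phi> / q \<notin> \<rat> \<Longrightarrow> equi q \<phi> (fht n0) (prof A n0)"
  shows "((\<lambda>t. vol (Fl t A \<inter> B)) \<longlongrightarrow>
     vol A * vol B / vol Xs) at_top"
proof (rule tendstoI)
  fix \<epsilon> :: real assume "\<epsilon> > 0"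
  define X a b where "X = vol Xs" and "a = vol A" and "b = vol B"
  define \<tau> where "\<tau> n = vol (Tw n)" for n
  have bB: "B \<in> sets borel" "B \<subseteq> Xs" using cylD(1,2)[OF B] Tw_subset by auto
  have \<tau>X: "\<tau> \<longlonglongrightarrow> X"
    using measure_Int_Tw[OF Xs_borel order_refl] Tw_subset
    unfolding \<tau>_def[abs_def] X_def by (simp add: Int_absorb1)
  have \<tau>_le: "\<tau> n \<le> X" "0 < \<tau> n" for n
    using measure_mono_Xs[OF Tw_borel Xs_borel Tw_subset order_refl] measure_Tw_pos
    unfolding \<tau>_def X_def by auto
  have X: "X > 0" using \<tau>_le[of 0] by linarith
  have "(\<lambda>n. a / \<tau> n * (X - \<tau> n) + \<bar>a / \<tau> n - a / X\<bar> * b) \<longlonglongrightarrow> a / X * (X - X) + \<bar>a / X - a / X\<bar> * b"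
    using X by (intro tendsto_intros \<tau>X) auto
  then have "\<forall>\<^sub>F n in sequentially. a / \<tau> n * (X - \<tau> n) + \<bar>a / \<tau> n - a / X\<bar> * b < \<epsilon> / 2"
    using \<open>\<epsilon> > 0\<close> by (intro order_tendstoD(2)) auto
  then obtain n1 where n1: "n0 \<le> n1" "a / \<tau> n1 * (X - \<tau> n1) + \<bar>a / \<tau> n1 - a / X\<bar> * b < \<epsilon> / 2"
    unfolding eventually_sequentially by (metis nat_le_linear order_refl)
  have "\<forall>\<^sub>F t in at_top. \<bar>vol (Fl t A \<inter> B) - a / \<tau> n1 * vol (Fl t (Tw n1) \<inter> B)\<bar> \<le> \<epsilon> / 4"
    using mix_relative[OF A B eqA n1(1), of "\<epsilon> / 4"] \<open>\<epsilon> > 0\<close> unfolding a_def \<tau>_def by simp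
  then show "\<forall>\<^sub>F t in at_top. dist (vol (Fl t A \<inter> B))
     (vol A * vol B / vol Xs) < \<epsilon>"
    using eventually_ge_at_top[of 0]
  proof eventually_elim
    case (elim t)
    define e where "e = vol (Fl t (Tw n1) \<inter> B)"
    have F: "Fl t (Tw n1) \<in> sets borel" "Fl t (Tw n1) \<subseteq> Xs"
      using Fl_borel[OF Tw_borel elim(2)] Fl_subset by auto
    have e_le: "e \<le> b" unfolding e_def b_def using F bB by (intro measure_mono_Xs) auto
    \<comment> \<open>By invariance of area the complement of \<open>Fl t (Tw n1)\<close> has area
      \<open>X - \<tau> n1\<close>, so at most that much of \<open>B\<close> is missed.\<close>
    have "b \<le> e + (X - \<tau> n1)"
    proof -
      have "b \<le> vol ((Fl t (Tw n1) \<inter> B) \<union> (Xs - Fl t (Tw n1)))"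
        unfolding b_def using F bB Xs_borel by (intro measure_mono_Xs) auto
      also have "\<dots> \<le> e + vol (Xs - Fl t (Tw n1))"
        unfolding e_def using F bB Xs_borel by (intro measure_Un_le) auto
      also have "vol (Xs - Fl t (Tw n1)) = X - vol (Fl t (Tw n1))"
        unfolding X_def using F Xs_fm[OF Xs_borel order_refl] Xs_fm[OF F]
        by (intro measurable_measure_Diff) auto
      finally show ?thesis using Fl_measure[OF Tw_borel Tw_subset elim(2)] by (simp add: \<tau>_def)
    qed
    then have "\<bar>a / \<tau> n1 * (e - b)\<bar> \<le> a / \<tau> n1 * (X - \<tau> n1)"
      unfolding abs_mult using e_le \<tau>_le[of n1] by (intro mult_mono) (auto simp: a_def)
    moreover have "\<bar>(a / \<tau> n1 - a / X) * b\<bar> = \<bar>a / \<tau> n1 - a / X\<bar> * b"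
      unfolding abs_mult by (simp add: b_def)
    moreover have "vol (Fl t A \<inter> B) - a * b / X = (vol (Fl t A \<inter> B) - a / \<tau> n1 * e)
        + a / \<tau> n1 * (e - b) + (a / \<tau> n1 - a / X) * b"
    proof -
      have "x - s * b = (x - r * e) + r * (e - b) + (r - s) * b" for x r s :: real
        by (simp add: algebra_simps)
      from this[of "vol (Fl t A \<inter> B)" "a / X" "a / \<tau> n1"] show ?thesis by simp
    qed
    ultimately have "\<bar>vol (Fl t A \<inter> B) - a * b / X\<bar> < \<epsilon>"
      using elim(1) n1(2) \<open>\<epsilon> > 0\<close> unfolding e_def by linarith
    then show ?case by (simp add: dist_real_def a_def b_def X_def)
  qed
qed

end

section \<open>From rectangles to measurable sets\<close>

text \<open>Later columns only subdivide levels or add spacers beyond \<open>col_end\<close>. This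
  nesting makes the rectangles below stable under intersection.\<close>

lemma in_lv_nested:
  assumes "n \<le> m" "j' < ht m"
  shows "(\<forall>x. in_lv m j' x \<longrightarrow> in_lv n j x) \<or> (\<forall>x. in_lv m j' x \<longrightarrow> \<not> in_lv n j x)"
  using assms
proof (induction m arbitrary: j' rule: dec_induct)
  case base
  then show ?case using in_lv_unique by (cases "j = j'") blast+
next
  case (step m)
  obtain i where i: "i \<le> m" "(\<exists>l<ht m. j' = blk m i + l) \<or> (\<exists>k<i. j' = blk m i + ht m + k)"
    using blk_index[OF step.prems] by blast
  from i(2) show ?case
  proof (elim disjE exE conjE)
    fix l assume l: "l < ht m" "j' = blk m i + l"
    have "in_lv m l x" if "in_lv (Suc m) j' x" for x
      using in_lv_old_imp[OF i(1) l(1)] that l(2) by simp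
    then show ?thesis using step.IH[OF l(1)] by meson
  next
    fix k assume k: "k < i" "j' = blk m i + ht m + k"
    have "\<not> in_lv n j x" if "in_lv (Suc m) j' x" for x
      using new_spacer_bounds(1)[OF i(1) k(1), of x] in_lv_range[of n j x] col_end_mono[OF step.hyps(1)] that k(2)
      by auto
    then show ?thesis by blast
  qed
qed

context staircase_flow
begin

definition rect :: "nat \<Rightarrow> nat \<Rightarrow> real \<Rightarrow> real \<Rightarrow> (real \<times> real) set" where
  "rect n j c d = {lv n ! j..<lv n ! j + wd n} \<times> {c..<d}"

definition rects :: "(real \<times> real) set set" where
  "rects = {rect n j c d |n j c d. j < ht n \<and> 0 \<le> c \<and> c \<le> d \<and> d \<le> f (lv n ! j)}"

lemma mem_rect: "j < ht n \<Longrightarrow> (x, y) \<in> rect n j c d \<longleftrightarrow> in_lv n j x \<and> c \<le> y \<and> y < d"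
  by (auto simp: rect_def in_lv_def)

lemma f_in_lv: "in_lv n j x \<Longrightarrow> f x = f (lv n ! j)"
  using f_level[of "x - lv n ! j" n j] by (simp add: in_lv_def)

lemma rect_Tw:
  assumes "j < ht n" "0 \<le> c" "d \<le> f (lv n ! j)"
  shows "rect n j c d \<subseteq> Tw n"
proof
  fix z assume z: "z \<in> rect n j c d"
  obtain x y where xy: "z = (x, y)" by (cases z)
  have "in_lv n j x" "c \<le> y" "y < d" using z mem_rect[OF assms(1)] xy by auto
  then show "z \<in> Tw n"
    using in_lv_range[of n j x] f_in_lv[of n j x] assms col_end_le_1[of n]
    by (auto simp: xy Tw_def mem_Xs)
qed

text \<open>In tower coordinates a rectangle over level \<open>j\<close> becomes a full-width slice
  with an interval of heights, so \<open>equi_interval\<close> applies to its profile.\<close>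

lemma rect_kap:
  assumes "j < ht n" "0 \<le> c" "d \<le> f (lv n ! j)" "0 \<le> u" "u < wd n" "0 \<le> \<eta>" "\<eta> < fht n"
  shows "kap u \<eta> \<in> rect n j c d \<longleftrightarrow> \<theta> j + c \<le> \<eta> \<and> \<eta> < \<theta> j + d"
proof -
  obtain i where i: "i < ht n" "\<theta> i \<le> \<eta>" "\<eta> < \<theta> (Suc i)" using \<theta>_ex[OF assms(6,7)] .
  have k: "kap u \<eta> = (u + lv n ! i, \<eta> - \<theta> i)" by (rule kap_eq[OF assms(4,5) i])
  have lvl: "in_lv n i (u + lv n ! i)" using assms i by (simp add: in_lv_def)
  have mono: "\<theta> a \<le> \<theta> b" if "a \<le> b" for a b using bs_mono[OF that] by (simp add: \<theta>_def)
  show ?thesis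
  proof (cases "i = j")
    case True
    then show ?thesis using k lvl mem_rect[OF assms(1)] by auto
  next
    case False
    then have "\<not> in_lv n j (u + lv n ! i)" using in_lv_unique[OF lvl] by blast
    moreover have "\<not> (\<theta> j + c \<le> \<eta> \<and> \<eta> < \<theta> j + d)"
    proof (cases "i < j")
      case True
      then show ?thesis using mono[of "Suc i" j] i assms(2) by auto
    next
      case 2: False
      then show ?thesis using mono[of "Suc j" i] \<theta>_Suc[OF assms(1)] False i assms(3) by auto
    qed
    ultimately show ?thesis using k mem_rect[OF assms(1)] by auto
  qed
qed

lemma rect_cyl:
  assumes "j < ht n" "0 \<le> c" "d \<le> f (lv n ! j)"
  shows "cyl n (rect n j c d)"
  unfolding cyl_def
proof (intro conjI allI impI)
  show "rect n j c d \<in> sets borel" unfolding rect_def by (intro borel_Times) auto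
  show "rect n j c d \<subseteq> Tw n" by (rule rect_Tw[OF assms])
  show "kap u \<eta> \<in> rect n j c d \<longleftrightarrow> kap 0 \<eta> \<in> rect n j c d"
    if "0 \<le> u" "u < wd n" "0 \<le> \<eta>" "\<eta> < fht n" for u \<eta>
    using rect_kap[OF assms that] rect_kap[OF assms order_refl wd_pos that(3,4)] by simp
qed

lemma rect_equi:
  assumes "j < ht n" "0 \<le> c" "c \<le> d" "d \<le> f (lv n ! j)" "\<phi> / q \<notin> \<rat>"
  shows "equi q \<phi> (fht n) (prof (rect n j c d) n)"
proof -
  have j: "0 \<le> \<theta> j" "\<theta> (Suc j) \<le> fht n"
    using bs_mono[of 0 j 0] bs_mono[of "Suc j" "ht n" 0] assms(1) by (auto simp: \<theta>_def fht_def)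
  have "trace (rect n j c d) n = {\<theta> j + c..<\<theta> j + d}"
    using rect_kap[OF assms(1,2,4) order_refl wd_pos] j assms \<theta>_Suc[OF assms(1)]
    unfolding trace_def by auto
  moreover have "equi q \<phi> (fht n) (indicator {\<theta> j + c..<\<theta> j + d})"
    using j assms \<theta>_Suc[OF assms(1)] by (intro equi_interval q_pos) auto
  ultimately show ?thesis by (simp add: prof_def)
qed

lemma rects_borel: "A \<in> rects \<Longrightarrow> A \<in> sets borel \<and> A \<subseteq> Xs"
  using rect_cyl Tw_subset unfolding rects_def cyl_def by blast

lemma mix_rects:
  assumes "A \<in> rects" "B \<in> rects"
  shows "((\<lambda>t. vol (Fl t A \<inter> B)) \<longlongrightarrow>
     vol A * vol B / vol Xs) at_top"
proof -
  obtain n j c d where A: "A = rect n j c d" "j < ht n" "0 \<le> c" "c \<le> d" "d \<le> f (lv n ! j)"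
    using assms(1) unfolding rects_def by auto
  obtain n' j' c' d' where B: "B = rect n' j' c' d'" "j' < ht n'" "0 \<le> c'" "c' \<le> d'" "d' \<le> f (lv n' ! j')"
    using assms(2) unfolding rects_def by auto
  have cA: "cyl n A" and cB: "cyl n' B" using rect_cyl A B by auto
  show ?thesis
  proof (rule mix_cyl[of "max n n'"])
    show "cyl (max n n') A" "cyl (max n n') B" by (rule cyl_mono[OF cA max.cobounded1] cyl_mono[OF cB max.cobounded2])+
    show "equi q \<phi> (fht (max n n')) (prof A (max n n'))" if "\<phi> / q \<notin> \<rat>" for \<phi>
      using prof_equi[OF cA rect_equi[OF A(2-5) that, folded A(1)], of "max n n'"] by simp
  qed
qed

lemma Int_stable_rects: "Int_stable rects"
proof -
  have aux: "rect n j c d \<inter> rect n' j' c' d' \<in> rects"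
    if *: "j < ht n" "0 \<le> c" "d \<le> f (lv n ! j)" "j' < ht n'" "0 \<le> c'" "d' \<le> f (lv n' ! j')" "n \<le> n'"
    for n j c d n' j' c' d'
  proof -
    have empty: "{} \<in> rects"
      unfolding rects_def using *(1) f_pos[of "lv n ! j"]
      by (intro CollectI exI[of _ n] exI[of _ j] exI[of _ "0::real"]) (auto simp: rect_def)
    from in_lv_nested[OF *(7,4), of j] show ?thesis
    proof
      assume "\<forall>x. in_lv n' j' x \<longrightarrow> in_lv n j x"
      then have eq: "rect n j c d \<inter> rect n' j' c' d' = rect n' j' (max c c') (min d d')"
        using mem_rect[OF *(1)] mem_rect[OF *(4)] by auto
      show ?thesis
      proof (cases "max c c' \<le> min d d'")
        case True
        then show ?thesis unfolding eq rects_def using * by force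
      next
        case False
        then have "rect n' j' (max c c') (min d d') = {}" by (auto simp: rect_def)
        then show ?thesis using eq empty by simp
      qed
    next
      assume "\<forall>x. in_lv n' j' x \<longrightarrow> \<not> in_lv n j x"
      then have "rect n j c d \<inter> rect n' j' c' d' = {}"
        using mem_rect[OF *(1)] mem_rect[OF *(4)] by auto
      then show ?thesis using empty by simp
    qed
  qed
  show ?thesis
  proof (rule Int_stableI)
    fix A B assume "A \<in> rects" "B \<in> rects"
    then obtain n j c d n' j' c' d' where
      A: "A = rect n j c d" "j < ht n" "0 \<le> c" "d \<le> f (lv n ! j)" and
      B: "B = rect n' j' c' d'" "j' < ht n'" "0 \<le> c'" "d' \<le> f (lv n' ! j')"
      unfolding rects_def by auto
    show "A \<inter> B \<in> rects"
    proof (cases "n \<le> n'")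
      case True
      then show ?thesis using aux A B by simp
    next
      case False
      then show ?thesis using aux[of j' n' c' d' j n c d] A B by (simp add: Int_commute)
    qed
  qed
qed

lemma rect_nhd:
  assumes U: "open U" and z: "z \<in> U" "z \<in> Xs"
  shows "\<exists>n j. \<exists>c\<in>\<rat>. \<exists>d\<in>\<rat>. rect n j c d \<in> rects \<and> z \<in> rect n j c d \<and> rect n j c d \<subseteq> U"
proof -
  obtain x y where xy: "z = (x, y)" by (cases z)
  obtain e where e: "e > 0" "ball z e \<subseteq> U" using U z open_contains_ball by blast
  have "\<forall>\<^sub>F n in sequentially. wd n < e / 2"
    using order_tendstoD(2)[OF wd_tendsto_0, of "e / 2"] e by simp
  moreover have "x < 1" "0 \<le> x" "0 \<le> y" "y < f x" using z by (auto simp: xy mem_Xs)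
  ultimately obtain n where n: "wd n < e / 2" "x < col_end n"
    unfolding eventually_sequentially using ex_col_end by (meson)
  obtain j where j: "in_lv n j x" using in_lv_ex[OF \<open>0 \<le> x\<close> n(2)] by blast
  have jh: "j < ht n" using j by (simp add: in_lv_def)
  \<comment> \<open>On the base line \<open>y = 0\<close> the lower edge has to be 0 itself, since
    rectangles must not reach below the base.\<close>
  obtain c where c: "c \<in> \<rat>" "0 \<le> c" "c \<le> y" "y - e / 2 < c"
  proof (cases "y = 0")
    case True
    then show ?thesis using that[of 0] e by simp
  next
    case False
    then obtain c where "c \<in> \<rat>" "max 0 (y - e / 2) < c" "c < y"
      using Rats_dense_in_real[of "max 0 (y - e / 2)" y] \<open>0 \<le> y\<close> e by auto
    then show ?thesis using that[of c] by simp
  qed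
  obtain d where d: "d \<in> \<rat>" "y < d" "d < min (f x) (y + e / 2)"
    using Rats_dense_in_real[of y "min (f x) (y + e / 2)"] \<open>y < f x\<close> e by auto
  have "rect n j c d \<subseteq> ball z e"
  proof
    fix w assume w: "w \<in> rect n j c d"
    obtain x' y' where w': "w = (x', y')" by (cases w)
    have "lv n ! j \<le> x'" "x' < lv n ! j + wd n" "c \<le> y'" "y' < d"
      using w unfolding w' by (auto simp: rect_def)
    moreover have "lv n ! j \<le> x" "x < lv n ! j + wd n" using j by (auto simp: in_lv_def)
    moreover have "d < y + e / 2" using d by simp
    ultimately have "\<bar>x - x'\<bar> < e / 2" "\<bar>y - y'\<bar> < e / 2"
      using n(1) c d(2) by linarith+
    moreover have "dist z w \<le> \<bar>x - x'\<bar> + \<bar>y - y'\<bar>"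
      unfolding xy w' using norm_Pair_le[of "x - x'" "y - y'"] by (simp add: dist_norm)
    ultimately show "w \<in> ball z e" by simp
  qed
  moreover have "z \<in> rect n j c d" using j c d by (simp add: xy mem_rect[OF jh])
  moreover have "rect n j c d \<in> rects"
    unfolding rects_def using jh c d f_in_lv[OF j] by force
  ultimately show ?thesis using c(1) d(1) e(2) by blast
qed

lemma sigma_sets_rects:
  assumes "A \<in> sets borel"
  shows "A \<inter> Xs \<in> sigma_sets Xs rects"
proof -
  have sub: "rects \<subseteq> Pow Xs" using rects_borel by auto
  interpret sa: sigma_algebra Xs "sigma_sets Xs rects" by (rule sigma_algebra_sigma_sets[OF sub])
  have "A \<in> sigma_sets UNIV {U :: (real \<times> real) set. open U}"
    using assms by (simp add: borel_def)
  then show ?thesis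
  proof (induction rule: sigma_sets.induct)
    case (Basic U)
    \<comment> \<open>Rational lower and upper edges keep the family countable, so a relatively open
      set is a countable union of rectangles.\<close>
    define Q where "Q = (\<lambda>(n, j, c, d). rect n j c d) ` (UNIV \<times> UNIV \<times> \<rat> \<times> \<rat>) \<inter> {R \<in> rects. R \<subseteq> U}"
    have "countable Q" unfolding Q_def
      by (intro countable_Int1 countable_image countable_SIGMA) (auto intro: countable_rat)
    have "U \<inter> Xs = \<Union>Q"
    proof
      show "U \<inter> Xs \<subseteq> \<Union>Q"
      proof
        fix z assume "z \<in> U \<inter> Xs"
        then obtain n j c d where "c \<in> \<rat>" "d \<in> \<rat>" "rect n j c d \<in> rects" "z \<in> rect n j c d" "rect n j c d \<subseteq> U"
          using rect_nhd[of U z] Basic by auto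
        moreover then have "rect n j c d \<in> Q" unfolding Q_def
          by (auto intro!: image_eqI[of _ _ "(n, j, c, d)"])
        ultimately show "z \<in> \<Union>Q" by blast
      qed
      show "\<Union>Q \<subseteq> U \<inter> Xs" using sub unfolding Q_def by auto
    qed
    also have "\<dots> \<in> sigma_sets Xs rects"
      using \<open>countable Q\<close> by (intro sa.countable_Union) (auto simp: Q_def)
    finally show ?case .
  next
    case Empty
    then show ?case by simp
  next
    case (Compl A)
    have "(UNIV - A) \<inter> Xs = Xs - A \<inter> Xs" by auto
    then show ?case using sa.compl_sets[OF Compl.IH] by simp
  next
    case (Union A)
    have eq: "(\<Union>i. A i) \<inter> Xs = (\<Union>i. A i \<inter> Xs)" by auto
    show ?case unfolding eq using Union.IH by (intro sa.countable_UN) auto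
  qed
qed

end

section \<open>Extension to Borel sets and to Lebesgue sets\<close>

lemma tendsto_suminf_dominated:
  fixes a :: "nat \<Rightarrow> real \<Rightarrow> real"
  assumes "\<And>k. (a k \<longlongrightarrow> b k) at_top" "\<And>k t. 0 \<le> t \<Longrightarrow> \<bar>a k t\<bar> \<le> c k" "summable c"
  shows "((\<lambda>t. \<Sum>k. a k t) \<longlongrightarrow> (\<Sum>k. b k)) at_top"
proof -
  have "\<forall>\<^sub>F (k, t) in at_top \<times>\<^sub>F at_top. norm (a k t) \<le> c k"
    unfolding eventually_prod_filter
    by (intro exI[of _ "\<lambda>_. True"] exI[of _ "\<lambda>t. 0 \<le> t"])
       (use assms(2) eventually_ge_at_top in auto)
  from tannerys_theorem[OF assms(1) this assms(3)] show ?thesis by simp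
qed

context staircase_flow
begin

definition mixes :: "(real \<times> real) set \<Rightarrow> (real \<times> real) set \<Rightarrow> bool" where
  "mixes A B \<longleftrightarrow> ((\<lambda>t. vol (Fl t A \<inter> B)) \<longlongrightarrow>
     vol A * vol B / vol Xs) at_top"

lemma measure_Xs_pos: "0 < vol Xs"
  using measure_mono_Xs[OF Tw_borel Xs_borel Tw_subset order_refl] measure_Tw_pos[of 0] by (rule less_le_trans[rotated])

lemma mixes_cong:
  assumes "\<And>t. 0 \<le> t \<Longrightarrow> vol (Fl t A \<inter> B) = g t"
    and "(g \<longlongrightarrow> vol A * vol B / vol Xs) at_top"
  shows "mixes A B"
proof -
  have "\<forall>\<^sub>F t in at_top. vol (Fl t A \<inter> B) = g t"
    using eventually_ge_at_top[of 0] by eventually_elim (rule assms(1))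
  then show ?thesis unfolding mixes_def using assms(2) by (subst tendsto_cong)
qed

lemma sums_measure_Xs:
  assumes "\<And>i. D i \<in> sets borel" "\<And>i. D i \<subseteq> Xs" "disjoint_family D"
  shows "(\<lambda>i. vol (D i)) sums vol (\<Union>i. D i)"
proof (rule measure_UNION)
  have "(\<Union>i. D i) \<in> fmeasurable lborel" using assms by (intro Xs_fm) auto
  from fmeasurableD2[OF this] show "emeasure lborel (\<Union>i. D i) \<noteq> \<infinity>" by simp
qed (use assms in auto)

text \<open>Common core of the two closure lemmas for disjoint unions: \<open>E t\<close> is the
  flowed family, dominated by the areas of the \<open>D i\<close>, and \<open>r\<close> is the
  relative area of the set that is held fixed.\<close>

lemma tendsto_measure_UN:
  fixes D :: "nat \<Rightarrow> (real \<times> real) set"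
    and E :: "real \<Rightarrow> nat \<Rightarrow> (real \<times> real) set"
  assumes D: "\<And>i. D i \<in> sets borel" "\<And>i. D i \<subseteq> Xs" "disjoint_family D"
    and E: "\<And>t i. 0 \<le> t \<Longrightarrow> E t i \<in> sets borel" "\<And>t i. E t i \<subseteq> Xs" "\<And>t. disjoint_family (E t)"
    and le: "\<And>t i. 0 \<le> t \<Longrightarrow> vol (E t i) \<le> vol (D i)"
    and lim: "\<And>i. ((\<lambda>t. vol (E t i)) \<longlongrightarrow> r * vol (D i)) at_top"
  shows "((\<lambda>t. vol (\<Union>i. E t i)) \<longlongrightarrow> r * vol (\<Union>i. D i)) at_top"
proof -
  have s: "(\<lambda>i. vol (D i)) sums vol (\<Union>i. D i)" by (rule sums_measure_Xs[OF D])
  have "((\<lambda>t. \<Sum>i. vol (E t i)) \<longlongrightarrow> (\<Sum>i. r * vol (D i))) at_top"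
    by (rule tendsto_suminf_dominated[where c = "\<lambda>i. vol (D i)"])
       (use lim le sums_summable[OF s] in auto)
  moreover have "\<forall>\<^sub>F t in at_top. (\<Sum>i. vol (E t i)) = vol (\<Union>i. E t i)"
    using eventually_ge_at_top[of 0]
    by eventually_elim (use sums_measure_Xs[OF E] in \<open>simp add: sums_iff\<close>)
  ultimately have "((\<lambda>t. vol (\<Union>i. E t i)) \<longlongrightarrow> (\<Sum>i. r * vol (D i))) at_top"
    by (rule Lim_transform_eventually)
  then show ?thesis using suminf_mult[OF sums_summable[OF s], of r] s by (simp add: sums_iff)
qed

lemma mixes_UN_right:
  fixes D :: "nat \<Rightarrow> (real \<times> real) set"
  assumes A: "A \<in> sets borel" and D: "\<And>i. D i \<in> sets borel" "\<And>i. D i \<subseteq> Xs" "disjoint_family D"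
    and mix: "\<And>i. mixes A (D i)"
  shows "mixes A (\<Union>i. D i)"
proof -
  have "((\<lambda>t. vol (\<Union>i. Fl t A \<inter> D i)) \<longlongrightarrow>
      vol A / vol Xs * vol (\<Union>i. D i)) at_top"
  proof (rule tendsto_measure_UN[OF D])
    show "((\<lambda>t. vol (Fl t A \<inter> D i)) \<longlongrightarrow> vol A / vol Xs * vol (D i)) at_top" for i
      using mix[of i] unfolding mixes_def by simp
    show "Fl t A \<inter> D i \<in> sets borel" "vol (Fl t A \<inter> D i) \<le> vol (D i)" if "0 \<le> t" for t i
      using measure_mono_Xs[of "Fl t A \<inter> D i" "D i"] Fl_borel[OF A that] D by auto
  qed (use D(2) disjoint_family_subset[OF D(3)] in auto)
  then show ?thesis unfolding mixes_def by simp
qed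

lemma mixes_UN_left:
  fixes D :: "nat \<Rightarrow> (real \<times> real) set"
  assumes B: "B \<in> sets borel" "B \<subseteq> Xs" and D: "\<And>i. D i \<in> sets borel" "\<And>i. D i \<subseteq> Xs" "disjoint_family D"
    and mix: "\<And>i. mixes (D i) B"
  shows "mixes (\<Union>i. D i) B"
proof -
  have "((\<lambda>t. vol (\<Union>i. Fl t (D i) \<inter> B)) \<longlongrightarrow>
      vol B / vol Xs * vol (\<Union>i. D i)) at_top"
  proof (rule tendsto_measure_UN[OF D])
    show "((\<lambda>t. vol (Fl t (D i) \<inter> B)) \<longlongrightarrow> vol B / vol Xs * vol (D i)) at_top" for i
      using mix[of i] unfolding mixes_def by (simp add: mult.commute)
    show "Fl t (D i) \<inter> B \<in> sets borel" "vol (Fl t (D i) \<inter> B) \<le> vol (D i)" if "0 \<le> t" for t i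
      using measure_mono_Xs[of "Fl t (D i) \<inter> B" "Fl t (D i)"] Fl_borel[OF D(1) that] B Fl_subset
        Fl_measure[OF D(1,2) that] by auto
    have "disjoint_family (\<lambda>i. Fl t (D i))" for t
      using D(3) unfolding disjoint_family_on_def Fl_def by blast
    then show "disjoint_family (\<lambda>i. Fl t (D i) \<inter> B)" for t
      by (rule disjoint_family_subset) auto
  qed (use B(2) in auto)
  moreover have "Fl t (\<Union>i. D i) \<inter> B = (\<Union>i. Fl t (D i) \<inter> B)" for t by (auto simp: Fl_def)
  ultimately show ?thesis unfolding mixes_def by (simp add: mult.commute)
qed

lemma measure_Diff_Xs:
  assumes "A \<in> sets borel" "A \<subseteq> Xs" "B \<in> sets borel" "B \<subseteq> A"
  shows "vol (A - B) = vol A - vol B"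
  using assms Xs_fm[OF assms(1,2)] Xs_fm[of B] by (intro measurable_measure_Diff) auto

lemma mixes_Diff_right:
  assumes A: "A \<in> sets borel" "A \<subseteq> Xs" and B: "B \<in> sets borel" "B \<subseteq> Xs" and mix: "mixes A B"
  shows "mixes A (Xs - B)"
proof (rule mixes_cong)
  fix t :: real assume t: "0 \<le> t"
  have "Fl t A \<inter> (Xs - B) = Fl t A - Fl t A \<inter> B" using Fl_subset by auto
  then show "vol (Fl t A \<inter> (Xs - B)) = vol A - vol (Fl t A \<inter> B)"
    using measure_Diff_Xs[OF Fl_borel[OF A(1) t] Fl_subset, of "Fl t A \<inter> B"] Fl_borel[OF A(1) t] B Fl_measure[OF A t]
    by simp
next
  have "((\<lambda>t. vol A - vol (Fl t A \<inter> B)) \<longlongrightarrow>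
     vol A - vol A * vol B / vol Xs) at_top"
    using mix unfolding mixes_def by (intro tendsto_diff tendsto_const)
  also have "vol A - vol A * vol B / vol Xs
      = vol A * vol (Xs - B) / vol Xs"
    unfolding measure_Diff_Xs[OF Xs_borel order_refl B] using measure_Xs_pos by (simp add: field_simps)
  finally show "((\<lambda>t. vol A - vol (Fl t A \<inter> B)) \<longlongrightarrow>
     vol A * vol (Xs - B) / vol Xs) at_top" .
qed

lemma mixes_Diff_left:
  assumes A: "A \<in> sets borel" "A \<subseteq> Xs" and B: "B \<in> sets borel" "B \<subseteq> Xs" and mix: "mixes A B"
  shows "mixes (Xs - A) B"
proof (rule mixes_cong)
  fix t :: real assume t: "0 \<le> t"
  \<comment> \<open>Invariance of area shows that \<open>Fl t Xs\<close> fills \<open>Xs\<close> up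
    to a null set, which is enough to compare complements.\<close>
  define F where "F = Fl t Xs"
  have F: "F \<in> sets borel" "F \<subseteq> Xs" unfolding F_def using Fl_borel[OF Xs_borel t] Fl_subset by auto
  have FX: "vol (Xs - F) = 0"
    using measure_Diff_Xs[OF Xs_borel order_refl F] Fl_measure[OF Xs_borel order_refl t] by (simp add: F_def)
  have FA: "Fl t A \<subseteq> F" using A(2) unfolding F_def Fl_def by auto
  have b: "Fl t A \<in> sets borel" by (rule Fl_borel[OF A(1) t])
  have e: "Fl t (Xs - A) \<inter> B = (F \<inter> B) - (Fl t A \<inter> B)" unfolding F_def Fl_def by auto
  have "vol (Fl t (Xs - A) \<inter> B) = vol (F \<inter> B) - vol (Fl t A \<inter> B)"
    unfolding e using F B b FA by (intro measure_Diff_Xs) auto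
  moreover have "vol (F \<inter> B) = vol B"
  proof -
    have "vol (B - F \<inter> B) \<le> vol (Xs - F)"
      using F B Xs_borel by (intro measure_mono_Xs) auto
    then have "vol (B - F \<inter> B) = 0" using FX measure_nonneg[of lborel "B - F \<inter> B"] by simp
    then show ?thesis using measure_Diff_Xs[OF B, of "F \<inter> B"] F B by auto
  qed
  ultimately show "vol (Fl t (Xs - A) \<inter> B) = vol B - vol (Fl t A \<inter> B)" by simp
next
  have "((\<lambda>t. vol B - vol (Fl t A \<inter> B)) \<longlongrightarrow>
     vol B - vol A * vol B / vol Xs) at_top"
    using mix unfolding mixes_def by (intro tendsto_diff tendsto_const)
  also have "vol B - vol A * vol B / vol Xs
      = vol (Xs - A) * vol B / vol Xs"
    unfolding measure_Diff_Xs[OF Xs_borel order_refl A] using measure_Xs_pos by (simp add: field_simps)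
  finally show "((\<lambda>t. vol B - vol (Fl t A \<inter> B)) \<longlongrightarrow>
     vol (Xs - A) * vol B / vol Xs) at_top" .
qed

lemma mixes_empty: "mixes A {}" "mixes {} B"
  unfolding mixes_def by (auto simp: Fl_def)

lemma sigma_sets_rects_borel:
  assumes "A \<in> sigma_sets Xs rects"
  shows "A \<in> sets borel" "A \<subseteq> Xs"
proof -
  have sub: "rects \<subseteq> Pow Xs" using rects_borel by auto
  show "A \<subseteq> Xs" using sigma_sets_into_sp[OF sub assms] .
  show "A \<in> sets borel"
    using assms
  proof (induction rule: sigma_sets.induct)
    case (Basic A)
    then show ?case using rects_borel by blast
  next
    case (Compl A)
    then show ?case using Xs_borel by auto
  qed auto
qed

text \<open>The pi-lambda argument is applied to one argument at a time: here the first set is still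
  a rectangle, in \<open>mixes_sigma\<close> it becomes arbitrary.\<close>

lemma mixes_rects_sigma:
  assumes "A \<in> rects" "B \<in> sigma_sets Xs rects"
  shows "mixes A B"
proof -
  have sub: "rects \<subseteq> Pow Xs" using rects_borel by auto
  have A: "A \<in> sets borel" "A \<subseteq> Xs" using rects_borel[OF assms(1)] by auto
  show ?thesis
    using Int_stable_rects sub assms(2)
  proof (induction rule: sigma_sets_induct_disjoint)
    case (basic B)
    then show ?case unfolding mixes_def by (intro mix_rects assms)
  next
    case empty
    show ?case by (rule mixes_empty)
  next
    case (compl B)
    then show ?case by (intro mixes_Diff_right A sigma_sets_rects_borel)
  next
    case (union D)
    then have "D i \<in> sigma_sets Xs rects" for i by auto
    note sigma_sets_rects_borel[OF this]
    then show ?case using union by (intro mixes_UN_right A)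
  qed
qed

lemma mixes_sigma:
  assumes "A \<in> sigma_sets Xs rects" "B \<in> sigma_sets Xs rects"
  shows "mixes A B"
proof -
  have sub: "rects \<subseteq> Pow Xs" using rects_borel by auto
  note B = sigma_sets_rects_borel[OF assms(2)]
  show ?thesis
    using Int_stable_rects sub assms(1)
  proof (induction rule: sigma_sets_induct_disjoint)
    case (basic A)
    then show ?case by (intro mixes_rects_sigma assms)
  next
    case empty
    show ?case by (rule mixes_empty)
  next
    case (compl A)
    then show ?case by (intro mixes_Diff_left B sigma_sets_rects_borel)
  next
    case (union D)
    then have "D i \<in> sigma_sets Xs rects" for i by auto
    note sigma_sets_rects_borel[OF this]
    then show ?case using union by (intro mixes_UN_left B)
  qed
qed

lemma mixes_borel:
  assumes "A \<in> sets borel" "A \<subseteq> Xs" "B \<in> sets borel" "B \<subseteq> Xs"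
  shows "mixes A B"
  using mixes_sigma[OF sigma_sets_rects[OF assms(1)] sigma_sets_rects[OF assms(3)]] assms(2,4)
  by (simp add: Int_absorb2)

text \<open>Mixing is defined for Lebesgue sets. Squeezing such a set, or an intersection with its
  flow preimage, between a Borel set and the union of that set with a Borel null set reduces the
  claim to Borel sets.\<close>

lemma lebesgue_sandwich:
  assumes P: "P \<in> sets borel" "P \<subseteq> Xs" and Z: "Z \<in> sets borel" "Z \<subseteq> Xs" "vol Z = 0"
    and E: "P \<subseteq> E" "E \<subseteq> P \<union> Z"
  shows "measure lebesgue E = vol P"
proof -
  have fZ: "Z \<in> fmeasurable lborel" and fPZ: "P \<union> Z \<in> fmeasurable lborel" and fP: "P \<in> fmeasurable lborel"
    using Xs_fm P Z by auto
  have "emeasure lborel Z = 0" using fZ Z(3) by (simp add: emeasure_eq_measure2)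
  then have null: "Z \<in> null_sets lborel" using Z(1) by (simp add: null_sets_def)
  have El: "E \<in> sets lebesgue"
    by (rule sets_completionI[of _ P "E - P" Z]) (use E P null in auto)
  have f: "P \<union> Z \<in> fmeasurable lebesgue"
    using fPZ by (intro fmeasurableI) (auto simp: fmeasurable_def)
  have "measure lebesgue P \<le> measure lebesgue E"
    using E P El f by (intro measure_mono_fmeasurable) (auto intro: fmeasurableI2)
  moreover have "measure lebesgue E \<le> measure lebesgue (P \<union> Z)"
    using E El f by (intro measure_mono_fmeasurable) auto
  moreover have "vol (P \<union> Z) \<le> vol P + 0"
    using measure_Un_le[of P lborel Z] P Z by simp
  ultimately show ?thesis using P Z by simp
qed

lemma lebesgue_decomp:
  assumes "A \<in> sets lebesgue" "A \<subseteq> Xs"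
  obtains P Z where "P \<in> sets borel" "P \<subseteq> Xs" "Z \<in> sets borel" "Z \<subseteq> Xs" "vol Z = 0"
    "P \<subseteq> A" "A \<subseteq> P \<union> Z"
proof -
  obtain P N N' where *: "A = P \<union> N" "N \<subseteq> N'" "N' \<in> null_sets lborel" "P \<in> sets lborel"
    using assms(1) by (rule sets_completionE)
  have "N' \<inter> Xs \<in> null_sets lborel" using *(3) Xs_borel by (intro null_set_Int2) auto
  then have "vol (N' \<inter> Xs) = 0" by (simp add: null_sets_def measure_def)
  moreover have "N' \<inter> Xs \<in> sets borel" using *(3) Xs_borel by (auto simp: null_sets_def)
  ultimately show ?thesis using * assms(2) by (intro that[of P "N' \<inter> Xs"]) auto
qed

lemma staircase_susp_mixing: "susp_mixing staircase f"
  unfolding susp_mixing_def Let_def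
proof (intro allI impI)
  fix A B :: "(real \<times> real) set"
  assume "A \<in> sets lebesgue" "B \<in> sets lebesgue" "A \<subseteq> susp_space f" "B \<subseteq> susp_space f"
  then have AB: "A \<in> sets lebesgue" "A \<subseteq> Xs" "B \<in> sets lebesgue" "B \<subseteq> Xs" by (auto simp: Xs_def)
  obtain P Z where P: "P \<in> sets borel" "P \<subseteq> Xs" "Z \<in> sets borel" "Z \<subseteq> Xs" "vol Z = 0"
    "P \<subseteq> A" "A \<subseteq> P \<union> Z" using lebesgue_decomp[OF AB(1,2)] .
  obtain Q Y where Q: "Q \<in> sets borel" "Q \<subseteq> Xs" "Y \<in> sets borel" "Y \<subseteq> Xs" "vol Y = 0"
    "Q \<subseteq> B" "B \<subseteq> Q \<union> Y" using lebesgue_decomp[OF AB(3,4)] .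
  define X where "X = vol Xs"
  have mA: "measure lebesgue A = vol P" by (rule lebesgue_sandwich[OF P])
  have mB: "measure lebesgue B = vol Q" by (rule lebesgue_sandwich[OF Q])
  have mX: "measure lebesgue (susp_space f) = X"
    using Xs_borel unfolding X_def Xs_def by simp
  have mE: "measure lebesgue ({z \<in> susp_space f. susp_flow staircase f t z \<in> A} \<inter> B) = vol (Fl t P \<inter> Q)"
    if t: "0 \<le> t" for t
  proof (rule lebesgue_sandwich[where Z = "Fl t Z \<union> Y"])
    show "Fl t P \<inter> Q \<in> sets borel" "Fl t P \<inter> Q \<subseteq> Xs"
      using Fl_borel[OF P(1) t] Q by auto
    show "Fl t Z \<union> Y \<in> sets borel" "Fl t Z \<union> Y \<subseteq> Xs"
      using Fl_borel[OF P(3) t] Q Fl_subset by auto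
    \<comment> \<open>The preimage of the exceptional set is again null because the flow preserves
      area.\<close>
    have "vol (Fl t Z \<union> Y) \<le> vol (Fl t Z) + vol Y"
      using Fl_borel[OF P(3) t] Q by (intro measure_Un_le) auto
    then show "vol (Fl t Z \<union> Y) = 0"
      using Fl_measure[OF P(3,4) t] P(5) Q(5) measure_nonneg[of lborel "Fl t Z \<union> Y"] by simp
    show "Fl t P \<inter> Q \<subseteq> {z \<in> susp_space f. susp_flow staircase f t z \<in> A} \<inter> B"
      using P Q by (auto simp: Fl_def Xs_def)
    show "{z \<in> susp_space f. susp_flow staircase f t z \<in> A} \<inter> B \<subseteq> Fl t P \<inter> Q \<union> (Fl t Z \<union> Y)"
      using P Q by (auto simp: Fl_def Xs_def)
  qed
  have "((\<lambda>t. vol (Fl t P \<inter> Q) / X) \<longlongrightarrow> vol P * vol Q / X / X) at_top"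
    using mixes_borel[OF P(1,2) Q(1,2)] measure_Xs_pos unfolding mixes_def X_def
    by (intro tendsto_divide tendsto_const) auto
  moreover have "\<forall>\<^sub>F t in at_top. vol (Fl t P \<inter> Q) / X
      = measure lebesgue ({z \<in> susp_space f. susp_flow staircase f t z \<in> A} \<inter> B) / X"
    using eventually_ge_at_top[of 0] by eventually_elim (simp add: mE)
  ultimately have "((\<lambda>t. measure lebesgue ({z \<in> susp_space f. susp_flow staircase f t z \<in> A} \<inter> B) / X) \<longlongrightarrow>
      vol P * vol Q / X / X) at_top"
    by (rule Lim_transform_eventually)
  then show "((\<lambda>t. measure lebesgue ({z \<in> susp_space f. susp_flow staircase f t z \<in> A} \<inter> B) / measure lebesgue (susp_space f))
     \<longlongrightarrow> measure lebesgue A / measure lebesgue (susp_space f) * (measure lebesgue B / measure lebesgue (susp_space f))) at_top"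
    unfolding mA mB mX by simp
qed

end

theorem theorem2p1:
  fixes p q :: real and f :: "real \<Rightarrow> real"
  assumes "q > 0" and "p > q"
    and "rationally_independent p q"
    and "\<And>x. f x = (if x < stair_a staircase_r then p else q)"
  shows "susp_mixing staircase f"
proof -
  interpret staircase_flow p q f by unfold_locales (use assms in auto)
  show ?thesis by (rule staircase_susp_mixing)
qed

end
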